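(* Let $D\subset\mathbb{R}^n$ be a bounded open set. Let $\Phi$ be a Young function with $\phi=\Phi'$ such that, for some fixed numbers $p^\pm$, $1<p^-\le \frac{t\phi'(t)}{\phi(t)}\le p^+<\infty$ for all $t>0$, and such that $\phi$ is convex on $[0,\infty)$. Let $f\in L^{\Phi^*}(D)$ and let $\Omega_k$ ($k\in\mathbb{N}$) and $\Omega$ be open subsets of $D$. If $\Omega_k\to\Omega$ in the Hausdorff complementary topology and $\mathrm{cap}_\Phi(\Omega_k\setminus\Omega,D)\to0$ as $k\to\infty$, then, up to a subsequence, $u_{\Omega_k,f}\to u_{\Omega,f}$ strongly in $W^{1,\Phi}_0(D)$.
   Context: A Young function is $\Phi:[0,\infty)\to[0,\infty)$ of the form $\Phi(t)=\int_0^t\phi(\tau)\,d\tau$, where $\phi$ is right continuous and nondecreasing, $\phi(0)=0$, $\phi(t)>0$ for $t>0$, and $\phi(t)\to\infty$ as $t\to\infty$ (when $\phi'$ appears, $\phi$ is assumed differentiable on $(0,\infty)$). Its complementary function is $\Phi^*(t)=\sup\{tw-\Phi(w):w>0\}$. For open $\Omega\subset\mathbb{R}^n$, $L^\Phi(\Omega)$ is the set of measurable $u$ with $\int_\Omega\Phi(|u|)\,dx<\infty$, normed by $\|u\|_{L^\Phi(\Omega)}=\inf\{\lambda>0:\int_\Omega\Phi(|u|/\lambda)\,dx\le1\}$; $L^{\Phi^*}(\Omega)$ is defined likewise with $\Phi^*$. $W^{1,\Phi}(\Omega)=\{u\in L^\Phi(\Omega):|\nabla u|\in L^\Phi(\Omega)\}$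 (distributional derivatives) with norm $\|u\|_{L^\Phi(\Omega)}+\|\nabla u\|_{L^\Phi(\Omega)}$, and $W^{1,\Phi}_0(\Omega)$ is the closure of $C_c^\infty(\Omega)$ in this norm. For open $\Omega\subset D$ and $f\in L^{\Phi^*}(D)$, $u_{\Omega,f}\in W^{1,\Phi}_0(\Omega)$ denotes the weak solution of $-\Delta_\phi u=f$ in $\Omega$, $u=0$ on $\partial\Omega$, where $\Delta_\phi u=\mathrm{div}\big(\frac{\phi(|\nabla u|)}{|\nabla u|}\nabla u\big)$; that is, $\int_\Omega\frac{\phi(|\nabla u|)}{|\nabla u|}\nabla u\cdot\nabla v\,dx=\int_\Omega fv\,dx$ for all $v\in W^{1,\Phi}_0(\Omega)$ (with $\frac{\phi(|a|)}{|a|}a:=0$ for $a=0$). Functions in $W^{1,\Phi}_0(\Omega)$ are extended by zero and regarded as elements of $W^{1,\Phi}_0(D)$. Hausdorff complementary topology: for open $\Omega_1,\Omega_2\subset D$, $d_{H^c}(\Omega_1,\Omega_2)=d(\Omega_1^c,\Omega_2^c)$, where $d$ is the usual Hausdorff distance and $^c$ denotes complement in $\mathbb{R}^n$; $\Omega_k\to\Omega$ in this topology means $d_{H^c}(\Omega_k,\Omega)\to0$. Relative $\Phi$-capacity: for compact $K\subset D$ let $R_\Phi(K,D)=\{u\in W^{1,\Phi}(D)\cap C_0(D): u>1\text{ on }K,\ u\ge0\}$, where $C_0(D)$ is the set of continuous functions with compact support in $D$, and $\mathrm{cap}^*_\Phi(K,D)=\inf_{u\in R_\Phi(K,D)}\int_D\Phi(|\nabla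 u|)\,dx$. For open $U\subset D$, $\mathrm{cap}_\Phi(U,D)=\sup\{\mathrm{cap}^*_\Phi(K,D):K\subset U\text{ compact}\}$; for arbitrary $E\subset D$, $\mathrm{cap}_\Phi(E,D)=\inf\{\mathrm{cap}_\Phi(U,D):E\subset U\subset D,\ U\text{ open}\}$. *)

theory Defs
  imports "HOL-Analysis.Analysis"
begin

section \<open>Young functions\<close>

text \<open>Functions on \<open>[0,\<infinity>)\<close> are modelled as functions on \<^typ>\<open>real\<close> whose values at negative
  arguments are irrelevant.\<close>

definition young_function :: "(real \<Rightarrow> real) \<Rightarrow> (real \<Rightarrow> real) \<Rightarrow> bool" where
  "young_function \<Phi> \<phi> \<longleftrightarrow>
     (\<forall>t\<ge>0. continuous (at_right t) \<phi>) \<and>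
     mono_on {0..} \<phi> \<and>
     \<phi> 0 = 0 \<and>
     (\<forall>t>0. \<phi> t > 0) \<and>
     filterlim \<phi> at_top at_top \<and>
     (\<forall>t\<ge>0. (\<phi> has_integral \<Phi> t) {0..t})"

text \<open>The supremum is finite because \<open>\<phi>(t) \<rightarrow> \<infinity>\<close>, so the real-valued \<open>SUP\<close> is meaningful.\<close>

definition complementary :: "(real \<Rightarrow> real) \<Rightarrow> real \<Rightarrow> real" where
  "complementary \<Phi> t = (SUP w\<in>{0<..}. t * w - \<Phi> w)"


section \<open>Orlicz spaces\<close>

definition orlicz_space :: "(real \<Rightarrow> real) \<Rightarrow> 'a::euclidean_space set \<Rightarrow> ('a \<Rightarrow> real) set" where
  "orlicz_space \<Phi> \<Omega> =
     {u. u \<in> borel_measurable (lebesgue_on \<Omega>) \<and>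
         (\<integral>\<^sup>+x. ennreal (\<Phi> \<bar>u x\<bar>) \<partial>lebesgue_on \<Omega>) < \<infinity>}"

definition orlicz_norm :: "(real \<Rightarrow> real) \<Rightarrow> 'a::euclidean_space set \<Rightarrow> ('a \<Rightarrow> real) \<Rightarrow> real" where
  "orlicz_norm \<Phi> \<Omega> u =
     Inf {l. l > 0 \<and> (\<integral>\<^sup>+x. ennreal (\<Phi> (\<bar>u x\<bar> / l)) \<partial>lebesgue_on \<Omega>) \<le> 1}"


section \<open>Test functions and distributional gradients\<close>

primrec Ck_function :: "nat \<Rightarrow> ('a::euclidean_space \<Rightarrow> real) \<Rightarrow> bool" where
  "Ck_function 0 g \<longleftrightarrow> continuous_on UNIV g"
| "Ck_function (Suc k) g \<longleftrightarrow>
     (\<forall>x. g differentiable (at x)) \<and>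
     (\<forall>b\<in>Basis. Ck_function k (\<lambda>x. frechet_derivative g (at x) b))"

text \<open>\<open>C\<^sub>c\<^sup>\<infinity>(\<Omega>)\<close>; its elements are functions on the whole space that vanish off their support.\<close>

definition test_functions :: "'a::euclidean_space set \<Rightarrow> ('a \<Rightarrow> real) set" where
  "test_functions \<Omega> =
     {\<psi>. (\<forall>k. Ck_function k \<psi>) \<and>
         compact (closure {x. \<psi> x \<noteq> 0}) \<and> closure {x. \<psi> x \<noteq> 0} \<subseteq> \<Omega>}"

definition locally_integrable :: "'a::euclidean_space set \<Rightarrow> ('a \<Rightarrow> 'b::euclidean_space) \<Rightarrow> bool" where
  "locally_integrable \<Omega> g \<longleftrightarrow> (\<forall>K. compact K \<and> K \<subseteq> \<Omega> \<longrightarrow> set_integrable lebesgue K g)"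

definition is_weak_gradient ::
    "'a::euclidean_space set \<Rightarrow> ('a \<Rightarrow> real) \<Rightarrow> ('a \<Rightarrow> 'a) \<Rightarrow> bool" where
  "is_weak_gradient \<Omega> u G \<longleftrightarrow>
     locally_integrable \<Omega> u \<and> locally_integrable \<Omega> G \<and>
     (\<forall>\<psi>\<in>test_functions \<Omega>. \<forall>b\<in>Basis.
        (LINT x:\<Omega>|lebesgue. u x * frechet_derivative \<psi> (at x) b) =
        - (LINT x:\<Omega>|lebesgue. (G x \<bullet> b) * \<psi> x))"

text \<open>A weak gradient is unique up to null sets, and everything below depends on it only through
  integrals, so the choice of representative does not matter.\<close>

definition weak_gradient :: "'a::euclidean_space set \<Rightarrow> ('a \<Rightarrow> real) \<Rightarrow> 'a \<Rightarrow> 'a" where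
  "weak_gradient \<Omega> u = (SOME G. is_weak_gradient \<Omega> u G)"


section \<open>Orlicz--Sobolev spaces\<close>

text \<open>Elements are functions on the whole space of which only the values on \<open>\<Omega>\<close> (up to null sets)
  are relevant.\<close>

definition sobolev_space :: "(real \<Rightarrow> real) \<Rightarrow> 'a::euclidean_space set \<Rightarrow> ('a \<Rightarrow> real) set" where
  "sobolev_space \<Phi> \<Omega> =
     {u \<in> orlicz_space \<Phi> \<Omega>.
        \<exists>G. is_weak_gradient \<Omega> u G \<and> (\<lambda>x. norm (G x)) \<in> orlicz_space \<Phi> \<Omega>}"

definition sobolev_norm :: "(real \<Rightarrow> real) \<Rightarrow> 'a::euclidean_space set \<Rightarrow> ('a \<Rightarrow> real) \<Rightarrow> real" where
  "sobolev_norm \<Phi> \<Omega> u =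
     orlicz_norm \<Phi> \<Omega> u + orlicz_norm \<Phi> \<Omega> (\<lambda>x. norm (weak_gradient \<Omega> u x))"

definition sobolev_space_0 :: "(real \<Rightarrow> real) \<Rightarrow> 'a::euclidean_space set \<Rightarrow> ('a \<Rightarrow> real) set" where
  "sobolev_space_0 \<Phi> \<Omega> =
     {u \<in> sobolev_space \<Phi> \<Omega>.
        \<forall>e>0. \<exists>\<psi>\<in>test_functions \<Omega>. sobolev_norm \<Phi> \<Omega> (\<lambda>x. u x - \<psi> x) < e}"

definition zero_extension :: "'a set \<Rightarrow> ('a \<Rightarrow> real) \<Rightarrow> 'a \<Rightarrow> real" where
  "zero_extension \<Omega> u x = (if x \<in> \<Omega> then u x else 0)"

definition tendsto_sobolev_0 ::
    "(real \<Rightarrow> real) \<Rightarrow> 'a::euclidean_space set \<Rightarrow> (nat \<Rightarrow> 'a \<Rightarrow> real) \<Rightarrow> ('a \<Rightarrow> real) \<Rightarrow> bool" where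
  "tendsto_sobolev_0 \<Phi> D v w \<longleftrightarrow>
     (\<forall>k. v k \<in> sobolev_space_0 \<Phi> D) \<and> w \<in> sobolev_space_0 \<Phi> D \<and>
     (\<lambda>k. sobolev_norm \<Phi> D (\<lambda>x. v k x - w x)) \<longlonglongrightarrow> 0"


section \<open>The Dirichlet problem\<close>

text \<open>Division by zero in HOL yields the convention that the flux is \<open>0\<close> where the gradient
  vanishes.\<close>

definition flux :: "(real \<Rightarrow> real) \<Rightarrow> 'a::euclidean_space \<Rightarrow> 'a" where
  "flux \<phi> a = (\<phi> (norm a) / norm a) *\<^sub>R a"

definition is_weak_solution ::
    "(real \<Rightarrow> real) \<Rightarrow> (real \<Rightarrow> real) \<Rightarrow> 'a::euclidean_space set \<Rightarrow> ('a \<Rightarrow> real) \<Rightarrow> ('a \<Rightarrow> real) \<Rightarrow> bool" where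
  "is_weak_solution \<Phi> \<phi> \<Omega> f u \<longleftrightarrow>
     u \<in> sobolev_space_0 \<Phi> \<Omega> \<and>
     (\<forall>v\<in>sobolev_space_0 \<Phi> \<Omega>.
        (LINT x:\<Omega>|lebesgue. flux \<phi> (weak_gradient \<Omega> u x) \<bullet> weak_gradient \<Omega> v x) =
        (LINT x:\<Omega>|lebesgue. f x * v x))"


section \<open>Hausdorff complementary distance\<close>

text \<open>Used for nonempty sets at finite Hausdorff distance only, as is the case for complements of
  subsets of a bounded set.\<close>

definition hausdorff_distance :: "'a::metric_space set \<Rightarrow> 'a set \<Rightarrow> real" where
  "hausdorff_distance A B = max (SUP x\<in>A. infdist x B) (SUP y\<in>B. infdist y A)"

definition hausdorff_compl_distance :: "'a::metric_space set \<Rightarrow> 'a set \<Rightarrow> real" where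
  "hausdorff_compl_distance \<Omega>\<^sub>1 \<Omega>\<^sub>2 = hausdorff_distance (- \<Omega>\<^sub>1) (- \<Omega>\<^sub>2)"


section \<open>Relative capacity\<close>

definition capacity_admissible ::
    "(real \<Rightarrow> real) \<Rightarrow> 'a::euclidean_space set \<Rightarrow> 'a set \<Rightarrow> ('a \<Rightarrow> real) set" where
  "capacity_admissible \<Phi> K D =
     {u \<in> sobolev_space \<Phi> D.
        continuous_on D u \<and> (\<exists>C. compact C \<and> C \<subseteq> D \<and> (\<forall>x\<in>D - C. u x = 0)) \<and>
        (\<forall>x\<in>K. u x > 1) \<and> (\<forall>x\<in>D. u x \<ge> 0)}"

definition capacity_compact ::
    "(real \<Rightarrow> real) \<Rightarrow> 'a::euclidean_space set \<Rightarrow> 'a set \<Rightarrow> ennreal" where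
  "capacity_compact \<Phi> K D =
     (INF u\<in>capacity_admissible \<Phi> K D.
        \<integral>\<^sup>+x. ennreal (\<Phi> (norm (weak_gradient D u x))) \<partial>lebesgue_on D)"

definition capacity_open ::
    "(real \<Rightarrow> real) \<Rightarrow> 'a::euclidean_space set \<Rightarrow> 'a set \<Rightarrow> ennreal" where
  "capacity_open \<Phi> U D = (SUP K\<in>{K. compact K \<and> K \<subseteq> U}. capacity_compact \<Phi> K D)"

definition capacity ::
    "(real \<Rightarrow> real) \<Rightarrow> 'a::euclidean_space set \<Rightarrow> 'a set \<Rightarrow> ennreal" where
  "capacity \<Phi> E D = (INF U\<in>{U. open U \<and> E \<subseteq> U \<and> U \<subseteq> D}. capacity_open \<Phi> U D)"

end

theory Submission
  imports Defs
begin

text \<open>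
  Why the solutions converge.  Write \<open>J(\<psi>) = \<integral> \<Phi>(|\<nabla>\<psi>|) - \<integral> f \<psi>\<close>.  The weak solution \<open>u\<close> on \<open>\<Omega>\<close> minimizes \<open>J\<close>
  over \<open>W\<^sub>0(\<Omega>)\<close>, and likewise \<open>u\<^sub>k\<close> on \<open>\<Omega>\<^sub>k\<close>.  Because \<open>\<phi>\<close> is convex, \<open>\<Phi>\<close> is convex even as a function of
  \<open>t\<^sup>2\<close>; the parallelogram law then gives Clarkson's inequality and with it the quantitative minimality
  \<open>J(\<psi>) - J(u\<^sub>k) \<ge> 2 \<integral> \<Phi>(|\<nabla>\<psi> - \<nabla>u\<^sub>k|/2)\<close> for every \<open>\<psi>\<close> supported in \<open>\<Omega>\<^sub>k\<close> (\<open>flux_convexity\<close>,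
  \<open>energy_gap\<close>).  It therefore suffices to compare minimal energies, and neither weak compactness nor
  an identification of weak limits enters.

  Take a test function \<open>\<psi>\<close> in \<open>\<Omega>\<close> close to \<open>u\<close>.  Its compact support lies in \<open>\<Omega>\<^sub>k\<close> for large \<open>k\<close> by
  Hausdorff convergence of the complements (\<open>compact_subset_hausdorff_limit\<close>), so it competes with
  \<open>u\<^sub>k\<close>.  If moreover \<open>J(u) \<le> J(u\<^sub>k) + \<epsilon>\<close> for large \<open>k\<close>, the gap shows that \<open>\<nabla>\<psi>\<close> and \<open>\<nabla>u\<^sub>k\<close> are close, and
  Poincare's inequality (\<open>poincare\<close>) yields the same for the functions (\<open>solutions_converge\<close>).

  The lower bound \<open>J(u) \<le> J(u\<^sub>k) + \<epsilon>\<close> (\<open>energy_lower_bound\<close>) is where the capacity is used.  Approximate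
  \<open>u\<^sub>k\<close> by a test function \<open>\<psi>\<close> in \<open>\<Omega>\<^sub>k\<close> with compact support \<open>K\<close>.  The compact set \<open>K - \<Omega>\<close> has small
  capacity, so after mollification there is a test function \<open>w \<ge> 0\<close> with \<open>w > 1\<close> on \<open>K - \<Omega>\<close> and
  \<open>\<integral> \<Phi>(|\<nabla>w|)\<close> small (\<open>capacity_potential\<close>).  Multiplying \<open>\<psi>\<close> by a smooth cut-off of \<open>w\<close> that vanishes for
  \<open>w \<ge> 1\<close> gives a test function in \<open>\<Omega>\<close>, which competes with \<open>u\<close>.  Its gradient contains the product of
  \<open>\<psi>\<close> and \<open>\<nabla>w\<close>, so \<open>\<psi>\<close> is first replaced by the bounded function \<open>M sin(\<psi>/M)\<close>.  The two factors
  multiplying \<open>\<nabla>\<psi>\<close> are at most \<open>1\<close>, hence the energy rises only by a small amount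
  (\<open>truncated_competitor\<close>); the pairing with \<open>f\<close> changes little uniformly in \<open>\<psi>\<close>, because \<open>f\<close> is bounded
  up to a small remainder in the dual space (\<open>pairing_eps\<close>).

  All integrals are taken over the whole space, with \<open>u\<close> and its weak gradient extended by zero
  (\<open>W0_pair\<close>).  The doubling property makes norm convergence equivalent to convergence of the modular
  \<open>\<integral> \<Phi>(|v|)\<close>, and the almost-everywhere uniqueness of weak gradients (\<open>weak_gradient_unique\<close>) links the
  extended pair to the gradient of the extension.
\<close>

section \<open>Smooth functions\<close>

abbreviation partial :: "('a::euclidean_space \<Rightarrow> real) \<Rightarrow> 'a \<Rightarrow> 'a \<Rightarrow> real" where
  "partial g b x \<equiv> frechet_derivative g (at x) b"

definition smooth :: "('a::euclidean_space \<Rightarrow> real) \<Rightarrow> bool" where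
  "smooth g \<longleftrightarrow> (\<forall>k. Ck_function k g)"

lemma has_derivative_frechet:
  "g differentiable (at x) \<Longrightarrow> (g has_derivative frechet_derivative g (at x)) (at x)"
  by (simp add: frechet_derivative_works)

lemma frechet_derivative_eq:
  "(g has_derivative g') (at x) \<Longrightarrow> frechet_derivative g (at x) = g'"
  using frechet_derivative_at by metis

lemma Ck_function_SucI:
  assumes "\<And>x. (g has_derivative g' x) (at x)"
    and "\<And>b. b \<in> Basis \<Longrightarrow> Ck_function k (\<lambda>x. g' x b)"
  shows "Ck_function (Suc k) g"
proof -
  have "frechet_derivative g (at x) = g' x" for x
    using assms(1) by (rule frechet_derivative_eq)
  then show ?thesis using assms by (auto simp: differentiable_def)
qed

lemma Ck_function_pred: "Ck_function (Suc k) g \<Longrightarrow> Ck_function k g"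
proof (induction k arbitrary: g)
  case 0
  then show ?case by (auto intro!: continuous_at_imp_continuous_on differentiable_imp_continuous_within)
next
  case (Suc k)
  then show ?case by simp
qed

lemma Ck_function_const: "Ck_function k (\<lambda>x. c)"
proof (induction k arbitrary: c)
  case (Suc k)
  show ?case by (rule Ck_function_SucI[of _ "\<lambda>x h. 0"]) (auto intro: Suc)
qed auto

lemma Ck_function_inner: "Ck_function k (\<lambda>x. x \<bullet> c)"
proof (cases k)
  case (Suc n)
  show ?thesis unfolding Suc
    by (rule Ck_function_SucI[of _ "\<lambda>x h. h \<bullet> c"]) (auto intro!: derivative_eq_intros Ck_function_const)
qed (auto intro!: continuous_intros)

lemma Ck_function_add:
  "Ck_function k f \<Longrightarrow> Ck_function k g \<Longrightarrow> Ck_function k (\<lambda>x. f x + g x)"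
proof (induction k arbitrary: f g)
  case 0
  then show ?case by (auto intro: continuous_intros)
next
  case (Suc k)
  show ?case
    by (rule Ck_function_SucI[of _ "\<lambda>x h. frechet_derivative f (at x) h + frechet_derivative g (at x) h"])
      (use Suc.prems in \<open>auto intro!: derivative_intros has_derivative_frechet Suc.IH\<close>)
qed

lemma Ck_function_mult:
  "Ck_function k f \<Longrightarrow> Ck_function k g \<Longrightarrow> Ck_function k (\<lambda>x. f x * g x)"
proof (induction k arbitrary: f g)
  case 0
  then show ?case by (auto intro: continuous_intros)
next
  case (Suc k)
  have fg: "Ck_function k f" "Ck_function k g"
    using Suc.prems Ck_function_pred by blast+
  show ?case
    by (rule Ck_function_SucI[of _ "\<lambda>x h. f x * frechet_derivative g (at x) h + frechet_derivative f (at x) h * g x"])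
      (use Suc.prems fg in \<open>auto intro!: has_derivative_mult has_derivative_frechet Suc.IH Ck_function_add\<close>)
qed

lemma smooth_differentiable: "smooth g \<Longrightarrow> g differentiable (at x)"
  unfolding smooth_def using Ck_function.simps(2) by blast

lemma smooth_has_derivative: "smooth g \<Longrightarrow> (g has_derivative frechet_derivative g (at x)) (at x)"
  by (simp add: has_derivative_frechet smooth_differentiable)

lemma smooth_partial: "smooth g \<Longrightarrow> b \<in> Basis \<Longrightarrow> smooth (partial g b)"
  unfolding smooth_def using Ck_function.simps(2) by blast

lemma smooth_continuous: "smooth g \<Longrightarrow> continuous_on A g"
  unfolding smooth_def using Ck_function.simps(1) continuous_on_subset by blast

lemma smooth_const: "smooth (\<lambda>x. c)"
  and smooth_inner: "smooth (\<lambda>x. x \<bullet> d)"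
  and smooth_add: "smooth f \<Longrightarrow> smooth g \<Longrightarrow> smooth (\<lambda>x. f x + g x)"
  and smooth_mult: "smooth f \<Longrightarrow> smooth g \<Longrightarrow> smooth (\<lambda>x. f x * g x)"
  by (auto simp: smooth_def Ck_function_const Ck_function_inner Ck_function_add Ck_function_mult)

lemma smooth_diff: "smooth f \<Longrightarrow> smooth g \<Longrightarrow> smooth (\<lambda>x. f x - g x)"
  using smooth_add[of f "\<lambda>x. (- 1) * g x"] smooth_mult[OF smooth_const, of g "- 1"] by simp

lemma smooth_sum: "(\<And>i. i \<in> I \<Longrightarrow> smooth (f i)) \<Longrightarrow> smooth (\<lambda>x. \<Sum>i\<in>I. f i x)"
  by (induction I rule: infinite_finite_induct) (auto intro: smooth_const smooth_add)

lemma smooth_prod: "(\<And>i. i \<in> I \<Longrightarrow> smooth (f i)) \<Longrightarrow> smooth (\<lambda>x. \<Prod>i\<in>I. f i x)"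
  by (induction I rule: infinite_finite_induct) (auto intro: smooth_const smooth_mult)

text \<open>A real function is composed with a smooth one along the whole list \<open>F\<close> of its derivatives,
  since each differentiation moves one place up in that list.\<close>

lemma smooth_compose:
  assumes F: "\<And>n t. (F n has_real_derivative F (Suc n) t) (at t)" and g: "smooth g"
  shows "smooth (\<lambda>x. F n (g x))"
proof -
  have "Ck_function k (\<lambda>x. F n (g x))" for k n
  proof (induction k arbitrary: n)
    case 0
    have "continuous_on UNIV (F n)"
      by (intro continuous_at_imp_continuous_on ballI DERIV_isCont[OF F])
    then show ?case by (auto intro: continuous_on_compose2 smooth_continuous[OF g])
  next
    case (Suc k)
    show ?case
    proof (rule Ck_function_SucI[of _ "\<lambda>x h. F (Suc n) (g x) * frechet_derivative g (at x) h"])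
      show "((\<lambda>x. F n (g x)) has_derivative (\<lambda>h. F (Suc n) (g x) * frechet_derivative g (at x) h)) (at x)" for x
        using has_derivative_compose[OF smooth_has_derivative[OF g, of x], of "F n"] F[of n "g x"]
        by (auto simp: has_field_derivative_def)
      show "Ck_function k (\<lambda>x. F (Suc n) (g x) * partial g b x)" if "b \<in> Basis" for b
        using Suc.IH smooth_partial[OF g that] by (auto intro!: Ck_function_mult simp: smooth_def)
    qed
  qed
  then show ?thesis by (simp add: smooth_def)
qed

lemma smooth_sin: "smooth g \<Longrightarrow> smooth (\<lambda>x. sin (g x))"
proof -
  assume g: "smooth g"
  let ?F = "\<lambda>n t. sin (t + real n * (pi/2))"
  have "(?F n has_real_derivative ?F (Suc n) t) (at t)" for n t
  proof -
    have "?F (Suc n) t = sin ((t + real n * (pi/2)) + pi/2)"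
      by (rule arg_cong[of _ _ sin]) (simp add: field_simps)
    then have "cos (t + real n * (pi/2)) = ?F (Suc n) t"
      by (simp add: sin_add)
    then show ?thesis by (auto intro!: derivative_eq_intros)
  qed
  from smooth_compose[of ?F, OF this g, of 0] show ?thesis by simp
qed

text \<open>Every derivative of the flat function \<open>exp (-1/t)\<close> is a combination of its multiples by powers
  of \<open>1/t\<close>, and the span of these multiples is closed under differentiation.\<close>

definition flat :: "nat \<Rightarrow> real \<Rightarrow> real" where
  "flat n t = (if t > 0 then exp (- 1 / t) / t ^ n else 0)"

text \<open>One term of the exponential series of \<open>1/t\<close> beats the negative power.\<close>

lemma flat_bound: "norm (flat n t) \<le> fact (Suc n) * \<bar>t\<bar>"
proof (cases "t > 0")
  case True
  have "(\<lambda>k. (1/t) ^ k / fact k) sums exp (1/t)"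
    using exp_converges[of "1/t"] by (simp add: scaleR_conv_of_real field_simps)
  then have "sum (\<lambda>k. (1/t) ^ k / fact k) {Suc n} \<le> exp (1/t)"
    using True by (intro sum_le_suminf[THEN order_trans]) (auto simp: sums_iff)
  then have "exp (- (1/t)) \<le> fact (Suc n) * t ^ Suc n"
    using True le_imp_inverse_le[of "(1/t) ^ Suc n / fact (Suc n)" "exp (1/t)"]
    by (simp add: exp_minus power_divide mult.commute del: fact_Suc power_Suc)
  then have "exp (- (1/t)) / t ^ n \<le> fact (Suc n) * t"
    using True by (simp add: divide_le_eq mult.assoc del: fact_Suc)
  then show ?thesis using True
    by (simp add: flat_def del: fact_Suc)
next
  case False
  then have "flat n t = 0" by (simp add: flat_def)
  moreover have "0 \<le> fact (Suc n) * \<bar>t\<bar>" by (intro mult_nonneg_nonneg) auto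
  ultimately show ?thesis by simp
qed

lemma flat_tendsto_0: "(flat n \<longlongrightarrow> 0) (at 0)"
proof (rule Lim_null_comparison)
  show "((\<lambda>t. fact (Suc n) * \<bar>t\<bar>) \<longlongrightarrow> 0) (at (0::real))"
    by (auto intro!: tendsto_eq_intros)
  show "\<forall>\<^sub>F t in at 0. norm (flat n t) \<le> fact (Suc n) * \<bar>t\<bar>"
    by (intro always_eventually allI flat_bound)
qed

lemma flat_has_derivative:
  "(flat n has_real_derivative flat (n + 2) t - real n * flat (n + 1) t) (at t)"
proof -
  consider "t > 0" | "t < 0" | "t = 0" by linarith
  then show ?thesis
  proof cases
    case 1
    have "((\<lambda>t. exp (- 1 / t) / t ^ n) has_real_derivative flat (n + 2) t - real n * flat (n + 1) t) (at t)"
    proof (cases n)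
      case 0
      then show ?thesis using 1
        by (auto intro!: derivative_eq_intros simp: flat_def field_simps power2_eq_square)
    next
      case (Suc m)
      have "((\<lambda>t. exp (- 1 / t)) has_real_derivative exp (- 1 / t) / t^2) (at t)"
        using 1 by (auto intro!: derivative_eq_intros simp: power2_eq_square)
      from DERIV_quotient[OF this DERIV_pow[of n]] 1
      have "((\<lambda>t. exp (- 1 / t) / t ^ n) has_real_derivative
          (exp (- 1 / t) / t^2 * t ^ n - real n * t ^ (n - 1) * exp (- 1 / t)) / (t ^ n)^2) (at t)"
        by (simp add: power2_eq_square[of "t ^ n"])
      moreover have "(exp (- 1 / t) / t^2 * t ^ n - real n * t ^ (n - 1) * exp (- 1 / t)) / (t ^ n)^2
         = flat (n + 2) t - real n * flat (n + 1) t"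
        using 1 Suc by (simp add: flat_def field_simps power2_eq_square)
      ultimately show ?thesis by simp
    qed
    then show ?thesis
      by (rule has_field_derivative_transform_within_open[of _ _ _ "{0<..}"]) (use 1 in \<open>auto simp: flat_def\<close>)
  next
    case 2
    have "((\<lambda>t. 0) has_real_derivative 0) (at t)" by simp
    then have "(flat n has_real_derivative 0) (at t)"
      by (rule has_field_derivative_transform_within_open[of _ _ _ "{..<0}"]) (use 2 in \<open>auto simp: flat_def\<close>)
    then show ?thesis using 2 by (simp add: flat_def)
  next
    case 3
    have "((\<lambda>h. flat n h / h) \<longlongrightarrow> 0) (at 0)"
      by (rule Lim_transform_eventually[OF flat_tendsto_0[of "Suc n"]])
        (auto simp: eventually_at flat_def intro!: exI[of _ 1])
    then show ?thesis using 3 by (simp add: has_field_derivative_iff flat_def)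
  qed
qed

lemma smooth_flat: assumes g: "smooth g" shows "smooth (\<lambda>x. flat n (g x))"
proof -
  have "Ck_function k (\<lambda>x. flat n (g x))" for k n
  proof (induction k arbitrary: n)
    case 0
    have "continuous_on UNIV (flat n)"
      by (intro continuous_at_imp_continuous_on ballI DERIV_isCont[OF flat_has_derivative])
    then show ?case by (auto intro: continuous_on_compose2 smooth_continuous[OF g])
  next
    case (Suc k)
    let ?F = "\<lambda>t. flat (n + 2) t + (- real n) * flat (n + 1) t"
    show ?case
    proof (rule Ck_function_SucI[of _ "\<lambda>x h. ?F (g x) * frechet_derivative g (at x) h"])
      show "((\<lambda>x. flat n (g x)) has_derivative (\<lambda>h. ?F (g x) * frechet_derivative g (at x) h)) (at x)" for x
        using has_derivative_compose[OF smooth_has_derivative[OF g, of x], of "flat n"] flat_has_derivative[of n "g x"]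
        by (auto simp: has_field_derivative_def)
      show "Ck_function k (\<lambda>x. ?F (g x) * partial g b x)" if "b \<in> Basis" for b
        using Suc.IH smooth_partial[OF g that]
        by (intro Ck_function_mult Ck_function_add Ck_function_const Suc.IH) (auto simp: smooth_def)
    qed
  qed
  then show ?thesis by (simp add: smooth_def)
qed

text \<open>Convolution with a smooth kernel is smooth: every derivative falls on the kernel.\<close>

lemma convolution_has_derivative:
  fixes w \<eta> :: "'a::euclidean_space \<Rightarrow> real"
  assumes w: "continuous_on UNIV w" and \<eta>: "smooth \<eta>"
  shows "((\<lambda>x. integral (cbox p q) (\<lambda>y. w y * \<eta> (x - y))) has_derivative
     (\<lambda>h. \<Sum>b\<in>Basis. (h \<bullet> b) * integral (cbox p q) (\<lambda>y. w y * partial \<eta> b (x - y)))) (at x)"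
proof -
  let ?D = "\<lambda>x y h. w y * frechet_derivative \<eta> (at (x - y)) h"
  have D: "((\<lambda>x. w y * \<eta> (x - y)) has_derivative ?D x y) (at x)" for x y
  proof -
    have "((\<lambda>x. \<eta> (x - y)) has_derivative frechet_derivative \<eta> (at (x - y))) (at x)"
    proof -
      have "((\<lambda>x. x - y) has_derivative (\<lambda>h. h)) (at x)" by (auto intro!: derivative_eq_intros)
      from has_derivative_compose[OF this smooth_has_derivative[OF \<eta>, of "x - y"]] show ?thesis by simp
    qed
    then show ?thesis by (rule has_derivative_mult_right)
  qed
  have bl: "bounded_linear (?D x y)" for x y
    using D has_derivative_bounded_linear by blast
  have app: "blinfun_apply (Blinfun (?D x y)) = ?D x y" for x y
    by (rule bounded_linear_Blinfun_apply[OF bl])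
  have cont: "continuous_on (UNIV \<times> cbox p q) (\<lambda>(x, y). Blinfun (?D x y))"
    unfolding split_def
  proof (rule continuous_on_blinfun_componentwise)
    fix b :: 'a assume b: "b \<in> Basis"
    have c1: "continuous_on A (\<lambda>z. w (snd z))" for A :: "('a\<times>'a) set"
      by (rule continuous_on_compose2[OF w]) (auto intro!: continuous_intros)
    have c2: "continuous_on A (\<lambda>z. partial \<eta> b (fst z - snd z))" for A :: "('a\<times>'a) set"
      by (rule continuous_on_compose2[OF smooth_continuous[OF smooth_partial[OF \<eta> b], of UNIV]])
        (auto intro!: continuous_intros)
    show "continuous_on (UNIV \<times> cbox p q) (\<lambda>z. blinfun_apply (Blinfun (?D (fst z) (snd z))) b)"
      unfolding app by (intro continuous_intros c1 c2)
  qed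
  have cw: "continuous_on (cbox p q) (\<lambda>y. w y * \<eta> (x - y))" for x
    by (intro continuous_intros continuous_on_subset[OF w] continuous_on_compose2[OF smooth_continuous[OF \<eta>, of UNIV]]) auto
  have 1: "((\<lambda>x. integral (cbox p q) (\<lambda>y. w y * \<eta> (x - y))) has_derivative
      blinfun_apply (integral (cbox p q) (\<lambda>y. Blinfun (?D x y)))) (at x within UNIV)"
    by (rule leibniz_rule[OF _ _ cont]) (auto simp: app intro!: D integrable_continuous cw has_derivative_at_withinI)
  have ib: "(\<lambda>y. Blinfun (?D x y)) integrable_on cbox p q"
    by (rule integrable_continuous)
      (use continuous_on_compose2[OF cont, of "cbox p q" "\<lambda>y. (x, y)"] in \<open>simp add: continuous_on_Pair image_subset_iff\<close>)
  have 2: "blinfun_apply (integral (cbox p q) (\<lambda>y. Blinfun (?D x y))) h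
      = integral (cbox p q) (\<lambda>y. ?D x y h)" for h
    using integral_linear[OF ib, of "\<lambda>L. blinfun_apply L h"] by (simp add: o_def app bounded_linear_intros)
  have 3: "integral (cbox p q) (\<lambda>y. ?D x y h)
      = (\<Sum>b\<in>Basis. (h \<bullet> b) * integral (cbox p q) (\<lambda>y. w y * partial \<eta> b (x - y)))" for h
  proof -
    have lin: "bounded_linear (blinfun_apply (integral (cbox p q) (\<lambda>y. Blinfun (?D x y))))"
      by (rule blinfun.bounded_linear_right)
    have "integral (cbox p q) (\<lambda>y. ?D x y h)
       = blinfun_apply (integral (cbox p q) (\<lambda>y. Blinfun (?D x y))) (\<Sum>b\<in>Basis. (h \<bullet> b) *\<^sub>R b)"
      by (simp add: 2 euclidean_representation)
    also have "\<dots> = (\<Sum>b\<in>Basis. (h \<bullet> b) * blinfun_apply (integral (cbox p q) (\<lambda>y. Blinfun (?D x y))) b)"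
      by (simp add: blinfun.sum_right blinfun.scaleR_right)
    finally show ?thesis by (simp add: 2)
  qed
  have "blinfun_apply (integral (cbox p q) (\<lambda>y. Blinfun (?D x y)))
      = (\<lambda>h. \<Sum>b\<in>Basis. (h \<bullet> b) * integral (cbox p q) (\<lambda>y. w y * partial \<eta> b (x - y)))"
    by (rule ext) (rule trans[OF 2 3])
  then show ?thesis using 1 by simp
qed

lemma smooth_convolution:
  fixes w \<eta> :: "'a::euclidean_space \<Rightarrow> real"
  assumes w: "continuous_on UNIV w" and \<eta>: "smooth \<eta>"
  shows "smooth (\<lambda>x. integral (cbox p q) (\<lambda>y. w y * \<eta> (x - y)))"
proof -
  have "Ck_function k (\<lambda>x. integral (cbox p q) (\<lambda>y. w y * \<eta> (x - y)))" if "smooth \<eta>" for k \<eta>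
    using that
  proof (induction k arbitrary: \<eta>)
    case 0
    have "isCont (\<lambda>x. integral (cbox p q) (\<lambda>y. w y * \<eta> (x - y))) x" for x
      by (rule has_derivative_continuous[OF convolution_has_derivative[OF w 0]])
    then show ?case by (simp add: continuous_at_imp_continuous_on)
  next
    case (Suc k)
    show ?case
    proof (rule Ck_function_SucI[OF convolution_has_derivative[OF w Suc.prems]])
      fix b :: 'a assume b: "b \<in> Basis"
      have "(\<Sum>c\<in>Basis. (b \<bullet> c) * integral (cbox p q) (\<lambda>y. w y * partial \<eta> c (x - y)))
         = integral (cbox p q) (\<lambda>y. w y * partial \<eta> b (x - y))" for x
        using b by (simp add: inner_Basis if_distrib[of "\<lambda>z. z * _"] cong: if_cong)
      then show "Ck_function k (\<lambda>x. \<Sum>c\<in>Basis. (b \<bullet> c) * integral (cbox p q) (\<lambda>y. w y * partial \<eta> c (x - y)))"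
        using Suc.IH[OF smooth_partial[OF Suc.prems b]] by simp
    qed
  qed
  then show ?thesis using \<eta> by (simp add: smooth_def)
qed

section \<open>Test functions\<close>

lemma test_functionsI:
  assumes "smooth \<psi>" "compact K" "K \<subseteq> \<Omega>" "\<And>x. x \<notin> K \<Longrightarrow> \<psi> x = 0"
  shows "\<psi> \<in> test_functions \<Omega>"
proof -
  have "closure {x. \<psi> x \<noteq> 0} \<subseteq> K"
    using assms by (intro closure_minimal) (auto simp: compact_imp_closed)
  moreover from this have "compact (closure {x. \<psi> x \<noteq> 0})"
    using assms(2) compact_Int_closed[of K "closure {x. \<psi> x \<noteq> 0}"] by (simp add: Int_absorb1)
  ultimately show ?thesis using assms
    by (auto simp: test_functions_def smooth_def)
qed

lemma test_functionsE:
  assumes "\<psi> \<in> test_functions \<Omega>"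
  obtains K where "smooth \<psi>" "compact K" "K \<subseteq> \<Omega>" "\<And>x. x \<notin> K \<Longrightarrow> \<psi> x = 0"
proof (rule that)
  show "smooth \<psi>" "compact (closure {x. \<psi> x \<noteq> 0})" "closure {x. \<psi> x \<noteq> 0} \<subseteq> \<Omega>"
    using assms by (simp_all add: test_functions_def smooth_def)
  show "\<psi> x = 0" if "x \<notin> closure {x. \<psi> x \<noteq> 0}" for x
    using that closure_subset[of "{x. \<psi> x \<noteq> 0}"] by blast
qed

lemma test_functions_smooth: "\<psi> \<in> test_functions \<Omega> \<Longrightarrow> smooth \<psi>"
  by (auto simp: test_functions_def smooth_def)

lemma test_functions_mono: "\<Omega> \<subseteq> D \<Longrightarrow> \<psi> \<in> test_functions \<Omega> \<Longrightarrow> \<psi> \<in> test_functions D"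
  by (auto simp: test_functions_def)

lemma test_functions_outside: "\<psi> \<in> test_functions \<Omega> \<Longrightarrow> x \<notin> \<Omega> \<Longrightarrow> \<psi> x = 0"
  by (erule test_functionsE) blast

lemma test_functions_zero: "(\<lambda>x. 0) \<in> test_functions \<Omega>"
  by (rule test_functionsI[of _ "{}"]) (auto intro: smooth_const)

lemma test_functions_diff:
  assumes "\<psi> \<in> test_functions \<Omega>" "\<zeta> \<in> test_functions \<Omega>"
  shows "(\<lambda>x. \<psi> x - \<zeta> x) \<in> test_functions \<Omega>"
proof -
  obtain K where K: "smooth \<psi>" "compact K" "K \<subseteq> \<Omega>" "\<And>x. x \<notin> K \<Longrightarrow> \<psi> x = 0"
    using test_functionsE[OF assms(1)] by metis
  obtain L where L: "smooth \<zeta>" "compact L" "L \<subseteq> \<Omega>" "\<And>x. x \<notin> L \<Longrightarrow> \<zeta> x = 0"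
    using test_functionsE[OF assms(2)] by metis
  show ?thesis
    by (rule test_functionsI[of _ "K \<union> L"]) (use K L in \<open>auto intro: smooth_diff compact_Un\<close>)
qed

definition grad :: "('a::euclidean_space \<Rightarrow> real) \<Rightarrow> 'a \<Rightarrow> 'a" where
  "grad \<psi> x = (\<Sum>b\<in>Basis. partial \<psi> b x *\<^sub>R b)"

lemma grad_inner_Basis: "b \<in> Basis \<Longrightarrow> grad \<psi> x \<bullet> b = partial \<psi> b x"
  by (simp add: grad_def inner_sum_left inner_Basis if_distrib[of "\<lambda>z. _ * z"] cong: if_cong)

lemma grad_inner:
  assumes "\<psi> differentiable (at x)"
  shows "grad \<psi> x \<bullet> h = frechet_derivative \<psi> (at x) h"
proof -
  interpret bounded_linear "frechet_derivative \<psi> (at x)"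
    using has_derivative_frechet[OF assms] has_derivative_bounded_linear by blast
  have "frechet_derivative \<psi> (at x) h = frechet_derivative \<psi> (at x) (\<Sum>b\<in>Basis. (h \<bullet> b) *\<^sub>R b)"
    by (simp add: euclidean_representation)
  also have "\<dots> = (\<Sum>b\<in>Basis. (h \<bullet> b) * partial \<psi> b x)"
    by (simp add: sum scaleR)
  also have "\<dots> = grad \<psi> x \<bullet> h"
    by (simp add: grad_def inner_sum_left inner_commute[of h] mult.commute)
  finally show ?thesis by simp
qed

lemma has_derivative_grad: "smooth \<psi> \<Longrightarrow> (\<psi> has_derivative (\<lambda>h. grad \<psi> x \<bullet> h)) (at x)"
  using smooth_has_derivative[of \<psi> x] smooth_differentiable[of \<psi> x] by (simp add: grad_inner)

lemma grad_eqI: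
  assumes "(\<psi> has_derivative (\<lambda>h. v \<bullet> h)) (at x)"
  shows "grad \<psi> x = v"
  by (rule euclidean_eqI) (simp add: grad_inner_Basis frechet_derivative_eq[OF assms])

lemma continuous_on_grad: "smooth \<psi> \<Longrightarrow> continuous_on A (grad \<psi>)"
  unfolding grad_def by (intro continuous_intros smooth_continuous smooth_partial) auto

lemma grad_zero_outside:
  assumes "closed K" "\<And>x. x \<notin> K \<Longrightarrow> \<psi> x = 0" "x \<notin> K"
  shows "grad \<psi> x = 0"
proof (rule grad_eqI)
  have "((\<lambda>x. 0::real) has_derivative (\<lambda>h. 0)) (at x)" by simp
  then show "(\<psi> has_derivative (\<lambda>h. 0 \<bullet> h)) (at x)"
    using has_derivative_transform_within_open[of "\<lambda>x. 0::real" "\<lambda>h. 0" x UNIV "- K" \<psi>] assms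
    by (auto simp: open_Compl)
qed

lemma grad_test_outside: "\<psi> \<in> test_functions \<Omega> \<Longrightarrow> x \<notin> \<Omega> \<Longrightarrow> grad \<psi> x = 0"
proof -
  assume "\<psi> \<in> test_functions \<Omega>" and x: "x \<notin> \<Omega>"
  then obtain K where K: "compact K" "K \<subseteq> \<Omega>" "\<And>x. x \<notin> K \<Longrightarrow> \<psi> x = 0"
    using test_functionsE by metis
  show "grad \<psi> x = 0"
    by (rule grad_zero_outside[OF compact_imp_closed[OF K(1)] K(3)]) (use x K(2) in auto)
qed

lemma grad_diff: "smooth \<psi> \<Longrightarrow> smooth \<zeta> \<Longrightarrow> grad (\<lambda>x. \<psi> x - \<zeta> x) x = grad \<psi> x - grad \<zeta> x"
  by (rule grad_eqI) (auto intro!: derivative_eq_intros has_derivative_grad simp: inner_diff_left)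

lemma integrable_continuous_compact_support:
  fixes g :: "'a::euclidean_space \<Rightarrow> 'b::euclidean_space"
  assumes g: "continuous_on UNIV g" and K: "compact K" "\<And>x. x \<notin> K \<Longrightarrow> g x = 0"
  shows "integrable lebesgue g"
proof -
  have "integrable lborel (\<lambda>x. indicator K x *\<^sub>R g x)"
    by (rule borel_integrable_compact[OF K(1) continuous_on_subset[OF g]]) auto
  moreover have "(\<lambda>x. indicator K x *\<^sub>R g x) = g"
    using K(2) by (auto simp: indicator_def fun_eq_iff)
  ultimately have "integrable lborel g" by simp
  then show ?thesis by (simp add: integrable_completion)
qed

lemma bounded_continuous_compact_support:
  fixes g :: "'a::euclidean_space \<Rightarrow> 'b::real_normed_vector"
  assumes g: "continuous_on UNIV g" and K: "compact K" "\<And>x. x \<notin> K \<Longrightarrow> g x = 0"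
  obtains B where "B > 0" "\<And>x. norm (g x) \<le> B"
proof -
  have "bounded (g ` K)"
    using K(1) g by (meson compact_continuous_image compact_imp_bounded continuous_on_subset subset_UNIV)
  then obtain B where B: "B > 0" "\<And>x. x \<in> K \<Longrightarrow> norm (g x) \<le> B"
    by (auto simp: bounded_pos)
  have "norm (g x) \<le> B" for x using B K(2)[of x] by (cases "x \<in> K") auto
  then show ?thesis using B(1) that by blast
qed

text \<open>Translation invariance makes the integral of every difference quotient vanish; the
  quotients converge boundedly to the derivative.\<close>

lemma integral_directional_derivative_eq_0:
  fixes F :: "'a::euclidean_space \<Rightarrow> real"
  assumes F: "\<And>x. (F has_derivative F' x) (at x)"
    and c: "continuous_on UNIV (\<lambda>x. F' x b)"
    and K: "compact K" "\<And>x. x \<notin> K \<Longrightarrow> F x = 0"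
  shows "integral\<^sup>L lebesgue (\<lambda>x. F' x b) = 0"
proof -
  have z: "F' x b = 0" if "x \<notin> K" for x
  proof -
    have "grad F x = 0" using grad_zero_outside[OF compact_imp_closed[OF K(1)] K(2) that] .
    moreover have "F differentiable (at x)" using F by (auto simp: differentiable_def)
    ultimately show ?thesis using grad_inner[of F x b] frechet_derivative_eq[OF F[of x]] by simp
  qed
  obtain B where B: "B > 0" "\<And>x. norm (F' x b) \<le> B"
    using bounded_continuous_compact_support[OF c K(1) z] by blast
  have cF: "continuous_on UNIV F"
    using F by (meson has_derivative_continuous continuous_at_imp_continuous_on)
  have Fm[measurable]: "F \<in> borel_measurable borel"
    using cF by (rule borel_measurable_continuous_onI)
  have F'm[measurable]: "(\<lambda>x. F' x b) \<in> borel_measurable borel"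
    using c by (rule borel_measurable_continuous_onI)
  have line: "((\<lambda>t. F (x + t *\<^sub>R b)) has_real_derivative F' (x + t *\<^sub>R b) b) (at t)" for x t
  proof -
    have "((\<lambda>t. x + t *\<^sub>R b) has_derivative (\<lambda>h. h *\<^sub>R b)) (at t)"
      by (auto intro!: derivative_eq_intros)
    from has_derivative_compose[OF this F]
    have "((\<lambda>t. F (x + t *\<^sub>R b)) has_derivative (\<lambda>h. F' (x + t *\<^sub>R b) (h *\<^sub>R b))) (at t)" .
    moreover have "F' (x + t *\<^sub>R b) (h *\<^sub>R b) = F' (x + t *\<^sub>R b) b * h" for h
      using linear_cmul[OF has_derivative_linear[OF F]] by simp
    ultimately show ?thesis by (simp add: has_field_derivative_def)
  qed
  obtain R where R: "\<And>x. x \<in> K \<Longrightarrow> norm x \<le> R"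
    using compact_imp_bounded[OF K(1)] by (auto simp: bounded_iff)
  let ?C = "cball 0 (R + norm b) :: 'a set"
  define s where "s n x = real (Suc n) * (F (x + (1 / real (Suc n)) *\<^sub>R b) - F x)" for n x
  have bound: "norm (s n x) \<le> B * indicator ?C x" for n x
  proof (cases "x \<in> ?C")
    case False
    then have "R + norm b < norm x" by simp
    moreover have "norm ((1 / real (Suc n)) *\<^sub>R b) \<le> norm b"
      using mult_right_mono[of "1 / real (Suc n)" 1 "norm b"] by simp
    moreover have "norm x \<le> norm (x + (1 / real (Suc n)) *\<^sub>R b) + norm ((1 / real (Suc n)) *\<^sub>R b)"
      using norm_triangle_ineq4[of "x + (1 / real (Suc n)) *\<^sub>R b" "(1 / real (Suc n)) *\<^sub>R b"] by simp
    ultimately have "norm (x + (1 / real (Suc n)) *\<^sub>R b) > R" "norm x > R"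
      using norm_ge_zero[of b] by linarith+
    then have "x + (1 / real (Suc n)) *\<^sub>R b \<notin> K" "x \<notin> K" using R by (meson not_le)+
    then have "s n x = 0" using K(2) by (simp add: s_def)
    then show ?thesis using B by simp
  next
    case True
    obtain t where "F (x + (1 / real (Suc n)) *\<^sub>R b) - F (x + 0 *\<^sub>R b) = (1 / real (Suc n) - 0) * F' (x + t *\<^sub>R b) b"
      using MVT2[of 0 "1 / real (Suc n)" "\<lambda>t. F (x + t *\<^sub>R b)" "\<lambda>t. F' (x + t *\<^sub>R b) b"] line by auto
    then have "s n x = F' (x + t *\<^sub>R b) b"
      by (simp add: s_def)
    then show ?thesis using B(2) True by simp
  qed
  have lim: "(\<lambda>n. s n x) \<longlonglongrightarrow> F' x b" for x
  proof -
    have "((\<lambda>h. (F (x + h *\<^sub>R b) - F x) / h) \<longlongrightarrow> F' x b) (at 0)"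
      using line[of x 0] by (simp add: has_field_derivative_iff)
    then have "(\<lambda>n. (F (x + (1 / real (Suc n)) *\<^sub>R b) - F x) / (1 / real (Suc n))) \<longlonglongrightarrow> F' x b"
    proof (rule filterlim_compose)
      show "filterlim (\<lambda>n. 1 / real (Suc n)) (at 0) sequentially"
        using LIMSEQ_inverse_real_of_nat by (auto simp: filterlim_at inverse_eq_divide)
    qed
    then show ?thesis by (simp add: s_def mult.commute)
  qed
  have iF: "integrable lborel F"
  proof -
    have "integrable lebesgue F" using integrable_continuous_compact_support[OF cF K] by simp
    then show ?thesis by (simp add: integrable_completion)
  qed
  have tr: "integrable lborel (\<lambda>x. F (x + v))" "integral\<^sup>L lborel (\<lambda>x. F (x + v)) = integral\<^sup>L lborel F" for v
    using iF integrable_distr_eq[of "(+) v" lborel borel F] integral_distr[of "(+) v" lborel borel F]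
    by (simp_all add: lborel_distr_plus add.commute)
  have s0: "integral\<^sup>L lborel (s n) = 0" for n
    unfolding s_def using tr iF by simp
  have "(\<lambda>n. integral\<^sup>L lborel (s n)) \<longlonglongrightarrow> integral\<^sup>L lborel (\<lambda>x. F' x b)"
  proof (rule integral_dominated_convergence)
    show "integrable lborel (\<lambda>x. B * indicator ?C x)"
      by (intro integrable_mult_right integrable_real_indicator emeasure_bounded_finite) auto
    show "s n \<in> borel_measurable lborel" for n unfolding s_def by measurable
  qed (use lim bound in auto)
  then have "integral\<^sup>L lborel (\<lambda>x. F' x b) = 0"
    by (simp add: s0 LIMSEQ_const_iff)
  then show ?thesis by (simp add: integral_completion)
qed

section \<open>Weak gradients\<close>

lemma locally_integrable_mult:
  fixes g :: "'a::euclidean_space \<Rightarrow> 'b::euclidean_space"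
  assumes g: "locally_integrable \<Omega> g"
    and c: "continuous_on UNIV c" "compact K" "K \<subseteq> \<Omega>" "\<And>x. x \<notin> K \<Longrightarrow> c x = 0"
  shows "set_integrable lebesgue \<Omega> (\<lambda>x. c x *\<^sub>R g x)"
proof -
  obtain B where B: "B > 0" "\<And>x. norm (c x :: real) \<le> B"
    using bounded_continuous_compact_support[OF c(1,2,4)] by blast
  have i: "integrable lebesgue (\<lambda>x. indicator K x *\<^sub>R g x)"
    using g c(2,3) by (auto simp: locally_integrable_def set_integrable_def)
  have cm: "c \<in> borel_measurable lebesgue"
    using borel_measurable_continuous_onI[OF c(1)] by (simp add: measurable_completion)
  have "integrable lebesgue (\<lambda>x. c x *\<^sub>R (indicator K x *\<^sub>R g x))"
  proof (rule Bochner_Integration.integrable_bound)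
    show "integrable lebesgue (\<lambda>x. B *\<^sub>R (indicator K x *\<^sub>R g x))"
      using i by (rule integrable_scaleR_right)
    show "(\<lambda>x. c x *\<^sub>R (indicator K x *\<^sub>R g x)) \<in> borel_measurable lebesgue"
      using cm borel_measurable_integrable[OF i] by measurable
    show "AE x in lebesgue. norm (c x *\<^sub>R (indicator K x *\<^sub>R g x)) \<le> norm (B *\<^sub>R (indicator K x *\<^sub>R g x))"
      using B by (auto simp: abs_mult mult.assoc intro!: mult_right_mono)
  qed
  moreover have "(\<lambda>x. c x *\<^sub>R (indicator K x *\<^sub>R g x)) = (\<lambda>x. indicator \<Omega> x *\<^sub>R (c x *\<^sub>R g x))"
    using c(3,4) by (auto simp: indicator_def fun_eq_iff)
  ultimately show ?thesis by (simp add: set_integrable_def)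
qed

lemma locally_integrable_diff:
  fixes g h :: "'a::euclidean_space \<Rightarrow> 'b::euclidean_space"
  shows "locally_integrable \<Omega> g \<Longrightarrow> locally_integrable \<Omega> h \<Longrightarrow> locally_integrable \<Omega> (\<lambda>x. g x - h x)"
  unfolding locally_integrable_def by (auto intro: set_integral_diff)

lemma locally_integrable_inner:
  fixes g :: "'a::euclidean_space \<Rightarrow> 'b::euclidean_space"
  shows "locally_integrable \<Omega> g \<Longrightarrow> locally_integrable \<Omega> (\<lambda>x. g x \<bullet> b)"
  unfolding locally_integrable_def set_integrable_def
  using integrable_inner_left by (fastforce simp: inner_scaleR_left[symmetric] simp del: inner_scaleR_left)

lemma locally_integrable_continuous:
  fixes g :: "'a::euclidean_space \<Rightarrow> 'b::euclidean_space"
  assumes "continuous_on UNIV g" shows "locally_integrable \<Omega> g"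
  unfolding locally_integrable_def set_integrable_def
  using borel_integrable_compact[OF _ continuous_on_subset[OF assms subset_UNIV]]
  by (auto simp: integrable_completion borel_measurable_integrable)

text \<open>Integration by parts, from the vanishing integral of a derivative of the product.\<close>

lemma is_weak_gradient_grad:
  assumes \<psi>: "smooth \<psi>"
  shows "is_weak_gradient \<Omega> \<psi> (grad \<psi>)"
  unfolding is_weak_gradient_def
proof (intro conjI ballI)
  show "locally_integrable \<Omega> \<psi>" "locally_integrable \<Omega> (grad \<psi>)"
    by (simp_all add: locally_integrable_continuous smooth_continuous continuous_on_grad \<psi>)
next
  fix \<zeta> b :: "_" assume z: "\<zeta> \<in> test_functions \<Omega>" and b: "b \<in> (Basis :: 'a set)"
  obtain K where K: "smooth \<zeta>" "compact K" "K \<subseteq> \<Omega>" "\<And>x. x \<notin> K \<Longrightarrow> \<zeta> x = 0"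
    using test_functionsE[OF z] by metis
  have gz: "grad \<zeta> x = 0" if "x \<notin> K" for x
    using grad_zero_outside[of K \<zeta> x] K that by (auto simp: compact_imp_closed)
  have pz: "partial \<zeta> b x = 0" if "x \<notin> K" for x
    using gz[OF that] grad_inner_Basis[OF b, of \<zeta> x] by simp
  have "integral\<^sup>L lebesgue (\<lambda>x. \<psi> x * (grad \<zeta> x \<bullet> b) + (grad \<psi> x \<bullet> b) * \<zeta> x) = 0"
  proof (rule integral_directional_derivative_eq_0[where F="\<lambda>x. \<psi> x * \<zeta> x" and F'="\<lambda>x h. \<psi> x * (grad \<zeta> x \<bullet> h) + (grad \<psi> x \<bullet> h) * \<zeta> x"])
    show "((\<lambda>x. \<psi> x * \<zeta> x) has_derivative (\<lambda>h. \<psi> x * (grad \<zeta> x \<bullet> h) + (grad \<psi> x \<bullet> h) * \<zeta> x)) (at x)" for x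
      by (intro has_derivative_mult has_derivative_grad \<psi> K)
    show "continuous_on UNIV (\<lambda>x. \<psi> x * (grad \<zeta> x \<bullet> b) + (grad \<psi> x \<bullet> b) * \<zeta> x)"
      by (intro continuous_intros smooth_continuous continuous_on_grad \<psi> K)
  qed (use K in auto)
  moreover have "integrable lebesgue (\<lambda>x. \<psi> x * (grad \<zeta> x \<bullet> b))"
    by (rule integrable_continuous_compact_support[OF _ K(2)], intro continuous_intros smooth_continuous continuous_on_grad \<psi> K(1))
      (simp add: gz)
  moreover have "integrable lebesgue (\<lambda>x. (grad \<psi> x \<bullet> b) * \<zeta> x)"
    by (rule integrable_continuous_compact_support[OF _ K(2)], intro continuous_intros smooth_continuous continuous_on_grad \<psi> K(1))
      (simp add: K(4))
  ultimately have "integral\<^sup>L lebesgue (\<lambda>x. \<psi> x * (grad \<zeta> x \<bullet> b)) = - integral\<^sup>L lebesgue (\<lambda>x. (grad \<psi> x \<bullet> b) * \<zeta> x)"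
    by simp
  moreover have "(\<lambda>x. indicator \<Omega> x *\<^sub>R (\<psi> x * partial \<zeta> b x)) = (\<lambda>x. \<psi> x * (grad \<zeta> x \<bullet> b))"
    using K(3) pz by (auto simp: fun_eq_iff indicator_def grad_inner_Basis[OF b])
  moreover have "(\<lambda>x. indicator \<Omega> x *\<^sub>R ((grad \<psi> x \<bullet> b) * \<zeta> x)) = (\<lambda>x. (grad \<psi> x \<bullet> b) * \<zeta> x)"
    using K(3,4) by (auto simp: fun_eq_iff indicator_def)
  ultimately show "(LINT x:\<Omega>|lebesgue. \<psi> x * partial \<zeta> b x) = - (LINT x:\<Omega>|lebesgue. (grad \<psi> x \<bullet> b) * \<zeta> x)"
    by (simp add: set_lebesgue_integral_def)
qed

lemma is_weak_gradient_diff: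
  assumes u: "is_weak_gradient \<Omega> u G" and v: "is_weak_gradient \<Omega> v H"
  shows "is_weak_gradient \<Omega> (\<lambda>x. u x - v x) (\<lambda>x. G x - H x)"
  unfolding is_weak_gradient_def
proof (intro conjI ballI)
  show "locally_integrable \<Omega> (\<lambda>x. u x - v x)" "locally_integrable \<Omega> (\<lambda>x. G x - H x)"
    using u v by (auto simp: is_weak_gradient_def intro: locally_integrable_diff)
next
  fix \<zeta> b :: "_" assume z: "\<zeta> \<in> test_functions \<Omega>" and b: "b \<in> (Basis :: 'a set)"
  obtain K where K: "smooth \<zeta>" "compact K" "K \<subseteq> \<Omega>" "\<And>x. x \<notin> K \<Longrightarrow> \<zeta> x = 0"
    using test_functionsE[OF z] by metis
  have pz: "partial \<zeta> b x = 0" if "x \<notin> K" for x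
    using grad_zero_outside[of K \<zeta> x] K that grad_inner_Basis[OF b, of \<zeta> x] by (auto simp: compact_imp_closed)
  have i1: "set_integrable lebesgue \<Omega> (\<lambda>x. w x * partial \<zeta> b x)" if "locally_integrable \<Omega> w" for w
    using locally_integrable_mult[OF that smooth_continuous[OF smooth_partial[OF K(1) b]] K(2,3) pz]
    by (simp add: mult.commute)
  have i2: "set_integrable lebesgue \<Omega> (\<lambda>x. (W x \<bullet> b) * \<zeta> x)" if "locally_integrable \<Omega> W" for W
    using locally_integrable_mult[OF locally_integrable_inner[OF that] smooth_continuous[OF K(1)] K(2,3,4), of b]
    by (simp add: mult.commute)
  have l: "locally_integrable \<Omega> u" "locally_integrable \<Omega> v" "locally_integrable \<Omega> G" "locally_integrable \<Omega> H"
    using u v by (auto simp: is_weak_gradient_def)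
  have "(LINT x:\<Omega>|lebesgue. (u x - v x) * partial \<zeta> b x)
      = (LINT x:\<Omega>|lebesgue. u x * partial \<zeta> b x) - (LINT x:\<Omega>|lebesgue. v x * partial \<zeta> b x)"
    using set_integral_diff(2)[OF i1[OF l(1)] i1[OF l(2)]] by (simp add: left_diff_distrib)
  also have "\<dots> = - (LINT x:\<Omega>|lebesgue. (G x \<bullet> b) * \<zeta> x) + (LINT x:\<Omega>|lebesgue. (H x \<bullet> b) * \<zeta> x)"
    using u v z b by (auto simp: is_weak_gradient_def)
  also have "\<dots> = - (LINT x:\<Omega>|lebesgue. ((G x - H x) \<bullet> b) * \<zeta> x)"
    using set_integral_diff(2)[OF i2[OF l(3)] i2[OF l(4)]] by (simp add: inner_diff_left left_diff_distrib)
  finally show "(LINT x:\<Omega>|lebesgue. (u x - v x) * partial \<zeta> b x)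
      = - (LINT x:\<Omega>|lebesgue. ((G x - H x) \<bullet> b) * \<zeta> x)" .
qed

lemma flat_scaled_tendsto: "(\<lambda>n. flat 0 (real n * t)) \<longlonglongrightarrow> (if t > 0 then 1 else 0)"
proof (cases "t > 0")
  case True
  have "(\<lambda>n. exp (- ((1 / real n) * (1 / t)))) \<longlonglongrightarrow> exp (- (0 * (1 / t)))"
    by (intro tendsto_intros lim_1_over_n)
  then have "(\<lambda>n. exp (- 1 / (real n * t))) \<longlonglongrightarrow> 1"
    by simp
  then show ?thesis using True
    by (subst tendsto_cong[where g="\<lambda>n. exp (- 1 / (real n * t))"])
      (auto simp: flat_def eventually_sequentially intro!: exI[of _ 1])
next
  case False
  then have "\<not> 0 < real n * t" for n by (simp add: mult_nonneg_nonpos not_less)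
  then show ?thesis using False by (simp add: flat_def)
qed

lemma flat_0_bounds: "0 \<le> flat 0 t" "flat 0 t \<le> 1"
  by (auto simp: flat_def)

text \<open>The flat functions of \<open>n\<close> times the distances to the faces, multiplied together, are test
  functions that increase to the indicator of a box.  So \<open>h\<close> has integral zero over all small boxes;
  these generate the Borel sets and are stable under intersection, hence the integral vanishes over
  every Borel set.\<close>

lemma AE_zero_on_box_if_test_integrals_zero:
  fixes h :: "'a::euclidean_space \<Rightarrow> real"
  assumes h: "locally_integrable \<Omega> h"
    and zero: "\<And>\<psi>. \<psi> \<in> test_functions \<Omega> \<Longrightarrow> (LINT x:\<Omega>|lebesgue. h x * \<psi> x) = 0"
    and sub: "cbox p q \<subseteq> \<Omega>"
  shows "AE x in lebesgue. x \<in> box p q \<longrightarrow> h x = 0"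
proof -
  define g where "g x = indicator (box p q) x * h x" for x
  have ic: "integrable lebesgue (\<lambda>x. indicator (cbox p q) x * h x)"
    using h sub by (auto simp: locally_integrable_def set_integrable_def)
  have g_int: "integrable lebesgue g"
  proof -
    have "g = (\<lambda>x. indicator (box p q) x * (indicator (cbox p q) x * h x))"
      using box_subset_cbox[of p q] by (auto simp: g_def fun_eq_iff indicator_def)
    then show ?thesis using integrable_mult_indicator[OF _ ic, of "box p q"] by simp
  qed
  have box0: "integral\<^sup>L lebesgue (\<lambda>x. indicator (box a c) x * g x) = 0" for a c
  proof -
    obtain c1 c2 where int: "box a c \<inter> box p q = box c1 c2" using box_Int_box[of a c p q] by blast
    show ?thesis
    proof (cases "box c1 c2 = {}")
      case True
      then have "(\<lambda>x. indicator (box a c) x * g x) = (\<lambda>x. 0)"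
        using int by (auto simp: g_def fun_eq_iff indicator_def)
      then show ?thesis by simp
    next
      case False
      then have cb: "cbox c1 c2 \<subseteq> cbox p q"
        using int closure_mono[of "box c1 c2" "box p q"] closure_box
        by (metis False Int_lower2 closure_cbox closure_mono bot.extremum_uniqueI)
      define \<psi> where "\<psi> n x = (\<Prod>b\<in>Basis. flat 0 (real n * (x \<bullet> b - c1 \<bullet> b)) * flat 0 (real n * (c2 \<bullet> b - x \<bullet> b)))" for n x
      have b01: "0 \<le> \<psi> n x \<and> \<psi> n x \<le> 1" for n x
        unfolding \<psi>_def by (intro conjI prod_nonneg prod_le_1) (auto intro!: mult_le_one simp: flat_0_bounds)
      have out: "\<psi> n x = 0" if out_cbox: "x \<notin> cbox c1 c2" for n x
      proof -
        obtain b where b: "b \<in> Basis" "x \<bullet> b < c1 \<bullet> b \<or> c2 \<bullet> b < x \<bullet> b"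
          using out_cbox unfolding mem_box by (meson not_less)
        then have "flat 0 (real n * (x \<bullet> b - c1 \<bullet> b)) * flat 0 (real n * (c2 \<bullet> b - x \<bullet> b)) = 0"
          by (auto simp: flat_def zero_less_mult_iff)
        then show ?thesis unfolding \<psi>_def using b(1) by (intro prod_zero) auto
      qed
      have sm: "smooth (\<psi> n)" for n
        unfolding \<psi>_def by (intro smooth_prod smooth_mult smooth_flat smooth_diff smooth_const smooth_inner)
      have tst: "\<psi> n \<in> test_functions \<Omega>" for n
        by (rule test_functionsI[of _ "cbox c1 c2"]) (use sm out cb sub in auto)
      have ind: "(\<Prod>b\<in>Basis. (if x \<bullet> b - c1 \<bullet> b > 0 then 1 else 0) * (if c2 \<bullet> b - x \<bullet> b > 0 then 1 else 0 :: real)) = indicator (box c1 c2) x" for x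
      proof (cases "x \<in> box c1 c2")
        case True
        then show ?thesis by (auto simp: mem_box intro!: prod.neutral)
      next
        case False
        then obtain b where "b \<in> Basis" "\<not> (c1 \<bullet> b < x \<bullet> b \<and> x \<bullet> b < c2 \<bullet> b)"
          by (auto simp: mem_box)
        then have "(\<Prod>b\<in>Basis. (if x \<bullet> b - c1 \<bullet> b > 0 then 1 else 0) * (if c2 \<bullet> b - x \<bullet> b > 0 then 1 else 0 :: real)) = 0"
          by (intro prod_zero) (auto intro!: bexI[of _ b])
        then show ?thesis using False by simp
      qed
      have lim: "(\<lambda>n. \<psi> n x) \<longlonglongrightarrow> indicator (box c1 c2) x" for x
        unfolding \<psi>_def ind[symmetric] by (intro tendsto_prod tendsto_mult flat_scaled_tendsto)
      have mh: "(\<lambda>x. indicator (cbox p q) x * h x) \<in> borel_measurable lebesgue" using ic by auto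
      have "(\<lambda>n. integral\<^sup>L lebesgue (\<lambda>x. \<psi> n x * (indicator (cbox p q) x * h x)))
          \<longlonglongrightarrow> integral\<^sup>L lebesgue (\<lambda>x. indicator (box c1 c2) x * (indicator (cbox p q) x * h x))"
      proof (rule integral_dominated_convergence[where w="\<lambda>x. norm (indicator (cbox p q) x * h x)"])
        show "(\<lambda>x. \<psi> n x * (indicator (cbox p q) x * h x)) \<in> borel_measurable lebesgue" for n
          using borel_measurable_continuous_onI[OF smooth_continuous[OF sm[of n]]]
          by (intro borel_measurable_times[OF _ mh]) (simp add: measurable_completion)
        show "(\<lambda>x. indicator (box c1 c2) x * (indicator (cbox p q) x * h x)) \<in> borel_measurable lebesgue"
          by (intro borel_measurable_times[OF _ mh] borel_measurable_indicator) simp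
        show "AE x in lebesgue. (\<lambda>n. \<psi> n x * (indicator (cbox p q) x * h x)) \<longlonglongrightarrow> indicator (box c1 c2) x * (indicator (cbox p q) x * h x)"
          using lim by (intro always_eventually allI tendsto_mult) auto
        show "AE x in lebesgue. norm (\<psi> n x * (indicator (cbox p q) x * h x)) \<le> norm (indicator (cbox p q) x * h x)" for n
          using b01[of n] by (auto simp: abs_mult intro!: mult_left_le_one_le)
      qed (use ic in auto)
      moreover have "integral\<^sup>L lebesgue (\<lambda>x. \<psi> n x * (indicator (cbox p q) x * h x)) = 0" for n
      proof -
        have "(\<lambda>x. \<psi> n x * (indicator (cbox p q) x * h x)) = (\<lambda>x. indicator \<Omega> x *\<^sub>R (h x * \<psi> n x))"
          using out[of _ n] cb sub by (auto simp: fun_eq_iff indicator_def)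
        then show ?thesis using zero[OF tst[of n]] by (simp add: set_lebesgue_integral_def)
      qed
      ultimately have "integral\<^sup>L lebesgue (\<lambda>x. indicator (box c1 c2) x * (indicator (cbox p q) x * h x)) = 0"
        by (simp add: LIMSEQ_const_iff)
      moreover have "(\<lambda>x. indicator (box c1 c2) x * (indicator (cbox p q) x * h x)) = (\<lambda>x. indicator (box a c) x * g x)"
        unfolding int[symmetric] using box_subset_cbox[of p q] by (auto simp: fun_eq_iff indicator_def g_def)
      ultimately show ?thesis by simp
    qed
  qed
  obtain g' where g'm[measurable]: "g' \<in> borel_measurable lborel" and g': "AE x in lborel. g x = g' x"
    using completion_ex_borel_measurable_real borel_measurable_integrable[OF g_int] by blast
  have g'c: "AE x in lebesgue. g x = g' x" using g' by (rule AE_completion)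
  have g'm2: "g' \<in> borel_measurable lebesgue" using g'm by (rule measurable_completion)
  have i: "integrable lborel g'"
    using integrable_cong_AE[of g lebesgue g'] g'c g_int g'm2 by (auto simp: integrable_completion)
  have eq: "set_lebesgue_integral lborel A g' = integral\<^sup>L lebesgue (\<lambda>x. indicator A x * g x)" if [measurable]: "A \<in> sets borel" for A
  proof -
    have "set_lebesgue_integral lborel A g' = integral\<^sup>L lebesgue (\<lambda>x. indicator A x * g' x)"
      unfolding set_lebesgue_integral_def by (simp add: integral_completion)
    also have "\<dots> = integral\<^sup>L lebesgue (\<lambda>x. indicator A x * g x)"
    proof (rule integral_cong_AE)
      have A: "indicator A \<in> borel_measurable lebesgue"
        using that by (intro borel_measurable_indicator) simp
      show "(\<lambda>x. indicat_real A x * g' x) \<in> borel_measurable lebesgue"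
        by (rule borel_measurable_times[OF A g'm2])
      show "(\<lambda>x. indicat_real A x * g x) \<in> borel_measurable lebesgue"
        by (rule borel_measurable_times[OF A borel_measurable_integrable[OF g_int]])
      show "AE x in lebesgue. indicat_real A x * g' x = indicat_real A x * g x"
        using g'c by eventually_elim simp
    qed
    finally show ?thesis .
  qed
  have si: "set_integrable lborel A g'" if "A \<in> sets borel" for A
    using that i by (auto simp: set_integrable_def intro!: integrable_mult_indicator[of A lborel g', simplified])
  have "set_lebesgue_integral lborel A g' = 0" if A: "A \<in> sets borel" for A
  proof -
    have "Int_stable (range (\<lambda>(a, b). box a b :: 'a set))"
      by (auto simp: Int_stable_def box_Int_box)
    moreover have "(range (\<lambda>(a, b). box a b)) \<subseteq> Pow (UNIV :: 'a set)" by auto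
    moreover have "A \<in> sigma_sets UNIV (range (\<lambda>(a, b). box a b))"
       using A unfolding borel_eq_box by simp
    ultimately show ?thesis
    proof (induction rule: sigma_sets_induct_disjoint)
      case (basic A) then show ?case by (auto simp: eq box0)
    next
      case empty then show ?case by (simp add: set_lebesgue_integral_def)
    next
      case (compl A)
      then have A: "A \<in> sets borel" by (simp add: borel_eq_box)
      have "(LINT x:(UNIV - A) \<union> A|lborel. g' x) = (LINT x:(UNIV - A)|lborel. g' x) + (LINT x:A|lborel. g' x)"
        using A by (intro set_integral_Un si) auto
      moreover have "(LINT x:UNIV|lborel. g' x) = 0"
      proof -
        have "(\<lambda>x. indicator (box p q) x * g x) = (\<lambda>x. indicator UNIV x * g x)"
          by (auto simp: g_def fun_eq_iff indicator_def)
        then show ?thesis using box0[of p q] by (simp add: eq)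
      qed
      ultimately show ?case using compl by simp
    next
      case (union F)
      then have F: "\<And>i. F i \<in> sets borel"
        by (simp add: borel_eq_box subset_eq)
      have "(LINT x:(\<Union>i. F i)|lborel. g' x) = (\<Sum>i. LINT x:F i|lborel. g' x)"
        using F union(1) by (intro lebesgue_integral_countable_add si) (auto simp: disjoint_family_on_def)
      then show ?case using union by simp
    qed
  qed
  then have "AE x in lborel. g' x = 0"
    by (intro sigma_finite_measure.density_zero[OF sigma_finite_lborel] i) auto
  then have "AE x in lebesgue. g x = 0"
    using g'c AE_completion by fastforce
  then show ?thesis by eventually_elim (auto simp: g_def indicator_def)
qed

lemma AE_zero_if_test_integrals_zero:
  fixes h :: "'a::euclidean_space \<Rightarrow> real"
  assumes "open \<Omega>" and h: "locally_integrable \<Omega> h"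
    and zero: "\<And>\<psi>. \<psi> \<in> test_functions \<Omega> \<Longrightarrow> (LINT x:\<Omega>|lebesgue. h x * \<psi> x) = 0"
  shows "AE x in lebesgue. x \<in> \<Omega> \<longrightarrow> h x = 0"
proof -
  obtain \<D> where D: "countable \<D>" "\<D> \<subseteq> Pow \<Omega>" "\<And>X. X \<in> \<D> \<Longrightarrow> \<exists>a b. X = cbox a b" "\<Union>\<D> = \<Omega>"
    using open_countable_Union_open_cbox[OF assms(1)] by metis
  have "AE x in lebesgue. x \<in> X \<longrightarrow> h x = 0" if XD: "X \<in> \<D>" for X
  proof -
    obtain p q where pq: "X = cbox p q" using D(3)[OF XD] by blast
    have "cbox p q - box p q \<in> null_sets lebesgue"
      using negligible_frontier_interval negligible_iff_null_sets by blast
    then have "AE x in lebesgue. x \<notin> cbox p q - box p q" by (rule AE_not_in)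
    moreover have "AE x in lebesgue. x \<in> box p q \<longrightarrow> h x = 0"
      using AE_zero_on_box_if_test_integrals_zero[OF h zero] pq XD D(2) by blast
    ultimately show ?thesis by eventually_elim (auto simp: pq)
  qed
  then have "AE x in lebesgue. \<forall>X\<in>\<D>. x \<in> X \<longrightarrow> h x = 0"
    using D(1) by (intro AE_ball_countable[THEN iffD2]) auto
  then show ?thesis by eventually_elim (use D(4) in auto)
qed

lemma weak_gradient_unique:
  assumes "open \<Omega>" and G: "is_weak_gradient \<Omega> u G" and H: "is_weak_gradient \<Omega> u H"
  shows "AE x in lebesgue. x \<in> \<Omega> \<longrightarrow> G x = H x"
proof -
  have d: "is_weak_gradient \<Omega> (\<lambda>x. 0) (\<lambda>x. G x - H x)"
    using is_weak_gradient_diff[OF G H] by simp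
  have "AE x in lebesgue. x \<in> \<Omega> \<longrightarrow> (G x - H x) \<bullet> b = 0" if "b \<in> Basis" for b
  proof (rule AE_zero_if_test_integrals_zero[OF assms(1)])
    show "locally_integrable \<Omega> (\<lambda>x. (G x - H x) \<bullet> b)"
      using d by (intro locally_integrable_inner) (simp add: is_weak_gradient_def)
    show "(LINT x:\<Omega>|lebesgue. ((G x - H x) \<bullet> b) * \<psi> x) = 0" if "\<psi> \<in> test_functions \<Omega>" for \<psi>
      using d that \<open>b \<in> Basis\<close> by (auto simp: is_weak_gradient_def)
  qed
  then have "AE x in lebesgue. \<forall>b\<in>Basis. x \<in> \<Omega> \<longrightarrow> (G x - H x) \<bullet> b = 0"
    by (intro AE_finite_allI) auto
  then show ?thesis
    by eventually_elim (metis euclidean_eqI inner_diff_left right_minus_eq)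
qed

lemma is_weak_gradient_weak_gradient:
  "is_weak_gradient \<Omega> u G \<Longrightarrow> is_weak_gradient \<Omega> u (weak_gradient \<Omega> u)"
  unfolding weak_gradient_def by (rule someI[of "is_weak_gradient \<Omega> u"])

lemma weak_gradient_AE_eq:
  assumes "open \<Omega>" "is_weak_gradient \<Omega> u G"
  shows "AE x in lebesgue. x \<in> \<Omega> \<longrightarrow> weak_gradient \<Omega> u x = G x"
  using weak_gradient_unique[OF assms(1) is_weak_gradient_weak_gradient[OF assms(2)] assms(2)] .

text \<open>A weak gradient is an arbitrary choice among almost-everywhere equal functions; its measurability
  on the whole open set is recovered from countably many compact boxes.\<close>

lemma locally_integrable_measurable:
  fixes g :: "'a::euclidean_space \<Rightarrow> 'b::euclidean_space"
  assumes "open \<Omega>" "locally_integrable \<Omega> g"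
  shows "(\<lambda>x. indicator \<Omega> x *\<^sub>R g x) \<in> borel_measurable lebesgue"
proof -
  obtain \<D> where D: "countable \<D>" "\<D> \<subseteq> Pow \<Omega>" "\<And>X. X \<in> \<D> \<Longrightarrow> \<exists>a b. X = cbox a b" "\<Union>\<D> = \<Omega>"
    using open_countable_Union_open_cbox[OF assms(1)] by metis
  have X: "(\<lambda>x. indicator X x *\<^sub>R g x) \<in> borel_measurable lebesgue" if "X \<in> \<D>" for X
  proof -
    have "compact X" "X \<subseteq> \<Omega>" using D(2,3) that compact_cbox by blast+
    then have "integrable lebesgue (\<lambda>x. indicator X x *\<^sub>R g x)"
      using assms(2) by (simp add: locally_integrable_def set_integrable_def)
    then show ?thesis by (rule borel_measurable_integrable)
  qed
  have Xm: "X \<in> sets lebesgue" if "X \<in> \<D>" for X using D(3)[OF that] by auto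
  show ?thesis
  proof (rule measurable_piecewise_restrict[of "insert (- \<Omega>) \<D>"])
    show "countable (insert (- \<Omega>) \<D>)" using D(1) by simp
    show "A \<inter> space lebesgue \<in> sets lebesgue" if "A \<in> insert (- \<Omega>) \<D>" for A
      using that Xm assms(1) by auto
    show "space lebesgue \<subseteq> \<Union> (insert (- \<Omega>) \<D>)" using D(4) by auto
    show "(\<lambda>x. indicator \<Omega> x *\<^sub>R g x) \<in> borel_measurable (lebesgue_on A)" if "A \<in> insert (- \<Omega>) \<D>" for A
    proof (cases "A = - \<Omega>")
      case True
      have "(\<lambda>x. 0) \<in> borel_measurable (lebesgue_on A)" by simp
      then show ?thesis by (rule measurable_cong[THEN iffD1, rotated]) (simp add: True)
    next
      case False
      then have A: "A \<in> \<D>" "A \<subseteq> \<Omega>" using that D(2) by auto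
      have "(\<lambda>x. indicator A x *\<^sub>R g x) \<in> borel_measurable (lebesgue_on A)"
        using X[OF A(1)] by (rule measurable_restrict_space1)
      then show ?thesis
        by (rule measurable_cong[THEN iffD1, rotated]) (use A(2) in \<open>auto simp: indicator_def\<close>)
    qed
  qed
qed

section \<open>Young functions with a convex derivative\<close>

locale young =
  fixes \<Phi> \<phi> :: "real \<Rightarrow> real" and \<kappa> :: real
  assumes phi_cont: "continuous_on {0..} \<phi>"
    and phi_convex: "convex_on {0..} \<phi>"
    and phi_mono: "mono_on {0..} \<phi>"
    and phi_0: "\<phi> 0 = 0"
    and phi_pos: "t > 0 \<Longrightarrow> \<phi> t > 0"
    and phi_double: "t \<ge> 0 \<Longrightarrow> \<phi> (2 * t) \<le> \<kappa> * \<phi> t"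
    and Phi_integral: "t \<ge> 0 \<Longrightarrow> (\<phi> has_integral \<Phi> t) {0..t}"
begin

lemma phi_le: "0 \<le> s \<Longrightarrow> s \<le> t \<Longrightarrow> \<phi> s \<le> \<phi> t"
  using phi_mono by (auto simp: mono_on_def)

lemma phi_nonneg: "0 \<le> t \<Longrightarrow> 0 \<le> \<phi> t"
  using phi_le[of 0 t] phi_0 by simp

lemma kappa_ge_1: "\<kappa> \<ge> 1"
proof -
  have "1 * \<phi> 1 \<le> \<kappa> * \<phi> 1" using phi_le[of 1 2] phi_double[of 1] by simp
  then show ?thesis using phi_pos[of 1] by (simp only: mult_le_cancel_right_pos)
qed

text \<open>Chords of the convex function \<open>\<phi>\<close> from the origin become steeper.\<close>

lemma phi_slope_mono:
  assumes "0 < s" "s \<le> t" shows "\<phi> s / s \<le> \<phi> t / t"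
proof -
  have "\<phi> ((1 - s/t) *\<^sub>R 0 + (s/t) *\<^sub>R t) \<le> (1 - s/t) * \<phi> 0 + (s/t) * \<phi> t"
    using assms by (intro convex_onD[OF phi_convex]) auto
  then have "\<phi> s \<le> s / t * \<phi> t" using assms phi_0 by simp
  then show ?thesis using assms by (simp add: field_simps)
qed

lemma Phi_0: "\<Phi> 0 = 0"
  using has_integral_unique[OF Phi_integral[of 0] has_integral_null_real[of 0 0 \<phi>]] by simp

lemma Phi_diff:
  assumes "0 \<le> s" "s \<le> t" shows "(\<phi> has_integral \<Phi> t - \<Phi> s) {s..t}"
proof -
  have "\<phi> integrable_on {s..t}"
    by (rule integrable_continuous_real) (use assms in \<open>auto intro: continuous_on_subset[OF phi_cont]\<close>)
  then obtain I where I: "(\<phi> has_integral I) {s..t}" by blast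
  have "(\<phi> has_integral \<Phi> s + I) {0..t}"
    by (rule has_integral_combine[OF assms Phi_integral I]) (use assms in auto)
  from has_integral_unique[OF Phi_integral[of t] this] have "\<Phi> t = \<Phi> s + I"
    using assms by simp
  then show ?thesis using I by simp
qed

lemma Phi_tangent:
  assumes "0 \<le> s" "0 \<le> t" shows "\<Phi> s + \<phi> s * (t - s) \<le> \<Phi> t"
proof (cases "s \<le> t")
  case True
  have "((\<lambda>x. \<phi> s) has_integral (t - s) * \<phi> s) {s..t}"
    using has_integral_const_real[of "\<phi> s" s t] True by simp
  then have "(t - s) * \<phi> s \<le> \<Phi> t - \<Phi> s"
    by (rule has_integral_le[OF _ Phi_diff[OF assms(1) True]]) (use assms in \<open>auto intro: phi_le\<close>)
  then show ?thesis by (simp add: algebra_simps)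
next
  case False
  have "((\<lambda>x. \<phi> s) has_integral (s - t) * \<phi> s) {t..s}"
    using has_integral_const_real[of "\<phi> s" t s] False by simp
  then have "\<Phi> s - \<Phi> t \<le> (s - t) * \<phi> s"
    by (intro has_integral_le[OF Phi_diff[of t s]]) (use assms False in \<open>auto intro: phi_le\<close>)
  then show ?thesis by (simp add: algebra_simps)
qed

lemma Phi_nonneg: "0 \<le> t \<Longrightarrow> 0 \<le> \<Phi> t"
  using Phi_tangent[of 0 t] Phi_0 phi_0 by simp

lemma Phi_mono: "0 \<le> s \<Longrightarrow> s \<le> t \<Longrightarrow> \<Phi> s \<le> \<Phi> t"
  using Phi_tangent[of s t] phi_nonneg[of s] mult_nonneg_nonneg[of "\<phi> s" "t - s"] by linarith

lemma Phi_has_derivative: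
  assumes "0 < t" shows "(\<Phi> has_real_derivative \<phi> t) (at t)"
proof -
  have "((\<lambda>x. integral {0..x} \<phi>) has_real_derivative \<phi> t) (at t within {0..t+1})"
    by (rule integral_has_real_derivative) (use assms in \<open>auto intro: continuous_on_subset[OF phi_cont]\<close>)
  moreover have "at t within {0..t+1} = at t"
    using assms by (intro at_within_interior) (auto simp: interior_atLeastAtMost_real)
  ultimately have "((\<lambda>x. integral {0..x} \<phi>) has_real_derivative \<phi> t) (at t)" by simp
  then show ?thesis
    by (rule has_field_derivative_transform_within_open[of _ _ _ "{0<..}"])
      (use assms Phi_integral in \<open>auto intro!: integral_unique\<close>)
qed

lemma Phi_le: "0 \<le> t \<Longrightarrow> \<Phi> t \<le> t * \<phi> t"
  using Phi_tangent[of t 0] Phi_0 by (simp add: mult.commute)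

lemma Phi_abs_has_derivative:
  "((\<lambda>s. \<Phi> \<bar>s\<bar>) has_real_derivative sgn s * \<phi> \<bar>s\<bar>) (at s)"
proof -
  consider "s > 0" | "s < 0" | "s = 0" by linarith
  then show ?thesis
  proof cases
    case 1
    then show ?thesis
      using Phi_has_derivative[of s]
      by (auto intro: has_field_derivative_transform_within_open[of \<Phi> _ _ "{0<..}"])
  next
    case 2
    have "((\<lambda>s. \<Phi> (- s)) has_real_derivative \<phi> (- s) * (- 1)) (at s)"
      by (rule DERIV_chain2[OF Phi_has_derivative]) (use 2 in \<open>auto intro!: derivative_eq_intros\<close>)
    then have "((\<lambda>s. \<Phi> \<bar>s\<bar>) has_real_derivative \<phi> (- s) * (- 1)) (at s)"
      by (rule has_field_derivative_transform_within_open[of _ _ _ "{..<0}"]) (use 2 in auto)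
    then show ?thesis using 2 by simp
  next
    case 3
    have "((\<lambda>h. \<Phi> \<bar>h\<bar> / h) \<longlongrightarrow> 0) (at 0)"
    proof (rule Lim_null_comparison)
      have "continuous (at 0 within {0..}) \<phi>"
        using phi_cont by (simp add: continuous_on_eq_continuous_within)
      then have "(\<phi> \<longlongrightarrow> 0) (at 0 within {0..})"
        by (simp add: continuous_within phi_0)
      moreover have "filterlim (\<lambda>h::real. \<bar>h\<bar>) (at 0 within {0..}) (at 0)"
        by (auto simp: filterlim_at eventually_at intro!: tendsto_eq_intros exI[of _ 1])
      ultimately show "((\<lambda>h. \<phi> \<bar>h\<bar>) \<longlongrightarrow> 0) (at (0::real))"
        by (rule filterlim_compose)
      have "norm (\<Phi> \<bar>h\<bar> / h) \<le> \<phi> \<bar>h\<bar>" if "h \<noteq> 0" for h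
        using Phi_le[of "\<bar>h\<bar>"] Phi_nonneg[of "\<bar>h\<bar>"] that by (simp add: divide_le_eq mult.commute)
      then show "\<forall>\<^sub>F h in at 0. norm (\<Phi> \<bar>h\<bar> / h) \<le> \<phi> \<bar>h\<bar>"
        by (auto simp: eventually_at intro!: exI[of _ 1])
    qed
    then show ?thesis using 3 by (simp add: has_field_derivative_iff Phi_0)
  qed
qed

lemma continuous_on_Phi_abs: "continuous_on UNIV (\<lambda>s. \<Phi> \<bar>s\<bar>)"
  by (intro continuous_at_imp_continuous_on ballI DERIV_isCont[OF Phi_abs_has_derivative])

lemma continuous_on_Phi_norm: "continuous_on A g \<Longrightarrow> continuous_on A (\<lambda>x. \<Phi> (norm (g x)))"
  using continuous_on_compose2[OF continuous_on_Phi_abs, of A "\<lambda>x. norm (g x)"]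
  by (auto intro: continuous_intros)

lemma continuous_on_phi_norm: "continuous_on A g \<Longrightarrow> continuous_on A (\<lambda>x. \<phi> (norm (g x)))"
  using continuous_on_compose2[OF phi_cont, of A "\<lambda>x. norm (g x)"]
  by (simp add: continuous_on_norm image_subset_iff)

text \<open>Since \<open>\<phi>(s)/s\<close> is nondecreasing, \<open>\<Phi>\<close> is convex even as a function of \<open>t\<^sup>2\<close>.\<close>

lemma Phi_square_tangent:
  assumes "0 < s" "0 \<le> t" shows "\<Phi> s + \<phi> s / (2 * s) * (t\<^sup>2 - s\<^sup>2) \<le> \<Phi> t"
proof -
  have I: "((\<lambda>x. \<phi> s / s * x) has_integral \<phi> s / (2 * s) * (b\<^sup>2 - a\<^sup>2)) {a..b}" if "a \<le> b" for a b
  proof -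
    have "((\<lambda>x. \<phi> s / s * x) has_integral \<phi> s / s * (b\<^sup>2 / 2) - \<phi> s / s * (a\<^sup>2 / 2)) {a..b}"
      using that assms by (intro fundamental_theorem_of_calculus)
        (auto intro!: derivative_eq_intros simp: has_real_derivative_iff_has_vector_derivative[symmetric])
    then show ?thesis using assms by (simp add: field_simps)
  qed
  show ?thesis
  proof (cases "s \<le> t")
    case True
    have "\<phi> s / (2 * s) * (t\<^sup>2 - s\<^sup>2) \<le> \<Phi> t - \<Phi> s"
    proof (rule has_integral_le[OF I[OF True] Phi_diff[OF _ True]])
      fix x assume "x \<in> {s..t}"
      then show "\<phi> s / s * x \<le> \<phi> x" using phi_slope_mono[of s x] assms by (simp add: field_simps)
    qed (use assms in auto)
    then show ?thesis by simp
  next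
    case False
    have "\<Phi> s - \<Phi> t \<le> \<phi> s / (2 * s) * (s\<^sup>2 - t\<^sup>2)"
    proof (rule has_integral_le[OF Phi_diff I])
      fix x assume x: "x \<in> {t..s}"
      show "\<phi> x \<le> \<phi> s / s * x"
      proof (cases "x = 0")
        case True then show ?thesis using phi_0 by simp
      next
        case False then show ?thesis using phi_slope_mono[of x s] x assms by (simp add: field_simps)
      qed
    qed (use assms False in auto)
    then show ?thesis by (simp add: algebra_simps)
  qed
qed

lemma Phi_square_scale:
  assumes "0 \<le> s" "s \<le> t" shows "\<Phi> s * t\<^sup>2 \<le> \<Phi> t * s\<^sup>2"
proof (cases "s = 0")
  case True then show ?thesis by (simp add: Phi_0)
next
  case False
  then have s: "s > 0" using assms by simp
  have "\<Phi> s \<le> \<phi> s / (2 * s) * s\<^sup>2"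
    using Phi_square_tangent[of s 0] s Phi_0 by (simp add: algebra_simps)
  then have "\<Phi> s * (t\<^sup>2 - s\<^sup>2) \<le> (\<phi> s / (2 * s) * s\<^sup>2) * (t\<^sup>2 - s\<^sup>2)"
    using assms by (intro mult_right_mono) auto
  also have "\<dots> = (\<phi> s / (2 * s) * (t\<^sup>2 - s\<^sup>2)) * s\<^sup>2" by (simp add: mult_ac)
  also have "\<dots> \<le> (\<Phi> t - \<Phi> s) * s\<^sup>2"
    using Phi_square_tangent[of s t] s assms by (intro mult_right_mono) auto
  finally show ?thesis by (simp add: algebra_simps)
qed

lemma Phi_pos: "t > 0 \<Longrightarrow> \<Phi> t > 0"
  using Phi_tangent[of "t/2" t] Phi_nonneg[of "t/2"] phi_pos[of "t/2"] by (smt (verit) half_gt_zero_iff mult_pos_pos field_sum_of_halves)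

lemma Phi_quadruple: "0 \<le> t \<Longrightarrow> 4 * \<Phi> t \<le> \<Phi> (2 * t)"
proof (cases "t = 0")
  case False
  assume "0 \<le> t"
  then have "(4 * \<Phi> t) * t\<^sup>2 \<le> \<Phi> (2 * t) * t\<^sup>2"
    using Phi_square_scale[of t "2 * t"] by (simp add: power_mult_distrib)
  then show ?thesis using False by simp
qed (simp add: Phi_0)

text \<open>The parallelogram law turns convexity in \<open>t\<^sup>2\<close> into Clarkson's inequality.\<close>

lemma clarkson:
  fixes a b :: "'a::real_inner"
  shows "2 * \<Phi> (norm ((1/2) *\<^sub>R (a + b))) + 2 * \<Phi> (norm ((1/2) *\<^sub>R (a - b))) \<le> \<Phi> (norm a) + \<Phi> (norm b)"
proof -
  define p where "p = norm ((1/2) *\<^sub>R (a + b))"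
  define q where "q = norm ((1/2) *\<^sub>R (a - b))"
  define m where "m = sqrt (((norm a)\<^sup>2 + (norm b)\<^sup>2) / 2)"
  have m2: "m\<^sup>2 = ((norm a)\<^sup>2 + (norm b)\<^sup>2) / 2" by (simp add: m_def)
  have m0: "m \<ge> 0" by (simp add: m_def)
  have pq: "p\<^sup>2 + q\<^sup>2 = m\<^sup>2"
    unfolding m2 p_def q_def power2_norm_eq_inner by (simp add: inner_simps inner_commute field_simps)
  show ?thesis
  proof (cases "m = 0")
    case True
    then have "a = 0" "b = 0" using m2 by (simp_all add: add_nonneg_eq_0_iff)
    then show ?thesis by (simp add: Phi_0)
  next
    case False
    then have m: "m > 0" using m0 by simp
    have "p\<^sup>2 \<le> m\<^sup>2" "q\<^sup>2 \<le> m\<^sup>2" using pq by (metis le_add_same_cancel1 zero_le_power2, metis le_add_same_cancel2 zero_le_power2)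
    then have "p \<le> m" "q \<le> m" using m0 power2_le_imp_le by blast+
    then have "\<Phi> p * m\<^sup>2 \<le> \<Phi> m * p\<^sup>2" "\<Phi> q * m\<^sup>2 \<le> \<Phi> m * q\<^sup>2"
      by (auto intro!: Phi_square_scale simp: p_def q_def)
    then have "(\<Phi> p + \<Phi> q) * m\<^sup>2 \<le> \<Phi> m * m\<^sup>2"
      unfolding pq[symmetric] by (simp add: algebra_simps)
    then have "\<Phi> p + \<Phi> q \<le> \<Phi> m" using m by simp
    moreover have "2 * \<Phi> m \<le> \<Phi> (norm a) + \<Phi> (norm b)"
    proof -
      have "\<phi> m / (2 * m) * ((norm a)\<^sup>2 - m\<^sup>2) + \<phi> m / (2 * m) * ((norm b)\<^sup>2 - m\<^sup>2) = \<phi> m / (2 * m) * ((norm a)\<^sup>2 + (norm b)\<^sup>2 - 2 * m\<^sup>2)"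
        by (simp add: algebra_simps)
      also have "\<dots> = 0" by (simp add: m2)
      finally show ?thesis
        using Phi_square_tangent[OF m, of "norm a"] Phi_square_tangent[OF m, of "norm b"] by simp
    qed
    ultimately show ?thesis unfolding p_def q_def by linarith
  qed
qed

lemma norm_flux: "norm (flux \<phi> a) = \<phi> (norm a)"
  using phi_0 phi_nonneg[of "norm a"] by (cases "a = 0") (auto simp: flux_def)

text \<open>The tangent inequality is applied at \<open>a\<close> to the midpoint of \<open>a\<close> and \<open>b\<close>; Clarkson's inequality
  then passes from the midpoint to \<open>b\<close> and leaves a remainder that measures \<open>b - a\<close>.\<close>

lemma flux_convexity:
  "\<Phi> (norm a) + flux \<phi> a \<bullet> (b - a) + 2 * \<Phi> (norm ((1/2) *\<^sub>R (b - a))) \<le> \<Phi> (norm b)"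
proof -
  define c where "c = (1/2) *\<^sub>R (b + a)"
  have "\<Phi> (norm a) + \<phi> (norm a) * (norm c - norm a) \<le> \<Phi> (norm c)"
    by (rule Phi_tangent) auto
  moreover have "flux \<phi> a \<bullet> (c - a) \<le> \<phi> (norm a) * (norm c - norm a)"
  proof (cases "a = 0")
    case False
    have "flux \<phi> a \<bullet> a = \<phi> (norm a) * norm a"
      using False by (simp add: flux_def power2_norm_eq_inner[symmetric] power2_eq_square)
    moreover have "flux \<phi> a \<bullet> c \<le> \<phi> (norm a) * norm c"
      using norm_cauchy_schwarz[of "flux \<phi> a" c] by (simp add: norm_flux)
    ultimately show ?thesis by (simp add: inner_diff_right algebra_simps)
  qed (simp add: flux_def phi_0)
  moreover have "2 * (flux \<phi> a \<bullet> (c - a)) = flux \<phi> a \<bullet> (b - a)"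
    by (simp add: c_def inner_simps)
  moreover have "2 * \<Phi> (norm c) + 2 * \<Phi> (norm ((1/2) *\<^sub>R (b - a))) \<le> \<Phi> (norm b) + \<Phi> (norm a)"
    unfolding c_def by (rule clarkson)
  ultimately show ?thesis by linarith
qed

lemma phi_mult_le: "0 \<le> s \<Longrightarrow> s * \<phi> s \<le> 2 * \<kappa> * \<Phi> s"
proof -
  assume s: "0 \<le> s"
  have "(s/2) * \<phi> (s/2) \<le> \<Phi> s"
    using Phi_tangent[of "s/2" s] Phi_nonneg[of "s/2"] s by (simp add: field_simps)
  moreover have "s * \<phi> s \<le> s * (\<kappa> * \<phi> (s/2))"
    using phi_double[of "s/2"] s by (intro mult_left_mono) auto
  ultimately have "s * \<phi> s \<le> s * (\<kappa> * \<phi> (s/2))" "\<kappa> * ((s/2) * \<phi> (s/2)) \<le> \<kappa> * \<Phi> s"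
    using kappa_ge_1 by (auto intro!: mult_left_mono)
  then show ?thesis by (simp add: algebra_simps)
qed

lemma Phi_double: "0 \<le> t \<Longrightarrow> \<Phi> (2 * t) \<le> 4 * \<kappa>\<^sup>2 * \<Phi> t"
proof -
  assume t: "0 \<le> t"
  have "\<Phi> (2 * t) \<le> 2 * t * \<phi> (2 * t)" using Phi_le[of "2 * t"] t by simp
  also have "\<dots> \<le> 2 * t * (\<kappa> * \<phi> t)" using phi_double[OF t] t by (intro mult_left_mono) auto
  also have "\<dots> = 2 * \<kappa> * (t * \<phi> t)" by simp
  also have "\<dots> \<le> 2 * \<kappa> * (2 * \<kappa> * \<Phi> t)"
    using phi_mult_le[OF t] kappa_ge_1 by (intro mult_left_mono) auto
  finally show ?thesis by (simp add: power2_eq_square)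
qed

lemma Phi_scale:
  assumes c: "c \<ge> 0"
  obtains C where "C > 0" "\<And>t. 0 \<le> t \<Longrightarrow> \<Phi> (c * t) \<le> C * \<Phi> t"
proof -
  obtain n :: nat where n: "c \<le> 2 ^ n"
    using real_arch_pow[of 2 c] by (auto intro: less_imp_le)
  have "\<Phi> (2 ^ n * t) \<le> (4 * \<kappa>\<^sup>2) ^ n * \<Phi> t" if "0 \<le> t" for t n
  proof (induction n)
    case (Suc n)
    have "\<Phi> (2 ^ Suc n * t) \<le> 4 * \<kappa>\<^sup>2 * \<Phi> (2 ^ n * t)"
      using Phi_double[of "2 ^ n * t"] that by (simp add: mult.assoc)
    also have "\<dots> \<le> 4 * \<kappa>\<^sup>2 * ((4 * \<kappa>\<^sup>2) ^ n * \<Phi> t)"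
      using Suc by (intro mult_left_mono) auto
    finally show ?case by simp
  qed simp
  note pow = this
  have "\<Phi> (c * t) \<le> (4 * \<kappa>\<^sup>2) ^ n * \<Phi> t" if t: "0 \<le> t" for t
  proof -
    have "\<Phi> (c * t) \<le> \<Phi> (2 ^ n * t)"
      using n t c by (intro Phi_mono mult_right_mono) auto
    then show ?thesis using pow[OF t, of n] by linarith
  qed
  then show ?thesis using that[of "(4 * \<kappa>\<^sup>2) ^ n"] kappa_ge_1 by auto
qed

text \<open>Energies are compared through this inequality: the factor of the main term is as close to \<open>1\<close> as
  desired, and only the perturbation pays a large constant.\<close>

lemma Phi_add_eps:
  assumes "\<delta> > 0"
  obtains C where "C > 0" "\<And>a b. 0 \<le> a \<Longrightarrow> 0 \<le> b \<Longrightarrow> \<Phi> (a + b) \<le> (1 + \<delta>) * \<Phi> a + C * \<Phi> b"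
proof -
  \<comment> \<open>If \<open>b \<le> \<eta> a\<close>, the tangent at \<open>a + b\<close> costs at most \<open>2 \<kappa>\<^sup>2 \<eta> \<Phi> a\<close>; otherwise \<open>a\<close> is dominated by \<open>b\<close>.\<close>
  define \<eta> where "\<eta> = min 1 (\<delta> / (2 * \<kappa>\<^sup>2))"
  have \<eta>: "0 < \<eta>" "\<eta> \<le> 1" "\<eta> * (2 * \<kappa>\<^sup>2) \<le> \<delta>"
    using assms kappa_ge_1 min.cobounded2[of 1 "\<delta> / (2 * \<kappa>\<^sup>2)"]
    by (auto simp: \<eta>_def pos_le_divide_eq[symmetric] simp del: min.cobounded2)
  obtain C where C: "C > 0" "\<And>t. 0 \<le> t \<Longrightarrow> \<Phi> ((1/\<eta> + 1) * t) \<le> C * \<Phi> t"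
    using Phi_scale[of "1/\<eta> + 1"] \<eta> by auto
  have "\<Phi> (a + b) \<le> (1 + \<delta>) * \<Phi> a + C * \<Phi> b" if ab: "0 \<le> a" "0 \<le> b" for a b
  proof (cases "b \<le> \<eta> * a")
    case True
    have "b \<le> a" using True \<eta> ab mult_right_mono[of \<eta> 1 a] by linarith
    have "\<Phi> (a + b) \<le> \<Phi> a + \<phi> (a + b) * b"
      using Phi_tangent[of "a + b" a] ab by simp
    also have "\<phi> (a + b) * b \<le> (\<kappa> * \<phi> a) * (\<eta> * a)"
      using phi_le[of "a + b" "2 * a"] phi_double[OF ab(1)] \<open>b \<le> a\<close> ab True phi_nonneg[of "a + b"]
      by (intro mult_mono) auto
    also have "\<dots> = (\<kappa> * \<eta>) * (a * \<phi> a)" by simp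
    also have "\<dots> \<le> (\<kappa> * \<eta>) * (2 * \<kappa> * \<Phi> a)"
      using phi_mult_le[OF ab(1)] \<eta> kappa_ge_1 by (intro mult_left_mono) auto
    also have "\<dots> = \<eta> * (2 * \<kappa>\<^sup>2) * \<Phi> a" by (simp add: power2_eq_square)
    also have "\<dots> \<le> \<delta> * \<Phi> a" using \<eta>(3) Phi_nonneg[OF ab(1)] by (rule mult_right_mono)
    finally have "\<Phi> (a + b) \<le> \<Phi> a + \<delta> * \<Phi> a" by simp
    moreover have "0 \<le> C * \<Phi> b" using C(1) Phi_nonneg[OF ab(2)] by simp
    ultimately show ?thesis by (simp add: algebra_simps)
  next
    case False
    then have "a \<le> 1/\<eta> * b" using \<eta> by (simp add: field_simps)
    then have "\<Phi> (a + b) \<le> \<Phi> ((1/\<eta> + 1) * b)"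
      using ab by (intro Phi_mono) (auto simp: algebra_simps)
    also have "\<dots> \<le> C * \<Phi> b" using C(2) ab by simp
    finally have "\<Phi> (a + b) \<le> C * \<Phi> b" .
    moreover have "0 \<le> (1 + \<delta>) * \<Phi> a" using assms Phi_nonneg[OF ab(1)] by simp
    ultimately show ?thesis by linarith
  qed
  then show ?thesis using that C(1) by blast
qed

text \<open>Modular convergence implies convergence in \<open>L\<^sup>1\<close> on sets of finite measure by this estimate.\<close>

lemma linear_le_eps_Phi:
  assumes "\<delta> > 0"
  obtains C where "C > 0" "\<And>t. 0 \<le> t \<Longrightarrow> t \<le> \<delta> + C * \<Phi> t"
proof -
  have p: "\<Phi> \<delta> > 0" using Phi_pos assms by simp
  have "t \<le> \<delta> + \<delta> / \<Phi> \<delta> * \<Phi> t" if t: "0 \<le> t" for t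
  proof (cases "t \<le> \<delta>")
    case True
    have "0 \<le> \<delta> / \<Phi> \<delta> * \<Phi> t" using p assms Phi_nonneg[OF t] by simp
    then show ?thesis using True by linarith
  next
    case False
    have "\<Phi> \<delta> * t\<^sup>2 \<le> \<Phi> t * \<delta>\<^sup>2" using Phi_square_scale[of \<delta> t] False assms by simp
    also have "\<dots> \<le> \<Phi> t * (\<delta> * t)"
      using False assms Phi_nonneg[OF t] by (intro mult_left_mono) (auto simp: power2_eq_square)
    finally have "(\<Phi> \<delta> * t) * t \<le> (\<Phi> t * \<delta>) * t" by (simp add: power2_eq_square mult_ac)
    then have "\<Phi> \<delta> * t \<le> \<Phi> t * \<delta>" using False assms by simp
    then have "t \<le> \<delta> / \<Phi> \<delta> * \<Phi> t" using p by (simp add: field_simps)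
    then show ?thesis using assms by linarith
  qed
  then show ?thesis using that[of "\<delta> / \<Phi> \<delta>"] p assms by simp
qed

lemma Phi_superlinear:
  assumes "\<delta> > 0"
  obtains R where "R > 0" "\<And>t. R \<le> t \<Longrightarrow> t \<le> \<delta> * \<Phi> t"
proof -
  define R where "R = max 1 (1 / (\<delta> * \<Phi> 1))"
  have p: "\<Phi> 1 > 0" using Phi_pos by simp
  have "t \<le> \<delta> * \<Phi> t" if "R \<le> t" for t
  proof -
    have t: "1 \<le> t" "1 / (\<delta> * \<Phi> 1) \<le> t" using that by (auto simp: R_def)
    then have "1 \<le> \<delta> * \<Phi> 1 * t" using assms p by (simp add: field_simps)
    then have "t \<le> \<delta> * \<Phi> 1 * t * t" using mult_right_mono[of 1 "\<delta> * \<Phi> 1 * t" t] t by simp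
    also have "\<dots> \<le> \<delta> * \<Phi> t"
      using Phi_square_scale[of 1 t] t assms by (simp add: power2_eq_square mult.assoc)
    finally show ?thesis .
  qed
  then show ?thesis using that[of R] by (auto simp: R_def)
qed

text \<open>Young's inequality for the product of \<open>\<phi>(s)\<close> and \<open>t\<close>, without the complementary function: either
  \<open>t\<close> is at most a small multiple of \<open>s\<close>, or \<open>s\<close> is controlled by \<open>t\<close>.\<close>

lemma phi_mult_eps:
  assumes "\<delta> > 0"
  obtains C where "C > 0" "\<And>s t. 0 \<le> s \<Longrightarrow> 0 \<le> t \<Longrightarrow> \<phi> s * t \<le> \<delta> * \<Phi> s + C * \<Phi> t"
proof -
  define \<eta> where "\<eta> = \<delta> / (2 * \<kappa>)"
  have \<eta>: "0 < \<eta>" using assms kappa_ge_1 by (simp add: \<eta>_def)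
  have \<eta>2: "\<eta> * (2 * \<kappa>) = \<delta>" using kappa_ge_1 by (simp add: \<eta>_def)
  obtain C where C: "C > 0" "\<And>t. 0 \<le> t \<Longrightarrow> \<Phi> (1/\<eta> * t) \<le> C * \<Phi> t"
    using Phi_scale[of "1/\<eta>"] \<eta> by auto
  have "\<phi> s * t \<le> \<delta> * \<Phi> s + (\<delta> * C) * \<Phi> t" if st: "0 \<le> s" "0 \<le> t" for s t
  proof -
    have *: "\<phi> r * (\<eta> * r) \<le> \<delta> * \<Phi> r" if "0 \<le> r" for r
      using mult_left_mono[OF phi_mult_le[OF that], of \<eta>] \<eta> unfolding \<eta>2[symmetric] by (simp add: mult_ac)
    have nn: "0 \<le> \<delta> * \<Phi> s" "0 \<le> (\<delta> * C) * \<Phi> t" using st C assms by (simp_all add: Phi_nonneg)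
    show ?thesis
    proof (cases "t \<le> \<eta> * s")
      case True
      then have "\<phi> s * t \<le> \<phi> s * (\<eta> * s)" using phi_nonneg[OF st(1)] by (rule mult_left_mono)
      then show ?thesis using *[OF st(1)] nn by linarith
    next
      case False
      then have "s \<le> 1/\<eta> * t" using \<eta> by (simp add: field_simps)
      then have "\<phi> s * t \<le> \<phi> (1/\<eta> * t) * (\<eta> * (1/\<eta> * t))"
        using st \<eta> by (intro mult_mono phi_le) (auto intro: phi_nonneg)
      also have "\<dots> \<le> \<delta> * \<Phi> (1/\<eta> * t)" using *[of "1/\<eta> * t"] st \<eta> by simp
      also have "\<dots> \<le> \<delta> * (C * \<Phi> t)" using C(2)[OF st(2)] assms by (intro mult_left_mono) auto
      finally show ?thesis using nn by simp
    qed
  qed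
  then show ?thesis using that[of "\<delta> * C"] C assms by simp
qed

lemma bdd_above_complementary: "bdd_above ((\<lambda>w. t * w - \<Phi> w) ` {0<..})"
proof -
  obtain R where R: "R > 0" "\<And>w. R \<le> w \<Longrightarrow> w \<le> 1 / (\<bar>t\<bar> + 1) * \<Phi> w"
    using Phi_superlinear[of "1 / (\<bar>t\<bar> + 1)"] by (metis abs_add_one_gt_zero add.commute zero_less_divide_1_iff)
  have "t * w - \<Phi> w \<le> \<bar>t\<bar> * R" if w: "w > 0" for w
  proof (cases "R \<le> w")
    case True
    have "t * w \<le> (\<bar>t\<bar> + 1) * w" using w by (intro mult_right_mono) auto
    also have "\<dots> \<le> \<Phi> w" using R(2)[OF True] by (simp add: field_simps)
    finally show ?thesis using mult_nonneg_nonneg[of "\<bar>t\<bar>" R] R(1) by linarith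
  next
    case False
    have "t * w \<le> \<bar>t\<bar> * R" using False w by (intro mult_mono) auto
    then show ?thesis using Phi_nonneg[of w] w by linarith
  qed
  then show ?thesis by (auto simp: bdd_above_def)
qed

abbreviation "\<Psi> \<equiv> complementary \<Phi>"

lemma young_inequality:
  assumes w: "0 \<le> w" shows "t * w \<le> \<Psi> t + \<Phi> w"
proof (cases "w = 0")
  case False
  then have "t * w - \<Phi> w \<le> \<Psi> t"
    unfolding complementary_def using bdd_above_complementary w by (intro cSUP_upper) auto
  then show ?thesis by simp
next
  case True
  have "((\<lambda>w. t * w - \<Phi> \<bar>w\<bar>) \<longlongrightarrow> t * 0 - \<Phi> \<bar>0\<bar>) (at_right 0)"
    by (intro tendsto_intros tendsto_within_subset[OF DERIV_isCont[OF Phi_abs_has_derivative, unfolded isCont_def]]) auto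
  then have "((\<lambda>w. t * w - \<Phi> \<bar>w\<bar>) \<longlongrightarrow> 0) (at_right 0)" by (simp add: Phi_0)
  moreover have "\<forall>\<^sub>F w in at_right 0. t * w - \<Phi> \<bar>w\<bar> \<le> \<Psi> t"
  proof -
    have "t * w - \<Phi> \<bar>w\<bar> \<le> \<Psi> t" if "w > 0" for w
      unfolding complementary_def using cSUP_upper[OF _ bdd_above_complementary, of w] that by simp
    then show ?thesis by (auto simp: eventually_at_right_less[THEN eventually_mono])
  qed
  ultimately have "0 \<le> \<Psi> t" by (rule tendsto_upperbound) simp
  then show ?thesis using True by (simp add: Phi_0)
qed

lemma complementary_nonneg: "0 \<le> \<Psi> t"
  using young_inequality[of 0 t] by (simp add: Phi_0)

lemma complementary_mono: "s \<le> t \<Longrightarrow> \<Psi> s \<le> \<Psi> t"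
  unfolding complementary_def
  by (rule cSUP_mono[OF _ bdd_above_complementary]) (auto intro!: mult_right_mono bexI)

lemma complementary_measurable: "(\<lambda>x. \<Psi> x) \<in> borel_measurable borel"
  by (rule borel_measurable_mono) (auto simp: mono_def complementary_mono)

text \<open>Quadratic growth of \<open>\<Phi>\<close> from below turns into doubling of the complementary function.\<close>

lemma complementary_double: "\<Psi> (2 * t) \<le> 4 * \<Psi> t"
  unfolding complementary_def[of \<Phi> "2 * t"]
proof (rule cSUP_least)
  fix w :: real assume w: "w \<in> {0<..}"
  have "t * (w/2) \<le> \<Psi> t + \<Phi> (w/2)" using w by (intro young_inequality) auto
  moreover have "4 * \<Phi> (w/2) \<le> \<Phi> w" using Phi_quadruple[of "w/2"] w by simp
  ultimately show "2 * t * w - \<Phi> w \<le> 4 * \<Psi> t" by (simp add: field_simps)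
qed simp

lemma complementary_scale:
  obtains C where "C > 0" "\<And>t. 0 \<le> t \<Longrightarrow> \<Psi> (c * t) \<le> C * \<Psi> t"
proof -
  obtain n :: nat where n: "c \<le> 2 ^ n"
    using real_arch_pow[of 2 c] by (auto intro: less_imp_le)
  have "\<Psi> (2 ^ n * t) \<le> 4 ^ n * \<Psi> t" for t n
  proof (induction n)
    case (Suc n)
    then show ?case using complementary_double[of "2 ^ n * t"] by (simp add: mult.assoc)
  qed simp
  then have "\<Psi> (c * t) \<le> 4 ^ n * \<Psi> t" if "0 \<le> t" for t
    using complementary_mono[of "c * t" "2 ^ n * t"] mult_right_mono[OF n that] by (meson order_trans)
  then show ?thesis using that[of "4 ^ n"] by simp
qed

end

section \<open>The modular\<close>

context young
begin

definition in_LPhi :: "('a::euclidean_space \<Rightarrow> 'b::euclidean_space) \<Rightarrow> bool" where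
  "in_LPhi v \<longleftrightarrow> v \<in> borel_measurable lebesgue \<and> integrable lebesgue (\<lambda>x. \<Phi> (norm (v x)))"

definition modular :: "('a::euclidean_space \<Rightarrow> 'b::euclidean_space) \<Rightarrow> real" where
  "modular v = integral\<^sup>L lebesgue (\<lambda>x. \<Phi> (norm (v x)))"

lemma modular_nonneg: "0 \<le> modular v"
  unfolding modular_def by (rule integral_nonneg_AE) (simp add: Phi_nonneg)

lemma Phi_norm_measurable:
  fixes v :: "'a \<Rightarrow> 'b::euclidean_space"
  assumes "v \<in> borel_measurable M" shows "(\<lambda>x. \<Phi> (norm (v x))) \<in> borel_measurable M"
  by (rule measurable_compose[OF assms borel_measurable_continuous_onI[OF continuous_on_Phi_norm[OF continuous_on_id]]])

lemma in_LPhi_bound: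
  fixes u :: "'a::euclidean_space \<Rightarrow> 'b::euclidean_space"
  assumes u: "u \<in> borel_measurable lebesgue" and g: "integrable lebesgue g"
    and le: "\<And>x. \<Phi> (norm (u x)) \<le> g x"
  shows "in_LPhi u" "modular u \<le> integral\<^sup>L lebesgue g"
proof -
  have i: "integrable lebesgue (\<lambda>x. \<Phi> (norm (u x)))"
    using g by (rule Bochner_Integration.integrable_bound)
      (use u le in \<open>auto intro!: Phi_norm_measurable AE_I2 order_trans[OF le abs_ge_self] simp: Phi_nonneg\<close>)
  then show "in_LPhi u" using u by (simp add: in_LPhi_def)
  show "modular u \<le> integral\<^sup>L lebesgue g"
    unfolding modular_def by (rule integral_mono[OF i g le])
qed

lemma in_LPhi_mono:
  fixes u :: "'a::euclidean_space \<Rightarrow> 'b::euclidean_space" and v :: "'a \<Rightarrow> 'c::euclidean_space"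
  assumes "u \<in> borel_measurable lebesgue" "in_LPhi v" "\<And>x. norm (u x) \<le> norm (v x)"
  shows "in_LPhi u" "modular u \<le> modular v"
proof -
  have "integrable lebesgue (\<lambda>x. \<Phi> (norm (v x)))" using assms(2) by (simp add: in_LPhi_def)
  from in_LPhi_bound[OF assms(1) this Phi_mono[OF norm_ge_zero assms(3)]]
  show "in_LPhi u" "modular u \<le> modular v" by (simp_all add: modular_def)
qed

lemma in_LPhi_continuous:
  fixes g :: "'a::euclidean_space \<Rightarrow> 'b::euclidean_space"
  assumes g: "continuous_on UNIV g" and K: "compact K" "\<And>x. x \<notin> K \<Longrightarrow> g x = 0"
  shows "in_LPhi g"
  unfolding in_LPhi_def
proof
  show "g \<in> borel_measurable lebesgue"
    using integrable_continuous_compact_support[OF g K] by simp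
  show "integrable lebesgue (\<lambda>x. \<Phi> (norm (g x)))"
    by (rule integrable_continuous_compact_support[OF continuous_on_Phi_norm[OF g] K(1)]) (simp add: K(2) Phi_0)
qed

lemma in_LPhi_test: "\<psi> \<in> test_functions \<Omega> \<Longrightarrow> in_LPhi \<psi>"
  by (erule test_functionsE, rule in_LPhi_continuous) (auto intro: smooth_continuous)

lemma in_LPhi_grad_test: "\<psi> \<in> test_functions \<Omega> \<Longrightarrow> in_LPhi (grad \<psi>)"
proof (erule test_functionsE)
  fix K assume K: "smooth \<psi>" "compact K" "\<And>x. x \<notin> K \<Longrightarrow> \<psi> x = 0"
  show "in_LPhi (grad \<psi>)"
    by (rule in_LPhi_continuous[OF continuous_on_grad[OF K(1)] K(2)])
      (rule grad_zero_outside[OF compact_imp_closed[OF K(2)] K(3)])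
qed

lemma Phi_quasi_triangle: "0 \<le> a \<Longrightarrow> 0 \<le> b \<Longrightarrow> \<Phi> (a + b) \<le> 4 * \<kappa>\<^sup>2 * (\<Phi> a + \<Phi> b)"
proof -
  assume ab: "0 \<le> a" "0 \<le> b"
  have "\<Phi> (a + b) \<le> \<Phi> (2 * max a b)" using ab by (intro Phi_mono) auto
  also have "\<dots> \<le> 4 * \<kappa>\<^sup>2 * \<Phi> (max a b)" using ab by (intro Phi_double) auto
  also have "\<dots> \<le> 4 * \<kappa>\<^sup>2 * (\<Phi> a + \<Phi> b)"
    using ab by (intro mult_left_mono) (auto simp: max_def Phi_nonneg)
  finally show ?thesis .
qed

lemma in_LPhi_add_eps:
  fixes u v :: "'a::euclidean_space \<Rightarrow> 'b::euclidean_space"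
  assumes u: "in_LPhi u" and v: "in_LPhi v" and w: "w \<in> borel_measurable lebesgue"
    and le: "\<And>x. norm (w x :: 'c::euclidean_space) \<le> norm (u x) + norm (v x)"
    and C: "\<And>a b. 0 \<le> a \<Longrightarrow> 0 \<le> b \<Longrightarrow> \<Phi> (a + b) \<le> c * \<Phi> a + d * \<Phi> b"
  shows "in_LPhi w" "modular w \<le> c * modular u + d * modular v"
proof -
  have i: "integrable lebesgue (\<lambda>x. c * \<Phi> (norm (u x)))" "integrable lebesgue (\<lambda>x. d * \<Phi> (norm (v x)))"
    using u v by (auto simp: in_LPhi_def)
  have p: "\<Phi> (norm (w x)) \<le> c * \<Phi> (norm (u x)) + d * \<Phi> (norm (v x))" for x
    using Phi_mono[OF _ le[of x]] C[of "norm (u x)" "norm (v x)"] by fastforce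
  from in_LPhi_bound[OF w Bochner_Integration.integrable_add[OF i] p]
  show "in_LPhi w" "modular w \<le> c * modular u + d * modular v"
    using i u v by (auto simp: modular_def in_LPhi_def)
qed

lemma
  fixes u v :: "'a::euclidean_space \<Rightarrow> 'b::euclidean_space"
  assumes u: "in_LPhi u" and v: "in_LPhi v"
  shows in_LPhi_diff: "in_LPhi (\<lambda>x. u x - v x)"
    and modular_add_le: "modular (\<lambda>x. u x + v x) \<le> 4 * \<kappa>\<^sup>2 * (modular u + modular v)"
proof -
  have m: "(\<lambda>x. u x - v x) \<in> borel_measurable lebesgue" "(\<lambda>x. u x + v x) \<in> borel_measurable lebesgue"
    using u v by (auto simp: in_LPhi_def)
  have q: "\<Phi> (a + b) \<le> 4 * \<kappa>\<^sup>2 * \<Phi> a + 4 * \<kappa>\<^sup>2 * \<Phi> b" if "0 \<le> a" "0 \<le> b" for a b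
    using Phi_quasi_triangle[OF that] by (simp add: algebra_simps)
  from in_LPhi_add_eps(1)[OF u v m(1) norm_triangle_ineq4 q] in_LPhi_add_eps(2)[OF u v m(2) norm_triangle_ineq q]
  show "in_LPhi (\<lambda>x. u x - v x)" "modular (\<lambda>x. u x + v x) \<le> 4 * \<kappa>\<^sup>2 * (modular u + modular v)"
    by (simp_all add: algebra_simps)
qed

lemma modular_triangle:
  fixes u v w :: "'a::euclidean_space \<Rightarrow> 'b::euclidean_space"
  assumes "in_LPhi u" "in_LPhi v" "in_LPhi w"
  shows "modular (\<lambda>x. u x - w x) \<le> 4 * \<kappa>\<^sup>2 * (modular (\<lambda>x. u x - v x) + modular (\<lambda>x. v x - w x))"
  using modular_add_le[OF in_LPhi_diff[OF assms(1,2)] in_LPhi_diff[OF assms(2,3)]] by simp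

lemma modular_minus_commute: "modular (\<lambda>x. u x - v x) = modular (\<lambda>x. v x - u x)"
  by (simp add: modular_def norm_minus_commute)

lemma
  fixes v :: "'a::euclidean_space \<Rightarrow> 'b::euclidean_space"
  assumes v: "in_LPhi v" and C: "\<And>t. 0 \<le> t \<Longrightarrow> \<Phi> (\<bar>c\<bar> * t) \<le> C * \<Phi> t"
  shows in_LPhi_scale: "in_LPhi (\<lambda>x. c *\<^sub>R v x)"
    and modular_scale: "modular (\<lambda>x. c *\<^sub>R v x) \<le> C * modular v"
proof -
  have m: "(\<lambda>x. c *\<^sub>R v x) \<in> borel_measurable lebesgue"
    using v by (intro borel_measurable_scaleR borel_measurable_const) (simp add: in_LPhi_def)
  have i: "integrable lebesgue (\<lambda>x. C * \<Phi> (norm (v x)))" using v by (simp add: in_LPhi_def)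
  have "\<Phi> (norm (c *\<^sub>R v x)) \<le> C * \<Phi> (norm (v x))" for x using C[of "norm (v x)"] by simp
  from in_LPhi_bound[OF m i this]
  show "in_LPhi (\<lambda>x. c *\<^sub>R v x)" "modular (\<lambda>x. c *\<^sub>R v x) \<le> C * modular v"
    by (simp_all add: modular_def)
qed

lemma in_LPhi_integrable:
  fixes v :: "'a::euclidean_space \<Rightarrow> 'b::euclidean_space"
  assumes v: "in_LPhi v" and D: "D \<in> lmeasurable" and out: "\<And>x. x \<notin> D \<Longrightarrow> v x = 0"
    and C: "0 \<le> \<delta>" "\<And>t. 0 \<le> t \<Longrightarrow> t \<le> \<delta> + C * \<Phi> t"
  shows "integrable lebesgue v" "integral\<^sup>L lebesgue (\<lambda>x. norm (v x)) \<le> \<delta> * measure lebesgue D + C * modular v"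
proof -
  have i: "integrable lebesgue (\<lambda>x. \<delta> * indicator D x)" "integrable lebesgue (\<lambda>x. C * \<Phi> (norm (v x)))"
    using v D by (auto simp: in_LPhi_def fmeasurable_def)
  have le: "norm (v x) \<le> \<delta> * indicator D x + C * \<Phi> (norm (v x))" for x
    using C(2)[of "norm (v x)"] out[of x] by (cases "x \<in> D") (auto simp: Phi_0)
  have iv: "integrable lebesgue (\<lambda>x. norm (v x))"
    by (rule Bochner_Integration.integrable_bound[OF Bochner_Integration.integrable_add[OF i]])
      (use v le in \<open>auto simp: in_LPhi_def intro!: AE_I2 order_trans[OF le abs_ge_self]\<close>)
  then show "integrable lebesgue v" using v by (simp add: in_LPhi_def integrable_norm_iff)
  have "integral\<^sup>L lebesgue (\<lambda>x. norm (v x)) \<le> integral\<^sup>L lebesgue (\<lambda>x. \<delta> * indicator D x + C * \<Phi> (norm (v x)))"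
    by (rule integral_mono[OF iv Bochner_Integration.integrable_add[OF i] le])
  also have "\<dots> = \<delta> * measure lebesgue D + C * modular v"
    using i D by (simp add: modular_def)
  finally show "integral\<^sup>L lebesgue (\<lambda>x. norm (v x)) \<le> \<delta> * measure lebesgue D + C * modular v" .
qed

lemma continuous_on_sgn_phi: "continuous_on UNIV (\<lambda>s. sgn s * \<phi> \<bar>s\<bar>)"
proof -
  have "(\<lambda>s. sgn s * \<phi> \<bar>s\<bar>) = (\<lambda>s. \<phi> (max s 0) - \<phi> (max (- s) 0))"
    by (auto simp: fun_eq_iff sgn_if max_def phi_0)
  moreover have "continuous_on UNIV (\<lambda>s::real. \<phi> (max s 0))" "continuous_on UNIV (\<lambda>s::real. \<phi> (max (- s) 0))"
    by (rule continuous_on_compose2[OF phi_cont]; auto intro!: continuous_intros)+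
  ultimately show ?thesis
    using continuous_on_diff[of UNIV "\<lambda>s. \<phi> (max s 0)" "\<lambda>s. \<phi> (max (- s) 0)"] by (simp only:)
qed

text \<open>The integral of the derivative of \<open>(x \<bullet> b) \<Phi>(|\<psi>|)\<close> vanishes.  On the bounded set \<open>D\<close> this bounds
  the modular of \<open>\<psi>\<close> by a multiple of the integral of \<open>\<phi>(|\<psi>|) |\<nabla>\<psi>|\<close>, which \<open>phi_mult_eps\<close> splits into half
  the modular of \<open>\<psi>\<close>, absorbed on the left, and a multiple of the modular of the gradient.\<close>

lemma poincare:
  fixes D :: "'a::euclidean_space set"
  assumes "bounded D"
  obtains C where "C > 0" "\<And>\<psi>. \<psi> \<in> test_functions D \<Longrightarrow> modular \<psi> \<le> C * modular (grad \<psi>)"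
proof -
  obtain b :: 'a where b: "b \<in> Basis" using nonempty_Basis by blast
  obtain R where R: "R > 0" "\<And>x. x \<in> D \<Longrightarrow> norm x \<le> R" using assms by (auto simp: bounded_pos)
  have "1 / (2 * R) > 0" using R by simp
  then obtain C where C: "C > 0" "\<And>s t. 0 \<le> s \<Longrightarrow> 0 \<le> t \<Longrightarrow> \<phi> s * t \<le> 1 / (2 * R) * \<Phi> s + C * \<Phi> t"
    by (rule phi_mult_eps) blast
  have "modular \<psi> \<le> (2 * R * C) * modular (grad \<psi>)" if psi: "\<psi> \<in> test_functions D" for \<psi>
  proof -
    obtain K where K: "smooth \<psi>" "compact K" "K \<subseteq> D" "\<And>x. x \<notin> K \<Longrightarrow> \<psi> x = 0"
      using test_functionsE[OF psi] by metis
    define H where "H x = (x \<bullet> b) * (sgn (\<psi> x) * \<phi> \<bar>\<psi> x\<bar> * (grad \<psi> x \<bullet> b))" for x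
    have cpsi: "continuous_on UNIV \<psi>" by (rule smooth_continuous[OF K(1)])
    have cs: "continuous_on UNIV (\<lambda>x. sgn (\<psi> x) * \<phi> \<bar>\<psi> x\<bar>)"
      by (rule continuous_on_compose2[OF continuous_on_sgn_phi cpsi]) simp
    have cP: "continuous_on UNIV (\<lambda>x. \<Phi> \<bar>\<psi> x\<bar>)"
      using continuous_on_Phi_norm[OF cpsi] by simp
    have cH: "continuous_on UNIV H"
      unfolding H_def by (intro continuous_intros cs continuous_on_grad K(1))
    have "integral\<^sup>L lebesgue (\<lambda>x. (x \<bullet> b) * (sgn (\<psi> x) * \<phi> \<bar>\<psi> x\<bar> * (grad \<psi> x \<bullet> b)) + (b \<bullet> b) * \<Phi> \<bar>\<psi> x\<bar>) = 0"
    proof (rule integral_directional_derivative_eq_0[where F="\<lambda>x. (x \<bullet> b) * \<Phi> \<bar>\<psi> x\<bar>" and K=K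
          and F'="\<lambda>x h. (x \<bullet> b) * (sgn (\<psi> x) * \<phi> \<bar>\<psi> x\<bar> * (grad \<psi> x \<bullet> h)) + (h \<bullet> b) * \<Phi> \<bar>\<psi> x\<bar>"])
      fix x
      have "((\<lambda>x. \<Phi> \<bar>\<psi> x\<bar>) has_derivative (\<lambda>h. sgn (\<psi> x) * \<phi> \<bar>\<psi> x\<bar> * (grad \<psi> x \<bullet> h))) (at x)"
        using has_derivative_compose[OF has_derivative_grad[OF K(1)], of "\<lambda>s. \<Phi> \<bar>s\<bar>"] Phi_abs_has_derivative[of "\<psi> x"]
        by (simp add: has_field_derivative_def)
      then show "((\<lambda>x. (x \<bullet> b) * \<Phi> \<bar>\<psi> x\<bar>) has_derivative
          (\<lambda>h. (x \<bullet> b) * (sgn (\<psi> x) * \<phi> \<bar>\<psi> x\<bar> * (grad \<psi> x \<bullet> h)) + (h \<bullet> b) * \<Phi> \<bar>\<psi> x\<bar>)) (at x)"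
        by (intro has_derivative_mult) (auto intro!: derivative_eq_intros)
    next
      show "continuous_on UNIV (\<lambda>x. (x \<bullet> b) * (sgn (\<psi> x) * \<phi> \<bar>\<psi> x\<bar> * (grad \<psi> x \<bullet> b)) + (b \<bullet> b) * \<Phi> \<bar>\<psi> x\<bar>)"
        using continuous_on_add[OF cH continuous_on_mult_left[OF cP]] by (simp add: H_def)
    qed (use K in \<open>auto simp: Phi_0\<close>)
    then have z: "integral\<^sup>L lebesgue (\<lambda>x. H x + \<Phi> (norm (\<psi> x))) = 0"
      using b by (simp add: H_def)
    have iP: "integrable lebesgue (\<lambda>x. \<Phi> (norm (\<psi> x)))"
      using in_LPhi_test[OF psi] by (simp add: in_LPhi_def)
    have iH: "integrable lebesgue H"
      by (rule integrable_continuous_compact_support[OF cH K(2)]) (simp add: H_def K(4))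
    have eq: "modular \<psi> = - integral\<^sup>L lebesgue H"
      using z Bochner_Integration.integral_add[OF iH iP] by (simp add: modular_def)
    have iG: "integrable lebesgue (\<lambda>x. \<Phi> (norm (grad \<psi> x)))"
      using in_LPhi_grad_test[OF psi] by (simp add: in_LPhi_def)
    have le: "- H x \<le> 1/2 * \<Phi> (norm (\<psi> x)) + R * C * \<Phi> (norm (grad \<psi> x))" for x
    proof (cases "x \<in> D")
      case True
      have "\<bar>grad \<psi> x \<bullet> b\<bar> \<le> norm (grad \<psi> x)" "\<bar>x \<bullet> b\<bar> \<le> R"
        using Basis_le_norm[OF b] R(2)[OF True] by (auto intro: order_trans)
      moreover have "\<bar>sgn (\<psi> x)\<bar> \<le> 1" by (simp add: sgn_if)
      ultimately have "\<bar>x \<bullet> b\<bar> * (\<bar>sgn (\<psi> x)\<bar> * \<bar>\<phi> \<bar>\<psi> x\<bar>\<bar> * \<bar>grad \<psi> x \<bullet> b\<bar>) \<le> R * (1 * \<bar>\<phi> \<bar>\<psi> x\<bar>\<bar> * norm (grad \<psi> x))"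
        by (intro mult_mono) auto
      then have "- H x \<le> R * (\<phi> \<bar>\<psi> x\<bar> * norm (grad \<psi> x))"
        using phi_nonneg[of "\<bar>\<psi> x\<bar>"] abs_ge_minus_self[of "H x"] by (simp add: H_def abs_mult)
      also have "\<dots> \<le> R * (1 / (2 * R) * \<Phi> \<bar>\<psi> x\<bar> + C * \<Phi> (norm (grad \<psi> x)))"
        using R(1) by (intro mult_left_mono C(2)) auto
      finally show ?thesis using R(1) by (simp add: distrib_left)
    next
      case False
      then have "\<psi> x = 0" using K by auto
      then have "H x = 0" by (simp add: H_def)
      then show ?thesis using Phi_nonneg[of "norm (\<psi> x)"] Phi_nonneg[of "norm (grad \<psi> x)"] R(1) C(1) by simp
    qed
    have "- integral\<^sup>L lebesgue H = integral\<^sup>L lebesgue (\<lambda>x. - H x)" using iH by simp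
    also have "\<dots> \<le> integral\<^sup>L lebesgue (\<lambda>x. 1/2 * \<Phi> (norm (\<psi> x)) + R * C * \<Phi> (norm (grad \<psi> x)))"
      using iH iP iG by (intro integral_mono le) auto
    also have "\<dots> = 1/2 * modular \<psi> + R * C * modular (grad \<psi>)"
      using iP iG by (simp add: modular_def)
    finally show ?thesis using eq by simp
  qed
  then show ?thesis using that[of "2 * R * C"] R(1) C(1) by simp
qed

lemma nn_integral_lebesgue_on_scaled:
  assumes D: "D \<in> sets lebesgue" and u: "in_LPhi (\<lambda>x. indicator D x *\<^sub>R (u x :: real))" and l: "l > 0"
  shows "(\<integral>\<^sup>+x. ennreal (\<Phi> (\<bar>u x\<bar> / l)) \<partial>lebesgue_on D) = ennreal (modular (\<lambda>x. (1/l) *\<^sub>R (indicator D x *\<^sub>R u x)))"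
    and "in_LPhi (\<lambda>x. (1/l) *\<^sub>R (indicator D x *\<^sub>R u x))"
proof -
  have "0 \<le> \<bar>1/l\<bar>" by simp
  then obtain C where C: "\<And>t. 0 \<le> t \<Longrightarrow> \<Phi> (\<bar>1/l\<bar> * t) \<le> C * \<Phi> t" by (rule Phi_scale) blast
  show iu: "in_LPhi (\<lambda>x. (1/l) *\<^sub>R (indicator D x *\<^sub>R u x))" by (rule in_LPhi_scale[OF u C])
  have "(\<integral>\<^sup>+x. ennreal (\<Phi> (\<bar>u x\<bar> / l)) \<partial>lebesgue_on D) = (\<integral>\<^sup>+x. ennreal (\<Phi> (\<bar>u x\<bar> / l)) * indicator D x \<partial>lebesgue)"
    using D by (intro nn_integral_restrict_space) simp
  also have "\<dots> = (\<integral>\<^sup>+x. ennreal (\<Phi> (norm ((1/l) *\<^sub>R (indicator D x *\<^sub>R u x)))) \<partial>lebesgue)"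
    using l by (intro nn_integral_cong) (auto simp: indicator_def Phi_0)
  also have "\<dots> = ennreal (modular (\<lambda>x. (1/l) *\<^sub>R (indicator D x *\<^sub>R u x)))"
    unfolding modular_def using iu by (intro nn_integral_eq_integral) (auto simp: in_LPhi_def Phi_nonneg)
  finally show "(\<integral>\<^sup>+x. ennreal (\<Phi> (\<bar>u x\<bar> / l)) \<partial>lebesgue_on D) = ennreal (modular (\<lambda>x. (1/l) *\<^sub>R (indicator D x *\<^sub>R u x)))" .
qed

lemma Phi_convex_scale: "0 \<le> t \<Longrightarrow> 0 < l \<Longrightarrow> l \<le> 1 \<Longrightarrow> \<Phi> (l * t) \<le> l * \<Phi> t"
proof -
  assume a: "0 \<le> t" "0 < l" "l \<le> 1"
  have 1: "\<Phi> (l * t) + \<phi> (l * t) * (t - l * t) \<le> \<Phi> t" "\<Phi> (l * t) - \<phi> (l * t) * (l * t) \<le> 0"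
    using Phi_tangent[of "l * t" t] Phi_tangent[of "l * t" 0] Phi_0 a by simp_all
  have "l * (\<Phi> (l * t) + \<phi> (l * t) * (t - l * t)) + (1 - l) * (\<Phi> (l * t) - \<phi> (l * t) * (l * t)) \<le> l * \<Phi> t + (1 - l) * 0"
    using 1 a by (intro add_mono mult_left_mono) auto
  then show ?thesis by (simp add: algebra_simps)
qed

text \<open>The infimum defining the norm ranges over a nonempty set: by convexity the modular of \<open>u/l\<close> is at
  most \<open>1\<close> once \<open>l\<close> exceeds \<open>1\<close> plus the modular of \<open>u\<close>.\<close>

lemma
  assumes D: "D \<in> sets lebesgue" and u: "in_LPhi (\<lambda>x. indicator D x *\<^sub>R (u x :: real))"
  shows orlicz_norm_nonneg: "0 \<le> orlicz_norm \<Phi> D u"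
    and modular_le_orlicz_norm: "orlicz_norm \<Phi> D u < e \<Longrightarrow> e \<le> 1 \<Longrightarrow> modular (\<lambda>x. indicator D x *\<^sub>R u x) \<le> e"
    and orlicz_norm_le: "0 < l \<Longrightarrow> modular (\<lambda>x. (1/l) *\<^sub>R (indicator D x *\<^sub>R u x)) \<le> 1 \<Longrightarrow> orlicz_norm \<Phi> D u \<le> l"
proof -
  let ?m = "\<lambda>l. modular (\<lambda>x. (1/l) *\<^sub>R (indicator D x *\<^sub>R u x))"
  have S: "{l. l > 0 \<and> (\<integral>\<^sup>+x. ennreal (\<Phi> (\<bar>u x\<bar> / l)) \<partial>lebesgue_on D) \<le> 1} = {l. l > 0 \<and> ?m l \<le> 1}" (is "_ = ?S")
    using nn_integral_lebesgue_on_scaled(1)[OF D u] by (auto simp: ennreal_le_1)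
  have le: "?m l \<le> l' * ?m (l * l')" if "0 < l" "0 < l'" "l' \<le> 1" for l l'
  proof -
    have eq: "(1/l) *\<^sub>R (indicator D x *\<^sub>R u x) = l' *\<^sub>R ((1/(l * l')) *\<^sub>R (indicator D x *\<^sub>R u x))" for x
      using that by simp
    show ?thesis unfolding eq
      by (rule modular_scale[OF nn_integral_lebesgue_on_scaled(2)[OF D u]]) (use that Phi_convex_scale in auto)
  qed
  have bdd: "bdd_below ?S" by (auto simp: bdd_below_def intro: less_imp_le)
  have ne: "?S \<noteq> {}"
  proof -
    let ?l = "1 + ?m 1"
    have "?m ?l \<le> 1/?l * ?m (?l * (1/?l))"
      using modular_nonneg[of "\<lambda>x. (1/1) *\<^sub>R (indicator D x *\<^sub>R u x)"] by (intro le) auto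
    also have "?l * (1/?l) = 1"
      using modular_nonneg[of "\<lambda>x. (1/1) *\<^sub>R (indicator D x *\<^sub>R u x)"] by simp
    finally have "?m ?l \<le> 1/?l * ?m 1" .
    also have "\<dots> \<le> 1" using modular_nonneg[of "\<lambda>x. (1/1) *\<^sub>R (indicator D x *\<^sub>R u x)"] by (simp add: field_simps)
    finally have "?l \<in> ?S" using modular_nonneg[of "\<lambda>x. (1/1) *\<^sub>R (indicator D x *\<^sub>R u x)"] by simp
    then show ?thesis by blast
  qed
  have N: "orlicz_norm \<Phi> D u = Inf ?S" by (simp add: orlicz_norm_def S)
  show "0 \<le> orlicz_norm \<Phi> D u" unfolding N using ne by (intro cInf_greatest) auto
  show "orlicz_norm \<Phi> D u \<le> l" if "0 < l" "?m l \<le> 1" for l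
    unfolding N using that bdd by (intro cInf_lower) auto
  show "modular (\<lambda>x. indicator D x *\<^sub>R u x) \<le> e" if e: "orlicz_norm \<Phi> D u < e" "e \<le> 1"
  proof -
    obtain l where l: "l \<in> ?S" "l < e" using cInf_lessD[OF ne e(1)[unfolded N]] by blast
    have "?m 1 \<le> l * ?m (1 * l)" using l e(2) by (intro le) auto
    also have "\<dots> \<le> l * 1" using l by (intro mult_left_mono) auto
    finally show ?thesis using l by simp
  qed
qed

text \<open>Doubling bounds the modular of \<open>u/e\<close> by a constant, depending on \<open>e\<close> only, times that of \<open>u\<close>;
  hence the threshold \<open>d\<close> is the same for all sets and functions.\<close>

lemma orlicz_norm_small:
  assumes "e > 0"
  obtains d where "d > 0"
    "\<And>(D::'a::euclidean_space set) u. D \<in> sets lebesgue \<Longrightarrow> in_LPhi (\<lambda>x. indicator D x *\<^sub>R (u x :: real)) \<Longrightarrow>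
       modular (\<lambda>x. indicator D x *\<^sub>R u x) \<le> d \<Longrightarrow> orlicz_norm \<Phi> D u \<le> e"
proof -
  have "0 \<le> \<bar>1/e\<bar>" by simp
  then obtain C where C: "C > 0" "\<And>t. 0 \<le> t \<Longrightarrow> \<Phi> (\<bar>1/e\<bar> * t) \<le> C * \<Phi> t" by (rule Phi_scale) blast
  have "orlicz_norm \<Phi> D u \<le> e" if D: "D \<in> sets lebesgue" and u: "in_LPhi (\<lambda>x. indicator D x *\<^sub>R (u x :: real))"
    and m: "modular (\<lambda>x. indicator D x *\<^sub>R u x) \<le> 1/C" for D :: "'a set" and u
  proof (rule orlicz_norm_le[OF D u assms])
    have "modular (\<lambda>x. (1/e) *\<^sub>R (indicator D x *\<^sub>R u x)) \<le> C * modular (\<lambda>x. indicator D x *\<^sub>R u x)"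
      by (rule modular_scale[OF u C(2)])
    also have "\<dots> \<le> C * (1/C)" using m C(1) by (intro mult_left_mono) auto
    finally show "modular (\<lambda>x. (1/e) *\<^sub>R (indicator D x *\<^sub>R u x)) \<le> 1" using C(1) by simp
  qed
  then show ?thesis using that[of "1/C"] C(1) by simp
qed

lemma orlicz_norm_cong_AE:
  assumes D: "D \<in> sets lebesgue" and "AE x in lebesgue. x \<in> D \<longrightarrow> u x = v x"
  shows "orlicz_norm \<Phi> D u = orlicz_norm \<Phi> D v"
proof -
  have "AE x in lebesgue_on D. u x = v x"
    using assms by (subst AE_restrict_space_iff) auto
  then have "(\<integral>\<^sup>+x. ennreal (\<Phi> (\<bar>u x\<bar> / l)) \<partial>lebesgue_on D) = (\<integral>\<^sup>+x. ennreal (\<Phi> (\<bar>v x\<bar> / l)) \<partial>lebesgue_on D)" for l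
    by (intro nn_integral_cong_AE) (auto elim!: eventually_mono)
  then show ?thesis by (simp add: orlicz_norm_def)
qed

lemma orlicz_space_iff:
  assumes D: "D \<in> sets lebesgue"
  shows "u \<in> orlicz_space \<Phi> D \<longleftrightarrow> in_LPhi (\<lambda>x. indicator D x *\<^sub>R (u x :: real))"
proof -
  have m: "u \<in> borel_measurable (lebesgue_on D) \<longleftrightarrow> (\<lambda>x. indicator D x *\<^sub>R u x) \<in> borel_measurable lebesgue"
    using D by (subst borel_measurable_restrict_space_iff) auto
  have "(\<integral>\<^sup>+x. ennreal (\<Phi> \<bar>u x\<bar>) \<partial>lebesgue_on D) = (\<integral>\<^sup>+x. ennreal (\<Phi> \<bar>u x\<bar>) * indicator D x \<partial>lebesgue)"
    using D by (intro nn_integral_restrict_space) simp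
  also have "\<dots> = (\<integral>\<^sup>+x. ennreal (norm (\<Phi> (norm (indicator D x *\<^sub>R u x)))) \<partial>lebesgue)"
    by (intro nn_integral_cong) (auto simp: indicator_def Phi_0 Phi_nonneg)
  finally have e: "(\<integral>\<^sup>+x. ennreal (\<Phi> \<bar>u x\<bar>) \<partial>lebesgue_on D) = (\<integral>\<^sup>+x. ennreal (norm (\<Phi> (norm (indicator D x *\<^sub>R u x)))) \<partial>lebesgue)" .
  show ?thesis
    unfolding orlicz_space_def mem_Collect_eq m e in_LPhi_def integrable_iff_bounded
    using Phi_norm_measurable[of "\<lambda>x. indicator D x *\<^sub>R u x" lebesgue] by auto
qed

end

section \<open>Mollification of capacity competitors\<close>

lemma lborel_distr_reflect: "distr lborel borel (\<lambda>y. x - y) = (lborel :: 'a::euclidean_space measure)"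
  using lborel_affine[of "-1" x] by (simp add: density_1)

lemma smooth_reflect:
  assumes "smooth \<eta>" shows "smooth (\<lambda>y. \<eta> (x - y))"
    and partial_reflect: "partial (\<lambda>y. \<eta> (x - y)) b y = - partial \<eta> b (x - y)"
proof -
  have D: "((\<lambda>y. \<eta> (x - y)) has_derivative (\<lambda>h. - frechet_derivative \<eta> (at (x - y)) h)) (at y)"
    if "\<eta> differentiable (at (x - y))" for \<eta> :: "'a \<Rightarrow> real" and y
  proof -
    have "((\<lambda>y. x - y) has_derivative (\<lambda>h. - h)) (at y)" by (auto intro!: derivative_eq_intros)
    from has_derivative_compose[OF this has_derivative_frechet[OF that]]
    have "((\<lambda>y. \<eta> (x - y)) has_derivative (\<lambda>h. frechet_derivative \<eta> (at (x - y)) (- h))) (at y)" .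
    moreover have "frechet_derivative \<eta> (at (x - y)) (- h) = - frechet_derivative \<eta> (at (x - y)) h" for h
      using linear_neg[OF has_derivative_linear[OF has_derivative_frechet[OF that]]] .
    ultimately show ?thesis by simp
  qed
  show "partial (\<lambda>y. \<eta> (x - y)) b y = - partial \<eta> b (x - y)"
    using frechet_derivative_eq[OF D[OF smooth_differentiable[OF assms]]] by simp
  have "Ck_function k (\<lambda>y. \<eta> (x - y))" if "smooth \<eta>" for k \<eta>
    using that
  proof (induction k arbitrary: \<eta>)
    case 0
    show ?case
      by (auto intro!: continuous_on_compose2[OF smooth_continuous[OF 0, of UNIV]] continuous_intros)
  next
    case (Suc k)
    show ?case
    proof (rule Ck_function_SucI[OF D[OF smooth_differentiable[OF Suc.prems]]])
      fix b :: 'a assume b: "b \<in> Basis"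
      have "Ck_function k (\<lambda>y. (- 1) * partial \<eta> b (x - y))"
        by (intro Ck_function_mult Ck_function_const Suc.IH smooth_partial Suc.prems b)
      then show "Ck_function k (\<lambda>y. - partial \<eta> b (x - y))" by simp
    qed
  qed
  then show "smooth (\<lambda>y. \<eta> (x - y))" using assms by (simp add: smooth_def)
qed

lemma mollifier_exists:
  assumes "\<epsilon> > 0"
  obtains \<eta> :: "'a::euclidean_space \<Rightarrow> real"
  where "smooth \<eta>" "\<And>z. 0 \<le> \<eta> z" "\<And>z. \<epsilon> \<le> norm z \<Longrightarrow> \<eta> z = 0" "integrable lborel \<eta>" "integral\<^sup>L lborel \<eta> = 1"
proof -
  define g :: "'a \<Rightarrow> real" where "g z = flat 0 (1 - (1/\<epsilon>\<^sup>2) * (\<Sum>b\<in>Basis. (z \<bullet> b) * (z \<bullet> b)))" for z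
  have g: "g z = flat 0 (1 - (norm z)\<^sup>2 / \<epsilon>\<^sup>2)" for z
    by (simp add: g_def euclidean_inner[of z z, symmetric] power2_norm_eq_inner)
  have sm: "smooth g"
    unfolding g_def by (intro smooth_flat smooth_diff smooth_const smooth_mult smooth_sum smooth_inner)
  have nn: "0 \<le> g z" for z unfolding g by (simp add: flat_0_bounds)
  have out: "g z = 0" if "\<epsilon> \<le> norm z" for z
  proof -
    have "1 \<le> (norm z)\<^sup>2 / \<epsilon>\<^sup>2"
      unfolding power_divide[symmetric] using that assms by (intro one_le_power) (simp add: le_divide_eq)
    then have "\<not> 0 < 1 - (norm z)\<^sup>2 / \<epsilon>\<^sup>2" by linarith
    then show ?thesis by (simp only: g flat_def if_False)
  qed
  have i: "integrable lborel g"
    using integrable_continuous_compact_support[OF smooth_continuous[OF sm] compact_cball[of 0 \<epsilon>]] out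
      borel_measurable_continuous_onI[OF smooth_continuous[OF sm]]
    by (simp add: integrable_completion)
  have pos: "integral\<^sup>L lborel g > 0"
  proof -
    have le: "g z \<ge> exp (- 4/3) * indicator (ball 0 (\<epsilon>/2)) z" for z
    proof (cases "norm z < \<epsilon>/2")
      case True
      have "(norm z)\<^sup>2 \<le> (\<epsilon>/2)\<^sup>2" using True by (intro power_mono) auto
      then have t: "(norm z)\<^sup>2 / \<epsilon>\<^sup>2 \<le> 1/4" using assms by (simp add: field_simps power2_eq_square)
      define r where "r = 1 - (norm z)\<^sup>2 / \<epsilon>\<^sup>2"
      have r: "3/4 \<le> r" using t by (simp add: r_def)
      then have "1 / r \<le> 4/3" by (simp add: field_simps)
      then show ?thesis using r True unfolding g r_def[symmetric] by (simp add: flat_def)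
    next
      case False
      then show ?thesis using nn by simp
    qed
    have "integral\<^sup>L lborel (\<lambda>z::'a. exp (- 4/3) * indicator (ball 0 (\<epsilon>/2)) z) \<le> integral\<^sup>L lborel g"
      by (rule integral_mono[OF _ i le])
        (intro integrable_mult_right integrable_real_indicator emeasure_bounded_finite; simp)
    moreover have "integral\<^sup>L lborel (\<lambda>z::'a. exp (- 4/3) * indicator (ball 0 (\<epsilon>/2)) z) = exp (- 4/3) * measure lborel (ball (0::'a) (\<epsilon>/2))"
      by simp
    moreover have "measure lborel (ball (0::'a) (\<epsilon>/2)) > 0" using content_ball_pos[of "\<epsilon>/2" 0] assms by simp
    ultimately show ?thesis by (smt (verit) exp_gt_zero mult_pos_pos)
  qed
  show ?thesis
  proof (rule that[of "\<lambda>z. (1 / integral\<^sup>L lborel g) * g z"])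
    show "smooth (\<lambda>z. (1 / integral\<^sup>L lborel g) * g z)" by (intro smooth_mult smooth_const sm)
  qed (use nn pos out i in auto)
qed

lemma integral_cbox_eq_lebesgue:
  fixes g :: "'a::euclidean_space \<Rightarrow> real"
  assumes g: "continuous_on UNIV g" and out: "\<And>y. y \<notin> cbox p q \<Longrightarrow> g y = 0"
  shows "integral (cbox p q) g = integral\<^sup>L lebesgue g"
proof -
  have "integrable lebesgue g"
    by (rule integrable_continuous_compact_support[OF g compact_cbox out])
  then have "(g has_integral (integral\<^sup>L lebesgue g)) UNIV" by (rule has_integral_integral_lebesgue)
  moreover have "(g has_integral integral (cbox p q) g) UNIV"
    by (rule has_integral_on_superset[of _ _ "cbox p q"])
      (auto intro: integrable_integral integrable_continuous continuous_on_subset[OF g] out)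
  ultimately show ?thesis using has_integral_unique by blast
qed

context young
begin

text \<open>Jensen's inequality for the averages against a mollifier, from the tangent of \<open>\<Phi>\<close> at the
  average.\<close>

lemma Phi_average_le:
  fixes G :: "'a::euclidean_space \<Rightarrow> 'b::euclidean_space"
  assumes G: "in_LPhi G" and \<rho>: "continuous_on UNIV \<rho>" "compact K" "\<And>y. y \<notin> K \<Longrightarrow> \<rho> y = 0"
    and nn: "\<And>y. 0 \<le> \<rho> y" and one: "integral\<^sup>L lebesgue \<rho> = 1"
  shows "\<Phi> (norm (integral\<^sup>L lebesgue (\<lambda>y. \<rho> y *\<^sub>R G y))) \<le> integral\<^sup>L lebesgue (\<lambda>y. \<rho> y * \<Phi> (norm (G y)))"
    and "integrable lebesgue (\<lambda>y. \<rho> y * \<Phi> (norm (G y)))"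
    and "integrable lebesgue (\<lambda>y. \<rho> y *\<^sub>R G y)"
proof -
  obtain B where B: "B > 0" "\<And>y. norm (\<rho> y) \<le> B"
    using bounded_continuous_compact_support[OF \<rho>] by blast
  have i\<rho>: "integrable lebesgue \<rho>" by (rule integrable_continuous_compact_support[OF \<rho>])
  have \<rho>m: "\<rho> \<in> borel_measurable lebesgue" using i\<rho> by simp
  have Gm: "G \<in> borel_measurable lebesgue" and iG: "integrable lebesgue (\<lambda>y. \<Phi> (norm (G y)))"
    using G by (auto simp: in_LPhi_def)
  show iP: "integrable lebesgue (\<lambda>y. \<rho> y * \<Phi> (norm (G y)))"
  proof (rule Bochner_Integration.integrable_bound)
    show "integrable lebesgue (\<lambda>y. B * \<Phi> (norm (G y)))" using iG by simp
    show "AE y in lebesgue. norm (\<rho> y * \<Phi> (norm (G y))) \<le> norm (B * \<Phi> (norm (G y)))"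
      using B nn by (intro AE_I2) (auto simp: abs_mult Phi_nonneg intro!: mult_right_mono)
  qed (use \<rho>m iG in auto)
  obtain C where C: "C > 0" "\<And>t. 0 \<le> t \<Longrightarrow> t \<le> 1 + C * \<Phi> t"
    using linear_le_eps_Phi[of 1] by auto
  have iV: "integrable lebesgue (\<lambda>y. \<rho> y *\<^sub>R G y)"
  proof (rule Bochner_Integration.integrable_bound)
    show "integrable lebesgue (\<lambda>y. \<rho> y + C * (\<rho> y * \<Phi> (norm (G y))))" using i\<rho> iP by simp
    have "norm (\<rho> y *\<^sub>R G y) \<le> norm (\<rho> y + C * (\<rho> y * \<Phi> (norm (G y))))" for y
    proof -
      have "norm (\<rho> y *\<^sub>R G y) \<le> \<rho> y * (1 + C * \<Phi> (norm (G y)))"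
        using C(2)[of "norm (G y)"] nn[of y] by (simp add: mult_left_mono)
      then show ?thesis by (simp add: algebra_simps)
    qed
    then show "AE y in lebesgue. norm (\<rho> y *\<^sub>R G y) \<le> norm (\<rho> y + C * (\<rho> y * \<Phi> (norm (G y))))" by simp
  qed (use \<rho>m Gm in auto)
  then show "integrable lebesgue (\<lambda>y. \<rho> y *\<^sub>R G y)" .
  define m where "m = integral\<^sup>L lebesgue (\<lambda>y. \<rho> y * norm (G y))"
  have im: "integrable lebesgue (\<lambda>y. \<rho> y * norm (G y))"
    using integrable_norm[OF iV] nn by simp
  have m0: "0 \<le> m" unfolding m_def using nn by (intro integral_nonneg_AE) auto
  have "norm (integral\<^sup>L lebesgue (\<lambda>y. \<rho> y *\<^sub>R G y)) \<le> m"
    using integral_norm_bound[of lebesgue "\<lambda>y. \<rho> y *\<^sub>R G y"] nn by (simp add: m_def)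
  then have "\<Phi> (norm (integral\<^sup>L lebesgue (\<lambda>y. \<rho> y *\<^sub>R G y))) \<le> \<Phi> m" by (intro Phi_mono) auto
  also have "\<Phi> m = integral\<^sup>L lebesgue (\<lambda>y. \<Phi> m * \<rho> y + \<phi> m * (\<rho> y * norm (G y)) - \<phi> m * m * \<rho> y)"
    using i\<rho> im one by (simp add: m_def)
  also have "\<dots> \<le> integral\<^sup>L lebesgue (\<lambda>y. \<rho> y * \<Phi> (norm (G y)))"
  proof (rule integral_mono)
    show "integrable lebesgue (\<lambda>y. \<Phi> m * \<rho> y + \<phi> m * (\<rho> y * norm (G y)) - \<phi> m * m * \<rho> y)" using i\<rho> im by simp
    show "\<Phi> m * \<rho> y + \<phi> m * (\<rho> y * norm (G y)) - \<phi> m * m * \<rho> y \<le> \<rho> y * \<Phi> (norm (G y))" for y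
      using mult_left_mono[OF Phi_tangent[OF m0, of "norm (G y)"] nn[of y]] by (simp add: algebra_simps)
  qed (rule iP)
  finally show "\<Phi> (norm (integral\<^sup>L lebesgue (\<lambda>y. \<rho> y *\<^sub>R G y))) \<le> integral\<^sup>L lebesgue (\<lambda>y. \<rho> y * \<Phi> (norm (G y)))" .
qed

text \<open>Tonelli's theorem: each point \<open>y\<close> contributes to the averages with total weight \<open>1\<close>.  It is applied to
  a Borel version of \<open>\<Phi>(|G|)\<close>, since it concerns the product of the uncompleted measures.\<close>

lemma modular_mollify_le:
  fixes G :: "'a::euclidean_space \<Rightarrow> 'b::euclidean_space" and Z :: "'a \<Rightarrow> 'c::euclidean_space"
  assumes G: "in_LPhi G" and \<eta>: "continuous_on UNIV \<eta>" "\<And>z. 0 \<le> \<eta> z" "integrable lborel \<eta>" "integral\<^sup>L lborel \<eta> = 1"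
    and Z: "in_LPhi Z" "\<And>x. \<Phi> (norm (Z x)) \<le> integral\<^sup>L lebesgue (\<lambda>y. \<eta> (x - y) * \<Phi> (norm (G y)))"
    and i: "\<And>x. integrable lebesgue (\<lambda>y. \<eta> (x - y) * \<Phi> (norm (G y)))"
  shows "modular Z \<le> modular G"
proof -
  have iG: "integrable lebesgue (\<lambda>y. \<Phi> (norm (G y)))" using G by (simp add: in_LPhi_def)
  obtain g where gm[measurable]: "g \<in> borel_measurable lborel" and g: "AE y in lborel. ennreal (\<Phi> (norm (G y))) = g y"
    using completion_ex_borel_measurable[of "\<lambda>y. ennreal (\<Phi> (norm (G y)))" lborel] borel_measurable_integrable[OF iG] by auto
  have \<eta>m[measurable]: "\<eta> \<in> borel_measurable borel" by (rule borel_measurable_continuous_onI[OF \<eta>(1)])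
  have "ennreal (modular Z) = (\<integral>\<^sup>+x. ennreal (\<Phi> (norm (Z x))) \<partial>lborel)"
    unfolding modular_def using Z(1)
    by (subst nn_integral_eq_integral[symmetric]) (auto simp: in_LPhi_def Phi_nonneg nn_integral_completion)
  also have "\<dots> \<le> (\<integral>\<^sup>+x. (\<integral>\<^sup>+y. ennreal (\<eta> (x - y)) * g y \<partial>lborel) \<partial>lborel)"
  proof (rule nn_integral_mono)
    fix x
    have "ennreal (\<Phi> (norm (Z x))) \<le> ennreal (integral\<^sup>L lebesgue (\<lambda>y. \<eta> (x - y) * \<Phi> (norm (G y))))"
      by (rule ennreal_leI[OF Z(2)])
    also have "\<dots> = (\<integral>\<^sup>+y. ennreal (\<eta> (x - y) * \<Phi> (norm (G y))) \<partial>lborel)"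
      using i \<eta>(2) by (subst nn_integral_eq_integral[symmetric]) (auto simp: Phi_nonneg nn_integral_completion)
    also have "\<dots> = (\<integral>\<^sup>+y. ennreal (\<eta> (x - y)) * g y \<partial>lborel)"
      using g by (intro nn_integral_cong_AE) (auto simp: ennreal_mult'' Phi_nonneg elim!: eventually_mono)
    finally show "ennreal (\<Phi> (norm (Z x))) \<le> (\<integral>\<^sup>+y. ennreal (\<eta> (x - y)) * g y \<partial>lborel)" .
  qed
  also have "\<dots> = (\<integral>\<^sup>+y. (\<integral>\<^sup>+x. ennreal (\<eta> (x - y)) * g y \<partial>lborel) \<partial>lborel)"
    by (rule lborel_pair.Fubini') measurable
  also have "\<dots> = (\<integral>\<^sup>+y. g y \<partial>lborel)"
  proof (rule nn_integral_cong)
    fix y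
    have "(\<integral>\<^sup>+x. ennreal (\<eta> (x - y)) \<partial>lborel) = (\<integral>\<^sup>+x. ennreal (\<eta> x) \<partial>distr lborel borel ((+) (- y)))"
      by (subst nn_integral_distr) auto
    also have "\<dots> = (\<integral>\<^sup>+x. ennreal (\<eta> x) \<partial>lborel)" by (simp only: lborel_distr_plus)
    also have "\<dots> = 1" using \<eta> by (subst nn_integral_eq_integral) auto
    finally have "(\<integral>\<^sup>+x. ennreal (\<eta> (x - y)) \<partial>lborel) = 1" .
    then show "(\<integral>\<^sup>+x. ennreal (\<eta> (x - y)) * g y \<partial>lborel) = g y"
      by (subst nn_integral_multc) auto
  qed
  also have "\<dots> = (\<integral>\<^sup>+y. ennreal (\<Phi> (norm (G y))) \<partial>lborel)"
    using g by (intro nn_integral_cong_AE) (auto elim!: eventually_mono)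
  also have "\<dots> = ennreal (modular G)"
    unfolding modular_def using iG by (subst nn_integral_eq_integral[symmetric]) (auto simp: Phi_nonneg nn_integral_completion)
  finally show ?thesis using modular_nonneg[of G] by (simp add: ennreal_le_iff)
qed

text \<open>Around the compact set \<open>K\<close> the function \<open>w\<close> stays above some \<open>m > 1\<close>, so averages at small scale
  remain above \<open>1\<close>.  Near the support of \<open>w\<close> the translated and reflected kernel is itself a test
  function in \<open>D\<close>, which identifies the gradient of the average with the average of the gradient.\<close>

lemma mollify_weak_gradient:
  fixes D :: "'a::euclidean_space set"
  assumes D: "open D" and w: "continuous_on D w" "\<And>x. x \<in> D \<Longrightarrow> 0 \<le> w x"
    and C: "compact C" "C \<subseteq> D" "\<And>x. x \<in> D - C \<Longrightarrow> w x = 0"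
    and K: "compact K" "K \<subseteq> D" "\<And>x. x \<in> K \<Longrightarrow> 1 < w x"
    and G: "is_weak_gradient D w G" "in_LPhi (\<lambda>x. indicator D x *\<^sub>R G x)"
  obtains \<zeta> where "\<zeta> \<in> test_functions D" "\<And>x. 0 \<le> \<zeta> x" "\<And>x. x \<in> K \<Longrightarrow> 1 < \<zeta> x"
    "modular (grad \<zeta>) \<le> modular (\<lambda>x. indicator D x *\<^sub>R G x)"
proof -
  define w0 where "w0 x = (if x \<in> D then w x else 0)" for x
  have w0C: "w0 x = 0" if "x \<notin> C" for x using C(3) that by (simp add: w0_def)
  have w0nn: "0 \<le> w0 x" for x using w(2) by (simp add: w0_def)
  have cw: "continuous_on UNIV w0"
  proof -
    have "continuous_on D w0" using w(1) by (rule continuous_on_eq) (simp add: w0_def)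
    moreover have "continuous_on (- C) w0"
      by (rule continuous_on_eq[OF continuous_on_const[of _ 0]]) (simp add: w0C)
    moreover have "D \<union> - C = UNIV" using C(2) by auto
    ultimately show ?thesis
      using continuous_on_open_Un[OF D open_Compl[OF compact_imp_closed[OF C(1)]], of w0] by simp
  qed
  obtain m where m: "1 < m" "\<And>x. x \<in> K \<Longrightarrow> m < w0 x"
  proof (cases "K = {}")
    case False
    obtain x0 where x0: "x0 \<in> K" "\<And>x. x \<in> K \<Longrightarrow> w0 x0 \<le> w0 x"
      using continuous_attains_inf[OF K(1) False continuous_on_subset[OF cw]] by auto
    have "1 < w0 x0" using x0(1) K by (auto simp: w0_def)
    then have "1 < (1 + w0 x0) / 2" "(1 + w0 x0) / 2 < w0 x0" by simp_all
    then show ?thesis using x0(2) that[of "(1 + w0 x0) / 2"] by fastforce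
  qed (use that[of 2] in auto)
  have op: "open {x. m < w0 x}" by (intro open_Collect_less continuous_on_const cw)
  obtain \<epsilon>1 where \<epsilon>1: "\<epsilon>1 > 0" "(\<Union>x\<in>C. cball x \<epsilon>1) \<subseteq> D"
    using compact_subset_open_imp_cball_epsilon_subset[OF C(1) D C(2)] by blast
  obtain \<epsilon>2 where \<epsilon>2: "\<epsilon>2 > 0" "(\<Union>x\<in>K. cball x \<epsilon>2) \<subseteq> {x. m < w0 x}"
    using compact_subset_open_imp_cball_epsilon_subset[OF K(1) op] m by blast
  define \<epsilon> where "\<epsilon> = min (\<epsilon>1/2) \<epsilon>2"
  have \<epsilon>: "\<epsilon> > 0" "\<epsilon> \<le> \<epsilon>1/2" "\<epsilon> \<le> \<epsilon>2" using \<epsilon>1 \<epsilon>2 by (auto simp: \<epsilon>_def)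
  obtain \<eta> :: "'a \<Rightarrow> real" where \<eta>: "smooth \<eta>" "\<And>z. 0 \<le> \<eta> z" "\<And>z. \<epsilon> \<le> norm z \<Longrightarrow> \<eta> z = 0"
      "integrable lborel \<eta>" "integral\<^sup>L lborel \<eta> = 1"
    using mollifier_exists[OF \<epsilon>(1)] by metis
  define \<rho> where "\<rho> x y = \<eta> (x - y)" for x y
  have \<rho>s: "smooth (\<rho> x)" for x unfolding \<rho>_def by (rule smooth_reflect[OF \<eta>(1)])
  have \<rho>c: "continuous_on A (\<rho> x)" for x A by (rule smooth_continuous[OF \<rho>s])
  have \<rho>0: "\<rho> x y = 0" if "y \<notin> cball x \<epsilon>" for x y using \<eta>(3)[of "x - y"] that by (simp add: \<rho>_def dist_norm)
  have \<rho>nn: "0 \<le> \<rho> x y" for x y by (simp add: \<rho>_def \<eta>)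
  have \<rho>i: "integrable lebesgue (\<rho> x)" for x
    by (rule integrable_continuous_compact_support[OF \<rho>c compact_cball \<rho>0])
  have \<rho>1: "integral\<^sup>L lebesgue (\<rho> x) = 1" for x
  proof -
    have "integral\<^sup>L lebesgue (\<rho> x) = integral\<^sup>L lborel (\<rho> x)"
      using borel_measurable_continuous_onI[OF \<rho>c] by (simp add: integral_completion)
    also have "\<dots> = integral\<^sup>L (distr lborel borel (\<lambda>y. x - y)) \<eta>"
      using borel_measurable_continuous_onI[OF smooth_continuous[OF \<eta>(1)]] by (subst integral_distr) (auto simp: \<rho>_def[abs_def])
    also have "\<dots> = 1" by (simp only: lborel_distr_reflect \<eta>)
    finally show ?thesis .
  qed
  obtain p q where pq: "C \<subseteq> cbox p q"
    using bounded_subset_cbox_symmetric[OF compact_imp_bounded[OF C(1)]] by blast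
  define \<zeta> where "\<zeta> x = integral (cbox p q) (\<lambda>y. w0 y * \<eta> (x - y))" for x
  have \<zeta>: "\<zeta> x = integral\<^sup>L lebesgue (\<lambda>y. w0 y * \<rho> x y)" for x
    unfolding \<zeta>_def \<rho>_def[symmetric]
    by (rule integral_cbox_eq_lebesgue) (use pq w0C in \<open>auto intro!: continuous_on_mult cw \<rho>c\<close>)
  have i\<zeta>: "integrable lebesgue (\<lambda>y. w0 y * \<rho> x y)" for x
    by (rule integrable_continuous_compact_support[OF continuous_on_mult[OF cw \<rho>c] C(1)]) (simp add: w0C)
  have sm: "smooth \<zeta>" unfolding \<zeta>_def by (rule smooth_convolution[OF cw \<eta>(1)])
  let ?C = "{x + y |x y. x \<in> C \<and> y \<in> cball 0 \<epsilon>}"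
  have cC: "compact ?C" by (rule compact_sums[OF C(1) compact_cball])
  have inC: "x \<in> ?C" if "y \<in> C" "dist y x \<le> \<epsilon>" for x y
  proof -
    have "x = y + (x - y)" "x - y \<in> cball 0 \<epsilon>" using that(2) by (auto simp: dist_norm norm_minus_commute)
    then show ?thesis using that(1) by blast
  qed
  have CD: "y \<in> D" if xy: "x \<in> ?C" "dist x y \<le> \<epsilon>" for x y
  proof -
    obtain c z where cz: "x = c + z" "c \<in> C" "norm z \<le> \<epsilon>" using xy(1) by auto
    have "dist c y \<le> dist c x + dist x y" by (rule dist_triangle)
    also have "dist c x = norm z" by (simp add: cz(1) dist_norm)
    finally have "dist c y \<le> \<epsilon>1" using cz(3) xy(2) \<epsilon>(2) by linarith
    then have "y \<in> (\<Union>x\<in>C. cball x \<epsilon>1)" using cz(2) by (intro UN_I[of c]) auto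
    then show ?thesis using \<epsilon>1(2) by blast
  qed
  have out: "\<zeta> x = 0" if "x \<notin> ?C" for x
  proof -
    have "w0 y * \<rho> x y = 0" for y
      using inC[of y x] that w0C[of y] \<rho>0[of y x] by (auto simp: dist_commute)
    then have "(\<lambda>y. w0 y * \<rho> x y) = (\<lambda>y. 0)" by (rule ext)
    then show ?thesis by (simp only: \<zeta> integral_zero)
  qed
  have test: "\<zeta> \<in> test_functions D"
  proof (rule test_functionsI[OF sm cC _ out])
    show "?C \<subseteq> D"
    proof
      fix x assume "x \<in> ?C"
      then show "x \<in> D" by (rule CD) (use \<epsilon>(1) in simp)
    qed
  qed
  have G0: "in_LPhi (\<lambda>x. indicator D x *\<^sub>R G x)" by fact
  have gz: "grad \<zeta> x = integral\<^sup>L lebesgue (\<lambda>y. \<rho> x y *\<^sub>R (indicator D y *\<^sub>R G y))" if x: "x \<in> ?C" for x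
  proof (rule euclidean_eqI)
    fix b :: 'a assume b: "b \<in> Basis"
    have pt: "\<rho> x \<in> test_functions D"
      by (rule test_functionsI[OF \<rho>s compact_cball[of x \<epsilon>] _ \<rho>0]) (use CD[OF x] in auto)
    have pe: "continuous_on UNIV (partial \<eta> b)" by (rule smooth_continuous[OF smooth_partial[OF \<eta>(1) b]])
    have pr: "partial \<eta> b (x - y) = - partial (\<rho> x) b y" for y
      unfolding \<rho>_def by (simp add: partial_reflect[OF \<eta>(1)])
    have "grad \<zeta> x \<bullet> b = (\<Sum>c\<in>Basis. (b \<bullet> c) * integral (cbox p q) (\<lambda>y. w0 y * partial \<eta> c (x - y)))"
      unfolding \<zeta>_def grad_inner_Basis[OF b] frechet_derivative_eq[OF convolution_has_derivative[OF cw \<eta>(1)]] ..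
    also have "\<dots> = integral (cbox p q) (\<lambda>y. w0 y * partial \<eta> b (x - y))"
      using b by (simp add: inner_Basis if_distrib[of "\<lambda>z. z * _"] cong: if_cong)
    also have "\<dots> = integral\<^sup>L lebesgue (\<lambda>y. w0 y * partial \<eta> b (x - y))"
      by (rule integral_cbox_eq_lebesgue)
        (use pq w0C in \<open>auto intro!: continuous_on_mult cw continuous_on_compose2[OF pe] continuous_intros\<close>)
    also have "\<dots> = - (LINT y:D|lebesgue. w y * partial (\<rho> x) b y)"
      unfolding pr set_lebesgue_integral_def
      by (subst integral_minus[symmetric], rule Bochner_Integration.integral_cong) (auto simp: w0_def)
    also have "\<dots> = (LINT y:D|lebesgue. (G y \<bullet> b) * \<rho> x y)"
      using G(1) pt b by (auto simp: is_weak_gradient_def)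
    also have "\<dots> = integral\<^sup>L lebesgue (\<lambda>y. (\<rho> x y *\<^sub>R (indicator D y *\<^sub>R G y)) \<bullet> b)"
      unfolding set_lebesgue_integral_def by (rule Bochner_Integration.integral_cong) auto
    also have "\<dots> = integral\<^sup>L lebesgue (\<lambda>y. \<rho> x y *\<^sub>R (indicator D y *\<^sub>R G y)) \<bullet> b"
      by (rule integral_inner_left) (use Phi_average_le(3)[OF G0 \<rho>c compact_cball \<rho>0 \<rho>nn \<rho>1] in auto)
    finally show "grad \<zeta> x \<bullet> b = integral\<^sup>L lebesgue (\<lambda>y. \<rho> x y *\<^sub>R (indicator D y *\<^sub>R G y)) \<bullet> b" .
  qed
  show ?thesis
  proof (rule that[OF test])
    show "0 \<le> \<zeta> x" for x unfolding \<zeta> using w0nn \<rho>nn by (intro integral_nonneg_AE) auto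
    show "1 < \<zeta> x" if "x \<in> K" for x
    proof -
      have "m * \<rho> x y \<le> w0 y * \<rho> x y" for y
      proof (cases "y \<in> cball x \<epsilon>")
        case True
        then have "y \<in> (\<Union>x\<in>K. cball x \<epsilon>2)" using \<epsilon>(3) that by (intro UN_I[of x]) auto
        then have "m < w0 y" using \<epsilon>2(2) by blast
        then show ?thesis using \<rho>nn by (simp add: mult_right_mono)
      qed (simp add: \<rho>0)
      then have "integral\<^sup>L lebesgue (\<lambda>y. m * \<rho> x y) \<le> \<zeta> x"
        unfolding \<zeta> by (intro integral_mono i\<zeta>) (use \<rho>i in auto)
      then show ?thesis using m(1) \<rho>1 by simp
    qed
    show "modular (grad \<zeta>) \<le> modular (\<lambda>x. indicator D x *\<^sub>R G x)"
    proof (rule modular_mollify_le[OF G0 smooth_continuous[OF \<eta>(1)] \<eta>(2,4,5) in_LPhi_grad_test[OF test]])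
      fix x
      note av = Phi_average_le[OF G0 \<rho>c[of UNIV x] compact_cball \<rho>0 \<rho>nn \<rho>1]
      show "integrable lebesgue (\<lambda>y. \<eta> (x - y) * \<Phi> (norm (indicator D y *\<^sub>R G y)))"
        using av(2) by (simp add: \<rho>_def)
      show "\<Phi> (norm (grad \<zeta> x)) \<le> integral\<^sup>L lebesgue (\<lambda>y. \<eta> (x - y) * \<Phi> (norm (indicator D y *\<^sub>R G y)))"
      proof (cases "x \<in> ?C")
        case True
        then show ?thesis using av(1) by (simp add: gz[OF True] \<rho>_def)
      next
        case False
        have "grad \<zeta> x = 0" by (rule grad_zero_outside[OF compact_imp_closed[OF cC] _ False]) (rule out)
        then show ?thesis using \<eta>(2) by (auto simp: Phi_0 Phi_nonneg intro!: integral_nonneg_AE AE_I2)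
      qed
    qed
  qed
qed

end

section \<open>Sobolev functions with zero boundary values\<close>

context young
begin

text \<open>A pair \<open>(v, G)\<close> lives on the whole space and stands for an element of \<open>W\<^sub>0\<close> together with its
  gradient, both extended by zero; it is approximated by test functions in the sense of modulars.\<close>

definition W0_pair :: "'a::euclidean_space set \<Rightarrow> ('a \<Rightarrow> real) \<Rightarrow> ('a \<Rightarrow> 'a) \<Rightarrow> bool" where
  "W0_pair \<Omega> v G \<longleftrightarrow> in_LPhi v \<and> in_LPhi G \<and> (\<forall>x. x \<notin> \<Omega> \<longrightarrow> v x = 0 \<and> G x = 0) \<and>
     (\<forall>e>0. \<exists>\<psi>\<in>test_functions \<Omega>. modular (\<lambda>x. v x - \<psi> x) < e \<and> modular (\<lambda>x. G x - grad \<psi> x) < e)"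

lemma W0_pair_test: "\<psi> \<in> test_functions \<Omega> \<Longrightarrow> W0_pair \<Omega> \<psi> (grad \<psi>)"
  unfolding W0_pair_def
  by (auto simp: in_LPhi_test in_LPhi_grad_test test_functions_outside grad_test_outside modular_def Phi_0 intro!: bexI[of _ \<psi>])

lemma in_LPhi_cong_AE:
  fixes u :: "'a::euclidean_space \<Rightarrow> 'b::euclidean_space" and v :: "'a \<Rightarrow> 'c::euclidean_space"
  assumes "u \<in> borel_measurable lebesgue" "in_LPhi v" "AE x in lebesgue. norm (u x) = norm (v x)"
  shows "in_LPhi u" "modular u = modular v"
proof -
  have m: "(\<lambda>x. \<Phi> (norm (u x))) \<in> borel_measurable lebesgue" "(\<lambda>x. \<Phi> (norm (v x))) \<in> borel_measurable lebesgue"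
    using assms by (auto intro: Phi_norm_measurable simp: in_LPhi_def)
  have ae: "AE x in lebesgue. \<Phi> (norm (u x)) = \<Phi> (norm (v x))"
    using assms(3) by eventually_elim simp
  show "in_LPhi u" using assms(1,2) integrable_cong_AE[OF m ae] by (simp add: in_LPhi_def)
  show "modular u = modular v" unfolding modular_def by (rule integral_cong_AE[OF m ae])
qed

lemma in_LPhi_norm:
  fixes G :: "'a::euclidean_space \<Rightarrow> 'b::euclidean_space"
  assumes "in_LPhi (\<lambda>x. indicator D x *\<^sub>R G x)"
  shows "in_LPhi (\<lambda>x. indicator D x *\<^sub>R norm (G x))"
    "modular (\<lambda>x. indicator D x *\<^sub>R norm (G x)) = modular (\<lambda>x. indicator D x *\<^sub>R G x)"
proof -
  have "(\<lambda>x. norm (indicator D x *\<^sub>R G x)) \<in> borel_measurable lebesgue"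
    by (rule measurable_compose[OF conjunct1[OF assms[unfolded in_LPhi_def]] borel_measurable_norm])
  then have "(\<lambda>x. indicator D x *\<^sub>R norm (G x)) \<in> borel_measurable lebesgue" by simp
  from in_LPhi_cong_AE[OF this assms]
  show "in_LPhi (\<lambda>x. indicator D x *\<^sub>R norm (G x))"
    "modular (\<lambda>x. indicator D x *\<^sub>R norm (G x)) = modular (\<lambda>x. indicator D x *\<^sub>R G x)" by simp_all
qed

text \<open>The space asks for one weak gradient with finite modular; uniqueness transfers this to the chosen
  one.\<close>

lemma sobolev_weak_gradient:
  assumes "open \<Omega>" and u: "u \<in> sobolev_space \<Phi> \<Omega>"
  shows "is_weak_gradient \<Omega> u (weak_gradient \<Omega> u)"
    "in_LPhi (\<lambda>x. indicator \<Omega> x *\<^sub>R u x)" "in_LPhi (\<lambda>x. indicator \<Omega> x *\<^sub>R weak_gradient \<Omega> u x)"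
proof -
  have \<Omega>: "\<Omega> \<in> sets lebesgue" using assms(1) by auto
  obtain H where H: "is_weak_gradient \<Omega> u H" "(\<lambda>x. norm (H x)) \<in> orlicz_space \<Phi> \<Omega>"
    using u by (auto simp: sobolev_space_def)
  show G: "is_weak_gradient \<Omega> u (weak_gradient \<Omega> u)" by (rule is_weak_gradient_weak_gradient[OF H(1)])
  show "in_LPhi (\<lambda>x. indicator \<Omega> x *\<^sub>R u x)"
    using u orlicz_space_iff[OF \<Omega>] by (auto simp: sobolev_space_def)
  have h: "in_LPhi (\<lambda>x. indicator \<Omega> x *\<^sub>R norm (H x))"
    using H(2) orlicz_space_iff[OF \<Omega>, of "\<lambda>x. norm (H x)"] by simp
  show "in_LPhi (\<lambda>x. indicator \<Omega> x *\<^sub>R weak_gradient \<Omega> u x)"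
  proof (rule in_LPhi_cong_AE(1)[OF _ h])
    show "(\<lambda>x. indicator \<Omega> x *\<^sub>R weak_gradient \<Omega> u x) \<in> borel_measurable lebesgue"
      using G by (intro locally_integrable_measurable[OF assms(1)]) (simp add: is_weak_gradient_def)
    show "AE x in lebesgue. norm (indicat_real \<Omega> x *\<^sub>R weak_gradient \<Omega> u x) = norm (indicat_real \<Omega> x *\<^sub>R norm (H x))"
      using weak_gradient_AE_eq[OF assms(1) H(1)] by eventually_elim (auto simp: indicator_def)
  qed
qed

lemma
  assumes D: "open D" and w: "is_weak_gradient D w H" "in_LPhi (\<lambda>x. indicator D x *\<^sub>R w x)" "in_LPhi (\<lambda>x. indicator D x *\<^sub>R H x)"
  shows sobolev_norm_eq: "sobolev_norm \<Phi> D w = orlicz_norm \<Phi> D w + orlicz_norm \<Phi> D (\<lambda>x. norm (H x))"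
    and sobolev_norm_nonneg: "0 \<le> sobolev_norm \<Phi> D w"
    and modular_le_sobolev_norm: "sobolev_norm \<Phi> D w < e \<Longrightarrow> e \<le> 1 \<Longrightarrow>
      modular (\<lambda>x. indicator D x *\<^sub>R w x) \<le> e \<and> modular (\<lambda>x. indicator D x *\<^sub>R H x) \<le> e"
proof -
  have Ds: "D \<in> sets lebesgue" using D by auto
  have "orlicz_norm \<Phi> D (\<lambda>x. norm (weak_gradient D w x)) = orlicz_norm \<Phi> D (\<lambda>x. norm (H x))"
    by (rule orlicz_norm_cong_AE[OF Ds]) (use weak_gradient_AE_eq[OF D w(1)] in \<open>auto elim!: eventually_mono\<close>)
  then show eq: "sobolev_norm \<Phi> D w = orlicz_norm \<Phi> D w + orlicz_norm \<Phi> D (\<lambda>x. norm (H x))"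
    by (simp add: sobolev_norm_def)
  have nn: "0 \<le> orlicz_norm \<Phi> D w" "0 \<le> orlicz_norm \<Phi> D (\<lambda>x. norm (H x))"
    using orlicz_norm_nonneg[OF Ds w(2)] orlicz_norm_nonneg[OF Ds in_LPhi_norm(1)[OF w(3)]] by auto
  then show "0 \<le> sobolev_norm \<Phi> D w" by (simp add: eq)
  show "modular (\<lambda>x. indicator D x *\<^sub>R w x) \<le> e \<and> modular (\<lambda>x. indicator D x *\<^sub>R H x) \<le> e"
    if "sobolev_norm \<Phi> D w < e" "e \<le> 1"
    using modular_le_orlicz_norm[OF Ds w(2), of e] modular_le_orlicz_norm[OF Ds in_LPhi_norm(1)[OF w(3)], of e]
      nn that unfolding eq in_LPhi_norm(2)[OF w(3)] by auto
qed

lemma W0_pair_zero_extension: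
  assumes "open \<Omega>" and u: "u \<in> sobolev_space_0 \<Phi> \<Omega>"
  shows "W0_pair \<Omega> (zero_extension \<Omega> u) (\<lambda>x. indicator \<Omega> x *\<^sub>R weak_gradient \<Omega> u x)"
proof -
  have ze: "zero_extension \<Omega> u = (\<lambda>x. indicator \<Omega> x *\<^sub>R u x)"
    by (auto simp: zero_extension_def fun_eq_iff)
  have "u \<in> sobolev_space \<Phi> \<Omega>" using u by (simp add: sobolev_space_0_def)
  note s = sobolev_weak_gradient[OF assms(1) this]
  have "\<exists>\<psi>\<in>test_functions \<Omega>. modular (\<lambda>x. indicator \<Omega> x *\<^sub>R u x - \<psi> x) < e \<and>
      modular (\<lambda>x. indicator \<Omega> x *\<^sub>R weak_gradient \<Omega> u x - grad \<psi> x) < e" if e: "e > 0" for e :: real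
  proof -
    define e' where "e' = min (e/2) 1"
    have e': "e' > 0" "e' \<le> 1" "e' < e" using e by (auto simp: e'_def)
    obtain \<psi> where \<psi>: "\<psi> \<in> test_functions \<Omega>" "sobolev_norm \<Phi> \<Omega> (\<lambda>x. u x - \<psi> x) < e'"
      using u e'(1) by (auto simp: sobolev_space_0_def)
    have d: "is_weak_gradient \<Omega> (\<lambda>x. u x - \<psi> x) (\<lambda>x. weak_gradient \<Omega> u x - grad \<psi> x)"
      by (rule is_weak_gradient_diff[OF s(1) is_weak_gradient_grad[OF test_functions_smooth[OF \<psi>(1)]]])
    have e1: "(\<lambda>x. indicator \<Omega> x *\<^sub>R (u x - \<psi> x)) = (\<lambda>x. indicator \<Omega> x *\<^sub>R u x - \<psi> x)"
      using test_functions_outside[OF \<psi>(1)] by (auto simp: fun_eq_iff indicator_def)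
    have e2: "(\<lambda>x. indicator \<Omega> x *\<^sub>R (weak_gradient \<Omega> u x - grad \<psi> x)) = (\<lambda>x. indicator \<Omega> x *\<^sub>R weak_gradient \<Omega> u x - grad \<psi> x)"
      using grad_test_outside[OF \<psi>(1)] by (auto simp: fun_eq_iff indicator_def)
    have "modular (\<lambda>x. indicator \<Omega> x *\<^sub>R (u x - \<psi> x)) \<le> e' \<and> modular (\<lambda>x. indicator \<Omega> x *\<^sub>R (weak_gradient \<Omega> u x - grad \<psi> x)) \<le> e'"
      by (rule modular_le_sobolev_norm[OF assms(1) d _ _ \<psi>(2) e'(2)])
        (simp_all only: e1 e2 in_LPhi_diff s(2,3) in_LPhi_test[OF \<psi>(1)] in_LPhi_grad_test[OF \<psi>(1)])
    then show ?thesis unfolding e1 e2 using \<psi>(1) e'(3) by (intro bexI[of _ \<psi>]) auto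
  qed
  then show ?thesis unfolding W0_pair_def ze using s(2,3) by auto
qed

lemma sobolev_norm_small:
  assumes "e > 0"
  obtains d where "d > 0"
    "\<And>(D::'a::euclidean_space set) w H. open D \<Longrightarrow> is_weak_gradient D w H \<Longrightarrow> in_LPhi w \<Longrightarrow> in_LPhi H \<Longrightarrow>
       (\<And>x. x \<notin> D \<Longrightarrow> w x = 0) \<Longrightarrow> (\<And>x. x \<notin> D \<Longrightarrow> H x = 0) \<Longrightarrow>
       modular w \<le> d \<Longrightarrow> modular H \<le> d \<Longrightarrow> 0 \<le> sobolev_norm \<Phi> D w \<and> sobolev_norm \<Phi> D w < e"
proof -
  have "e / 3 > 0" using assms by simp
  then obtain d where d: "d > 0"
    "\<And>(D::'a set) u. D \<in> sets lebesgue \<Longrightarrow> in_LPhi (\<lambda>x. indicator D x *\<^sub>R (u x :: real)) \<Longrightarrow>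
       modular (\<lambda>x. indicator D x *\<^sub>R u x) \<le> d \<Longrightarrow> orlicz_norm \<Phi> D u \<le> e / 3"
    by (rule orlicz_norm_small) blast
  have "0 \<le> sobolev_norm \<Phi> D w \<and> sobolev_norm \<Phi> D w < e"
    if D: "open D" and w: "is_weak_gradient D w H" "in_LPhi w" "in_LPhi H"
      and o: "\<And>x. x \<notin> D \<Longrightarrow> w x = 0" "\<And>x. x \<notin> D \<Longrightarrow> H x = 0" and m: "modular w \<le> d" "modular H \<le> d"
    for D :: "'a set" and w H
  proof -
    have Ds: "D \<in> sets lebesgue" using D by auto
    have e: "(\<lambda>x. indicator D x *\<^sub>R w x) = w" "(\<lambda>x. indicator D x *\<^sub>R H x) = H"
      using o by (auto simp: fun_eq_iff indicator_def)
    have w': "in_LPhi (\<lambda>x. indicator D x *\<^sub>R w x)" "in_LPhi (\<lambda>x. indicator D x *\<^sub>R H x)" unfolding e by fact+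
    have "orlicz_norm \<Phi> D w \<le> e / 3" by (rule d(2)[OF Ds w'(1)]) (simp only: e m)
    moreover have "orlicz_norm \<Phi> D (\<lambda>x. norm (H x)) \<le> e / 3"
      by (rule d(2)[OF Ds in_LPhi_norm(1)[OF w'(2)]]) (simp only: in_LPhi_norm(2)[OF w'(2)], simp only: e m)
    ultimately show ?thesis
      using sobolev_norm_eq[OF D w(1) w'] sobolev_norm_nonneg[OF D w(1) w'] assms by simp
  qed
  then show ?thesis using that d(1) by blast
qed

text \<open>For test functions in \<open>\<Omega>\<close> integration by parts holds against test functions of the larger set \<open>D\<close>.
  It survives the passage to the limit because modular convergence implies convergence in \<open>L\<^sup>1\<close>.\<close>

lemma W0_pair_weak_gradient:
  assumes D: "open D" "D \<in> lmeasurable" and sub: "\<Omega> \<subseteq> D" and W: "W0_pair \<Omega> v G"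
  shows "is_weak_gradient D v G"
proof -
  have v: "in_LPhi v" and G: "in_LPhi G" and out: "\<And>x. x \<notin> D \<Longrightarrow> v x = 0" "\<And>x. x \<notin> D \<Longrightarrow> G x = 0"
    and ap: "\<And>e. e > 0 \<Longrightarrow> \<exists>\<psi>\<in>test_functions \<Omega>. modular (\<lambda>x. v x - \<psi> x) < e \<and> modular (\<lambda>x. G x - grad \<psi> x) < e"
    using W sub unfolding W0_pair_def by blast+
  have int: "integrable lebesgue g" if "in_LPhi g" "\<And>x. x \<notin> D \<Longrightarrow> g x = 0" for g :: "'a \<Rightarrow> 'b::euclidean_space"
  proof -
    have "(0::real) < 1" by simp
    then obtain C where "C > 0" "\<And>t. 0 \<le> t \<Longrightarrow> t \<le> 1 + C * \<Phi> t" by (rule linear_le_eps_Phi) blast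
    then show ?thesis using in_LPhi_integrable(1)[OF that(1) D(2) that(2), of 1 C] by simp
  qed
  have iv: "integrable lebesgue v" and iG: "integrable lebesgue G" using int v G out by blast+
  show ?thesis
    unfolding is_weak_gradient_def
  proof (intro conjI ballI)
    show "locally_integrable D v" "locally_integrable D G"
      unfolding locally_integrable_def set_integrable_def
      using integrable_mult_indicator[OF _ iv] integrable_mult_indicator[OF _ iG] by (auto simp: lmeasurable_compact fmeasurableD)
  next
    fix \<zeta> b :: "_" assume z: "\<zeta> \<in> test_functions D" and b: "b \<in> (Basis :: 'a set)"
    obtain K where K: "smooth \<zeta>" "compact K" "K \<subseteq> D" "\<And>x. x \<notin> K \<Longrightarrow> \<zeta> x = 0"
      using test_functionsE[OF z] by metis
    have pz: "partial \<zeta> b x = 0" if "x \<notin> K" for x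
      using grad_zero_outside[of K \<zeta> x] K that grad_inner_Basis[OF b, of \<zeta> x] by (auto simp: compact_imp_closed)
    have cz: "continuous_on UNIV \<zeta>" "continuous_on UNIV (partial \<zeta> b)"
      by (auto intro!: smooth_continuous smooth_partial K(1) b)
    obtain B1 where B1: "B1 > 0" "\<And>x. norm (\<zeta> x) \<le> B1"
      using bounded_continuous_compact_support[OF cz(1) K(2,4)] by blast
    obtain B2 where B2: "B2 > 0" "\<And>x. norm (partial \<zeta> b x) \<le> B2"
      using bounded_continuous_compact_support[OF cz(2) K(2) pz] by blast
    have zm: "\<zeta> \<in> borel_measurable lebesgue" "partial \<zeta> b \<in> borel_measurable lebesgue"
      using borel_measurable_continuous_onI[OF cz(1)] borel_measurable_continuous_onI[OF cz(2)] by (auto simp: measurable_completion)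
    have bd: "integrable lebesgue (\<lambda>x. g x * c x)" "\<bar>integral\<^sup>L lebesgue (\<lambda>x. g x * c x)\<bar> \<le> B * integral\<^sup>L lebesgue (\<lambda>x. \<bar>g x\<bar>)"
      if g: "integrable lebesgue g" and c: "c \<in> borel_measurable lebesgue" "\<And>x. norm (c x) \<le> B" for g c :: "'a \<Rightarrow> real" and B
    proof -
      have gB: "integrable lebesgue (\<lambda>x. B * \<bar>g x\<bar>)" using integrable_norm[OF g] by simp
      have le: "norm (g x * c x) \<le> B * \<bar>g x\<bar>" for x
        using mult_right_mono[OF c(2), of "\<bar>g x\<bar>" x] by (simp add: abs_mult mult.commute)
      show i: "integrable lebesgue (\<lambda>x. g x * c x)"
        by (rule Bochner_Integration.integrable_bound[OF gB])
          (use g c(1) order_trans[OF le abs_ge_self] in \<open>auto intro!: AE_I2\<close>)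
      have "\<bar>integral\<^sup>L lebesgue (\<lambda>x. g x * c x)\<bar> \<le> integral\<^sup>L lebesgue (\<lambda>x. norm (g x * c x))"
        using integral_norm_bound[of lebesgue "\<lambda>x. g x * c x"] by simp
      also have "\<dots> \<le> integral\<^sup>L lebesgue (\<lambda>x. B * \<bar>g x\<bar>)"
        by (rule integral_mono[OF integrable_norm[OF i] gB le])
      finally show "\<bar>integral\<^sup>L lebesgue (\<lambda>x. g x * c x)\<bar> \<le> B * integral\<^sup>L lebesgue (\<lambda>x. \<bar>g x\<bar>)" by simp
    qed
    define A where "A = integral\<^sup>L lebesgue (\<lambda>x. v x * partial \<zeta> b x) + integral\<^sup>L lebesgue (\<lambda>x. (G x \<bullet> b) * \<zeta> x)"
    let ?m = "measure lebesgue D"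
    have A: "\<bar>A\<bar> \<le> (B1 + B2) * (\<delta> * (?m + 1))" if \<delta>: "\<delta> > 0" for \<delta>
    proof -
      obtain C where C: "C > 0" "\<And>t. 0 \<le> t \<Longrightarrow> t \<le> \<delta> + C * \<Phi> t" using \<delta> by (rule linear_le_eps_Phi) blast
      have "\<delta> / C > 0" using \<delta> C(1) by simp
      then obtain \<psi> where \<psi>: "\<psi> \<in> test_functions \<Omega>" "modular (\<lambda>x. v x - \<psi> x) < \<delta> / C" "modular (\<lambda>x. G x - grad \<psi> x) < \<delta> / C"
        using ap by blast
      have \<psi>D: "\<psi> \<in> test_functions D" by (rule test_functions_mono[OF sub \<psi>(1)])
      have o1: "v x - \<psi> x = 0" "G x - grad \<psi> x = 0" if "x \<notin> D" for x
        using out that test_functions_outside[OF \<psi>D] grad_test_outside[OF \<psi>D] by auto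
      note l1 = in_LPhi_diff[OF v in_LPhi_test[OF \<psi>D]] and l2 = in_LPhi_diff[OF G in_LPhi_grad_test[OF \<psi>D]]
      have ii: "integrable lebesgue (\<lambda>x. v x - \<psi> x)" "integrable lebesgue (\<lambda>x. G x - grad \<psi> x)"
        using int[OF l1 o1(1)] int[OF l2 o1(2)] by auto
      have i\<psi>: "integrable lebesgue \<psi>" "integrable lebesgue (grad \<psi>)"
        using int[OF in_LPhi_test[OF \<psi>D] test_functions_outside[OF \<psi>D]] int[OF in_LPhi_grad_test[OF \<psi>D] grad_test_outside[OF \<psi>D]] by auto
      have s1: "integral\<^sup>L lebesgue (\<lambda>x. \<bar>v x - \<psi> x\<bar>) \<le> \<delta> * (?m + 1)"
      proof -
        have "integral\<^sup>L lebesgue (\<lambda>x. norm (v x - \<psi> x)) \<le> \<delta> * ?m + C * modular (\<lambda>x. v x - \<psi> x)"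
          using in_LPhi_integrable(2)[OF l1 D(2) o1(1) _ C(2)] \<delta> by simp
        also have "C * modular (\<lambda>x. v x - \<psi> x) \<le> C * (\<delta> / C)" using \<psi>(2) C(1) by (intro mult_left_mono) auto
        finally show ?thesis using C(1) by (simp add: algebra_simps)
      qed
      have s2: "integral\<^sup>L lebesgue (\<lambda>x. \<bar>(G x - grad \<psi> x) \<bullet> b\<bar>) \<le> \<delta> * (?m + 1)"
      proof -
        have "integral\<^sup>L lebesgue (\<lambda>x. \<bar>(G x - grad \<psi> x) \<bullet> b\<bar>) \<le> integral\<^sup>L lebesgue (\<lambda>x. norm (G x - grad \<psi> x))"
          using integrable_inner_left[OF ii(2), of b] ii(2) Basis_le_norm[OF b] by (intro integral_mono integrable_abs integrable_norm) auto
        also have "integral\<^sup>L lebesgue (\<lambda>x. norm (G x - grad \<psi> x)) \<le> \<delta> * ?m + C * modular (\<lambda>x. G x - grad \<psi> x)"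
          using in_LPhi_integrable(2)[OF l2 D(2) o1(2) _ C(2)] \<delta> by simp
        also have "C * modular (\<lambda>x. G x - grad \<psi> x) \<le> C * (\<delta> / C)" using \<psi>(3) C(1) by (intro mult_left_mono) auto
        finally show ?thesis using C(1) by (simp add: algebra_simps)
      qed
      have zero: "integral\<^sup>L lebesgue (\<lambda>x. \<psi> x * partial \<zeta> b x) + integral\<^sup>L lebesgue (\<lambda>x. (grad \<psi> x \<bullet> b) * \<zeta> x) = 0"
      proof -
        have "(LINT x:D|lebesgue. \<psi> x * partial \<zeta> b x) = - (LINT x:D|lebesgue. (grad \<psi> x \<bullet> b) * \<zeta> x)"
          using is_weak_gradient_grad[OF test_functions_smooth[OF \<psi>D], of D] z b by (simp add: is_weak_gradient_def)
        moreover have "(\<lambda>x. indicator D x *\<^sub>R (\<psi> x * partial \<zeta> b x)) = (\<lambda>x. \<psi> x * partial \<zeta> b x)"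
          "(\<lambda>x. indicator D x *\<^sub>R ((grad \<psi> x \<bullet> b) * \<zeta> x)) = (\<lambda>x. (grad \<psi> x \<bullet> b) * \<zeta> x)"
          using test_functions_outside[OF \<psi>D] test_functions_outside[OF z] by (auto simp: fun_eq_iff indicator_def)
        ultimately show ?thesis by (simp add: set_lebesgue_integral_def)
      qed
      have "A = integral\<^sup>L lebesgue (\<lambda>x. (v x - \<psi> x) * partial \<zeta> b x) + integral\<^sup>L lebesgue (\<lambda>x. ((G x - grad \<psi> x) \<bullet> b) * \<zeta> x)"
        using zero bd(1)[OF iv zm(2) B2(2)] bd(1)[OF i\<psi>(1) zm(2) B2(2)]
          bd(1)[OF integrable_inner_left[OF iG, of b] zm(1) B1(2)] bd(1)[OF integrable_inner_left[OF i\<psi>(2), of b] zm(1) B1(2)]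
        by (simp add: A_def inner_diff_left left_diff_distrib)
      then have "\<bar>A\<bar> \<le> \<bar>integral\<^sup>L lebesgue (\<lambda>x. (v x - \<psi> x) * partial \<zeta> b x)\<bar> + \<bar>integral\<^sup>L lebesgue (\<lambda>x. ((G x - grad \<psi> x) \<bullet> b) * \<zeta> x)\<bar>"
        by linarith
      also have "\<dots> \<le> B2 * integral\<^sup>L lebesgue (\<lambda>x. \<bar>v x - \<psi> x\<bar>) + B1 * integral\<^sup>L lebesgue (\<lambda>x. \<bar>(G x - grad \<psi> x) \<bullet> b\<bar>)"
        by (intro add_mono bd(2)[OF ii(1) zm(2) B2(2)] bd(2)[OF integrable_inner_left[OF ii(2)] zm(1) B1(2)])
      also have "\<dots> \<le> B2 * (\<delta> * (?m + 1)) + B1 * (\<delta> * (?m + 1))"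
        using s1 s2 B1(1) B2(1) by (intro add_mono mult_left_mono) auto
      finally show ?thesis by (simp add: algebra_simps)
    qed
    have "\<bar>A\<bar> \<le> 0"
    proof (rule field_le_epsilon)
      fix e :: real assume e: "e > 0"
      define P where "P = (B1 + B2) * (?m + 1)"
      have P: "P > 0" unfolding P_def using B1(1) B2(1) by (intro mult_pos_pos) (auto intro: add_nonneg_pos)
      have "\<bar>A\<bar> \<le> (B1 + B2) * (e / P * (?m + 1))" using A[of "e / P"] e P by simp
      also have "\<dots> = e * (P / P)" by (simp add: P_def)
      finally show "\<bar>A\<bar> \<le> 0 + e" using P by simp
    qed
    moreover have "(\<lambda>x. indicator D x *\<^sub>R (v x * partial \<zeta> b x)) = (\<lambda>x. v x * partial \<zeta> b x)"
      "(\<lambda>x. indicator D x *\<^sub>R ((G x \<bullet> b) * \<zeta> x)) = (\<lambda>x. (G x \<bullet> b) * \<zeta> x)"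
      using out by (auto simp: fun_eq_iff indicator_def)
    ultimately show "(LINT x:D|lebesgue. v x * partial \<zeta> b x) = - (LINT x:D|lebesgue. (G x \<bullet> b) * \<zeta> x)"
      by (simp add: set_lebesgue_integral_def A_def)
  qed
qed

lemma W0_pair_sobolev_0:
  assumes D: "open D" "D \<in> lmeasurable" and sub: "\<Omega> \<subseteq> D" and W: "W0_pair \<Omega> v G"
  shows "v \<in> sobolev_space_0 \<Phi> D"
proof -
  have Ds: "D \<in> sets lebesgue" using D by auto
  have v: "in_LPhi v" and G: "in_LPhi G" and out: "\<And>x. x \<notin> D \<Longrightarrow> v x = 0" "\<And>x. x \<notin> D \<Longrightarrow> G x = 0"
    and ap: "\<And>e. e > 0 \<Longrightarrow> \<exists>\<psi>\<in>test_functions \<Omega>. modular (\<lambda>x. v x - \<psi> x) < e \<and> modular (\<lambda>x. G x - grad \<psi> x) < e"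
    using W sub unfolding W0_pair_def by blast+
  have e: "(\<lambda>x. indicator D x *\<^sub>R v x) = v" "(\<lambda>x. indicator D x *\<^sub>R G x) = G"
    using out by (auto simp: fun_eq_iff indicator_def)
  have wg: "is_weak_gradient D v G" by (rule W0_pair_weak_gradient[OF assms])
  have "v \<in> orlicz_space \<Phi> D" "(\<lambda>x. norm (G x)) \<in> orlicz_space \<Phi> D"
    unfolding orlicz_space_iff[OF Ds] using in_LPhi_norm(1)[of D G] e v G by simp_all
  moreover have "\<exists>\<psi>\<in>test_functions D. sobolev_norm \<Phi> D (\<lambda>x. v x - \<psi> x) < r" if r: "r > 0" for r :: real
  proof -
    obtain d where d: "d > 0"
      "\<And>(D::'a set) w H. open D \<Longrightarrow> is_weak_gradient D w H \<Longrightarrow> in_LPhi w \<Longrightarrow> in_LPhi H \<Longrightarrow>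
       (\<And>x. x \<notin> D \<Longrightarrow> w x = 0) \<Longrightarrow> (\<And>x. x \<notin> D \<Longrightarrow> H x = 0) \<Longrightarrow>
       modular w \<le> d \<Longrightarrow> modular H \<le> d \<Longrightarrow> 0 \<le> sobolev_norm \<Phi> D w \<and> sobolev_norm \<Phi> D w < r"
      using sobolev_norm_small[OF r, where 'a='a] by metis
    obtain \<psi> where \<psi>: "\<psi> \<in> test_functions \<Omega>" "modular (\<lambda>x. v x - \<psi> x) < d" "modular (\<lambda>x. G x - grad \<psi> x) < d"
      using ap[OF d(1)] by blast
    have \<psi>D: "\<psi> \<in> test_functions D" by (rule test_functions_mono[OF sub \<psi>(1)])
    have "sobolev_norm \<Phi> D (\<lambda>x. v x - \<psi> x) < r"
      using d(2)[OF D(1) is_weak_gradient_diff[OF wg is_weak_gradient_grad[OF test_functions_smooth[OF \<psi>D]]]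
          in_LPhi_diff[OF v in_LPhi_test[OF \<psi>D]] in_LPhi_diff[OF G in_LPhi_grad_test[OF \<psi>D]]]
        out \<psi>(2,3) test_functions_outside[OF \<psi>D] grad_test_outside[OF \<psi>D] by simp
    then show ?thesis using \<psi>D by blast
  qed
  ultimately show ?thesis unfolding sobolev_space_0_def sobolev_space_def using wg by blast
qed

lemma tendsto_sobolev_0I:
  assumes D: "open D" "D \<in> lmeasurable" and sub: "\<And>k. \<Omega>s k \<subseteq> D" "\<Omega> \<subseteq> D"
    and W: "\<And>k. W0_pair (\<Omega>s k) (vs k) (Gs k)" "W0_pair \<Omega> v G"
    and conv: "(\<lambda>k. modular (\<lambda>x. vs k x - v x)) \<longlonglongrightarrow> 0" "(\<lambda>k. modular (\<lambda>x. Gs k x - G x)) \<longlonglongrightarrow> 0"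
  shows "tendsto_sobolev_0 \<Phi> D vs v"
  unfolding tendsto_sobolev_0_def
proof (intro conjI allI)
  show "vs k \<in> sobolev_space_0 \<Phi> D" for k by (rule W0_pair_sobolev_0[OF D sub(1) W(1)])
  show "v \<in> sobolev_space_0 \<Phi> D" by (rule W0_pair_sobolev_0[OF D sub(2) W(2)])
  have wg: "is_weak_gradient D (\<lambda>x. vs k x - v x) (\<lambda>x. Gs k x - G x)" for k
    by (intro is_weak_gradient_diff W0_pair_weak_gradient[OF D sub(1) W(1)] W0_pair_weak_gradient[OF D sub(2) W(2)])
  have l: "in_LPhi (\<lambda>x. vs k x - v x)" "in_LPhi (\<lambda>x. Gs k x - G x)" for k
    using W(1)[of k] W(2) unfolding W0_pair_def by (auto intro: in_LPhi_diff)
  have out: "vs k x - v x = 0" "Gs k x - G x = 0" if "x \<notin> D" for k x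
  proof -
    have "x \<notin> \<Omega>s k" "x \<notin> \<Omega>" using sub(1)[of k] sub(2) that by auto
    then have "vs k x = 0 \<and> Gs k x = 0" "v x = 0 \<and> G x = 0"
      using W(1)[of k] W(2) by (simp_all add: W0_pair_def)
    then show "vs k x - v x = 0" "Gs k x - G x = 0" by auto
  qed
  show "(\<lambda>k. sobolev_norm \<Phi> D (\<lambda>x. vs k x - v x)) \<longlonglongrightarrow> 0"
  proof (rule tendstoI)
    fix e :: real assume "e > 0"
    then obtain d where d: "d > 0"
      "\<And>(D::'a set) w H. open D \<Longrightarrow> is_weak_gradient D w H \<Longrightarrow> in_LPhi w \<Longrightarrow> in_LPhi H \<Longrightarrow>
       (\<And>x. x \<notin> D \<Longrightarrow> w x = 0) \<Longrightarrow> (\<And>x. x \<notin> D \<Longrightarrow> H x = 0) \<Longrightarrow>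
       modular w \<le> d \<Longrightarrow> modular H \<le> d \<Longrightarrow> 0 \<le> sobolev_norm \<Phi> D w \<and> sobolev_norm \<Phi> D w < e"
      using sobolev_norm_small[where 'a='a] by metis
    have "\<forall>\<^sub>F k in sequentially. modular (\<lambda>x. vs k x - v x) < d" "\<forall>\<^sub>F k in sequentially. modular (\<lambda>x. Gs k x - G x) < d"
      using conv d(1) by (auto dest: order_tendstoD(2))
    then show "\<forall>\<^sub>F k in sequentially. dist (sobolev_norm \<Phi> D (\<lambda>x. vs k x - v x)) 0 < e"
    proof eventually_elim
      case (elim k)
      then show ?case using d(2)[OF D(1) wg[of k] l(1,2)[of k] out(1,2)[of _ k]] by simp
    qed
  qed
qed

lemma flux_measurable:
  assumes G: "G \<in> borel_measurable M" shows "(\<lambda>x. flux \<phi> (G x :: 'a::euclidean_space)) \<in> borel_measurable M"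
proof -
  have "(\<lambda>a::'a. \<phi> (norm a)) \<in> borel_measurable borel"
    by (rule borel_measurable_continuous_onI[OF continuous_on_phi_norm[OF continuous_on_id]])
  from measurable_compose[OF G this] show ?thesis
    unfolding flux_def using G by measurable
qed

text \<open>Test functions are admissible in the weak formulation, and so is the solution itself; these two
  choices are all that the energy argument uses.\<close>

lemma weak_solution_pair:
  assumes \<Omega>: "open \<Omega>" "\<Omega> \<in> lmeasurable" "\<Omega> \<subseteq> D" and u: "is_weak_solution \<Phi> \<phi> \<Omega> f u"
    and f: "(\<lambda>x. indicator D x * f x) \<in> borel_measurable lebesgue"
  defines "v \<equiv> zero_extension \<Omega> u" and "G \<equiv> (\<lambda>x. indicator \<Omega> x *\<^sub>R weak_gradient \<Omega> u x)"
  shows "W0_pair \<Omega> v G"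
    "\<And>\<psi>. \<psi> \<in> test_functions \<Omega> \<Longrightarrow> integral\<^sup>L lebesgue (\<lambda>x. flux \<phi> (G x) \<bullet> grad \<psi> x) = integral\<^sup>L lebesgue (\<lambda>x. (indicator D x * f x) * \<psi> x)"
    "integral\<^sup>L lebesgue (\<lambda>x. flux \<phi> (G x) \<bullet> G x) = integral\<^sup>L lebesgue (\<lambda>x. (indicator D x * f x) * v x)"
proof -
  have u0: "u \<in> sobolev_space_0 \<Phi> \<Omega>" and eq: "\<And>v. v \<in> sobolev_space_0 \<Phi> \<Omega> \<Longrightarrow>
     (LINT x:\<Omega>|lebesgue. flux \<phi> (weak_gradient \<Omega> u x) \<bullet> weak_gradient \<Omega> v x) = (LINT x:\<Omega>|lebesgue. f x * v x)"
    using u by (auto simp: is_weak_solution_def)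
  show W: "W0_pair \<Omega> v G" unfolding v_def G_def by (rule W0_pair_zero_extension[OF \<Omega>(1) u0])
  have Gm: "G \<in> borel_measurable lebesgue" using W by (simp add: W0_pair_def in_LPhi_def)
  have *: "integral\<^sup>L lebesgue (\<lambda>x. flux \<phi> (G x) \<bullet> H x) = integral\<^sup>L lebesgue (\<lambda>x. (indicator D x * f x) * (indicator \<Omega> x * w x))"
    if w: "w \<in> sobolev_space_0 \<Phi> \<Omega>" and H: "H = (\<lambda>x. indicator \<Omega> x *\<^sub>R weak_gradient \<Omega> w x)" for w H
  proof -
    have "integral\<^sup>L lebesgue (\<lambda>x. flux \<phi> (G x) \<bullet> H x) = (LINT x:\<Omega>|lebesgue. flux \<phi> (weak_gradient \<Omega> u x) \<bullet> weak_gradient \<Omega> w x)"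
      unfolding set_lebesgue_integral_def H G_def
      by (rule Bochner_Integration.integral_cong) (auto simp: indicator_def)
    also have "\<dots> = (LINT x:\<Omega>|lebesgue. f x * w x)" by (rule eq[OF w])
    also have "\<dots> = integral\<^sup>L lebesgue (\<lambda>x. (indicator D x * f x) * (indicator \<Omega> x * w x))"
      unfolding set_lebesgue_integral_def
      by (rule Bochner_Integration.integral_cong) (use \<Omega>(3) in \<open>auto simp: indicator_def\<close>)
    finally show ?thesis .
  qed
  show "integral\<^sup>L lebesgue (\<lambda>x. flux \<phi> (G x) \<bullet> G x) = integral\<^sup>L lebesgue (\<lambda>x. (indicator D x * f x) * v x)"
  proof -
    have "v = (\<lambda>x. indicator \<Omega> x * u x)" by (auto simp: v_def zero_extension_def fun_eq_iff)
    then show ?thesis using *[OF u0 G_def[THEN meta_eq_to_obj_eq]] by simp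
  qed
  show "integral\<^sup>L lebesgue (\<lambda>x. flux \<phi> (G x) \<bullet> grad \<psi> x) = integral\<^sup>L lebesgue (\<lambda>x. (indicator D x * f x) * \<psi> x)"
    if \<psi>: "\<psi> \<in> test_functions \<Omega>" for \<psi>
  proof -
    have w: "\<psi> \<in> sobolev_space_0 \<Phi> \<Omega>" by (rule W0_pair_sobolev_0[OF \<Omega>(1,2) order_refl W0_pair_test[OF \<psi>]])
    have wg: "is_weak_gradient \<Omega> \<psi> (grad \<psi>)" by (rule is_weak_gradient_grad[OF test_functions_smooth[OF \<psi>]])
    have wm: "(\<lambda>x. indicator \<Omega> x *\<^sub>R weak_gradient \<Omega> \<psi> x) \<in> borel_measurable lebesgue"
      using is_weak_gradient_weak_gradient[OF wg] by (intro locally_integrable_measurable[OF \<Omega>(1)]) (simp add: is_weak_gradient_def)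
    have gm: "grad \<psi> \<in> borel_measurable lebesgue" using in_LPhi_grad_test[OF \<psi>] by (simp add: in_LPhi_def)
    have "integral\<^sup>L lebesgue (\<lambda>x. flux \<phi> (G x) \<bullet> grad \<psi> x) = integral\<^sup>L lebesgue (\<lambda>x. flux \<phi> (G x) \<bullet> (indicator \<Omega> x *\<^sub>R weak_gradient \<Omega> \<psi> x))"
    proof (rule integral_cong_AE)
      show "AE x in lebesgue. flux \<phi> (G x) \<bullet> grad \<psi> x = flux \<phi> (G x) \<bullet> (indicator \<Omega> x *\<^sub>R weak_gradient \<Omega> \<psi> x)"
        using weak_gradient_AE_eq[OF \<Omega>(1) wg] by eventually_elim (auto simp: indicator_def grad_test_outside[OF \<psi>])
    qed (intro borel_measurable_inner flux_measurable Gm gm wm)+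
    also have "\<dots> = integral\<^sup>L lebesgue (\<lambda>x. (indicator D x * f x) * (indicator \<Omega> x * \<psi> x))" by (rule *[OF w refl])
    also have "\<dots> = integral\<^sup>L lebesgue (\<lambda>x. (indicator D x * f x) * \<psi> x)"
      by (rule Bochner_Integration.integral_cong) (auto simp: indicator_def test_functions_outside[OF \<psi>])
    finally show ?thesis .
  qed
qed

end

section \<open>The energy\<close>

locale dirichlet_data = young +
  fixes D :: "'a::euclidean_space set" and F :: "'a \<Rightarrow> real"
  assumes D_open: "open D" and D_bounded: "bounded D"
    and F_measurable: "F \<in> borel_measurable lebesgue"
    and F_dual: "integrable lebesgue (\<lambda>x. \<Psi> \<bar>F x\<bar>)"
begin

abbreviation vol :: real where "vol \<equiv> measure lebesgue D"

lemma D_lmeasurable: "D \<in> lmeasurable"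
  using D_open D_bounded by (rule lmeasurable_open[rotated])

definition energy :: "('a \<Rightarrow> real) \<Rightarrow> ('a \<Rightarrow> 'a) \<Rightarrow> real" where
  "energy v G = modular G - integral\<^sup>L lebesgue (\<lambda>x. F x * v x)"

lemma pairing_integrable:
  assumes v: "in_LPhi v" shows "integrable lebesgue (\<lambda>x. F x * v x)"
proof (rule Bochner_Integration.integrable_bound)
  show "integrable lebesgue (\<lambda>x. \<Psi> \<bar>F x\<bar> + \<Phi> (norm (v x)))"
    using F_dual v by (auto simp: in_LPhi_def)
  show "(\<lambda>x. F x * v x) \<in> borel_measurable lebesgue"
    using F_measurable v by (auto simp: in_LPhi_def)
  have "norm (F x * v x) \<le> norm (\<Psi> \<bar>F x\<bar> + \<Phi> (norm (v x)))" for x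
    using young_inequality[of "\<bar>v x\<bar>" "\<bar>F x\<bar>"] by (simp add: abs_mult)
  then show "AE x in lebesgue. norm (F x * v x) \<le> norm (\<Psi> \<bar>F x\<bar> + \<Phi> (norm (v x)))" by simp
qed

text \<open>Where \<open>|F|\<close> is at most \<open>L\<close> the pairing is controlled by the \<open>L\<^sup>1\<close> norm; the remaining part of
  \<open>F\<close> is small in the dual space, whatever the factor taken out of \<open>v\<close>.\<close>

lemma pairing_eps:
  assumes "\<epsilon> > 0"
  obtains L where "L > 0"
    "\<And>v. in_LPhi v \<Longrightarrow> integrable lebesgue v \<Longrightarrow>
      integral\<^sup>L lebesgue (\<lambda>x. \<bar>F x * v x\<bar>) \<le> \<epsilon> + \<epsilon> * modular v + L * integral\<^sup>L lebesgue (\<lambda>x. \<bar>v x\<bar>)"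
proof -
  \<comment> \<open>Young's inequality for \<open>c F\<close> and \<open>v/c\<close> leaves the factor \<open>1/c \<le> \<epsilon>\<close> in front of the modular of \<open>v\<close>.\<close>
  define c where "c = max 1 (1/\<epsilon>)"
  have c: "c \<ge> 1" "1/c \<le> \<epsilon>"
    using assms max.cobounded2[of "1/\<epsilon>" 1] by (auto simp: c_def max_def field_simps)
  obtain C where C: "C > 0" "\<And>t. 0 \<le> t \<Longrightarrow> \<Psi> (c * t) \<le> C * \<Psi> t"
    using complementary_scale[of c] by metis
  let ?T = "\<lambda>n::nat. \<lambda>x. indicator {x. real n < \<bar>F x\<bar>} x * \<Psi> \<bar>F x\<bar>"
  have setm: "{x. real n < \<bar>F x\<bar>} \<in> sets lebesgue" for n
    using borel_measurable_abs[OF F_measurable] borel_measurable_less[of "\<lambda>_. real n" lebesgue "\<lambda>x. \<bar>F x\<bar>"]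
    by (simp add: pred_def)
  have iT: "integrable lebesgue (?T n)" for n
    using integrable_mult_indicator[OF setm F_dual] by simp
  have "(\<lambda>n. integral\<^sup>L lebesgue (?T n)) \<longlonglongrightarrow> integral\<^sup>L lebesgue (\<lambda>x::'a. 0)"
  proof (rule integral_dominated_convergence[where w="\<lambda>x. \<Psi> \<bar>F x\<bar>"])
    show "AE x in lebesgue. (\<lambda>n. ?T n x) \<longlonglongrightarrow> 0"
    proof (intro AE_I2)
      fix x
      obtain N :: nat where N: "\<bar>F x\<bar> \<le> real N" using real_arch_simple by blast
      have "\<forall>\<^sub>F n in sequentially. ?T n x = 0"
        using eventually_ge_at_top[of N] by eventually_elim (use N in auto)
      then show "(\<lambda>n. ?T n x) \<longlonglongrightarrow> 0" by (rule tendsto_eventually)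
    qed
    show "AE x in lebesgue. norm (?T n x) \<le> \<Psi> \<bar>F x\<bar>" for n
      by (intro AE_I2) (auto simp: indicator_def complementary_nonneg)
  qed (use iT F_dual in auto)
  then have "\<forall>\<^sub>F n in sequentially. integral\<^sup>L lebesgue (?T n) < \<epsilon> / C"
    using assms C(1) by (intro order_tendstoD(2)) auto
  then obtain n where n: "integral\<^sup>L lebesgue (?T n) < \<epsilon> / C" by (auto simp: eventually_sequentially)
  have "integral\<^sup>L lebesgue (\<lambda>x. \<bar>F x * v x\<bar>) \<le> \<epsilon> + \<epsilon> * modular v + (real n + 1) * integral\<^sup>L lebesgue (\<lambda>x. \<bar>v x\<bar>)"
    if v: "in_LPhi v" and iv: "integrable lebesgue v" for v
  proof -
    have le: "\<bar>F x * v x\<bar> \<le> C * ?T n x + \<epsilon> * \<Phi> (norm (v x)) + (real n + 1) * \<bar>v x\<bar>" for x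
    proof (cases "real n < \<bar>F x\<bar>")
      case True
      have "(c * \<bar>F x\<bar>) * ((1/c) * \<bar>v x\<bar>) \<le> \<Psi> (c * \<bar>F x\<bar>) + \<Phi> ((1/c) * \<bar>v x\<bar>)"
        using c by (intro young_inequality) auto
      also have "\<dots> \<le> C * \<Psi> \<bar>F x\<bar> + (1/c) * \<Phi> \<bar>v x\<bar>"
        using c by (intro add_mono C(2) Phi_convex_scale) auto
      also have "(1/c) * \<Phi> \<bar>v x\<bar> \<le> \<epsilon> * \<Phi> \<bar>v x\<bar>"
        using c by (intro mult_right_mono) (auto simp: Phi_nonneg)
      finally have "\<bar>F x * v x\<bar> \<le> C * \<Psi> \<bar>F x\<bar> + \<epsilon> * \<Phi> \<bar>v x\<bar>"
        using c by (simp add: abs_mult)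
      moreover have "0 \<le> (real n + 1) * \<bar>v x\<bar>" by simp
      ultimately have "\<bar>F x * v x\<bar> \<le> C * \<Psi> \<bar>F x\<bar> + \<epsilon> * \<Phi> \<bar>v x\<bar> + (real n + 1) * \<bar>v x\<bar>" by linarith
      then show ?thesis using True by simp
    next
      case False
      then have "\<bar>F x\<bar> * \<bar>v x\<bar> \<le> (real n + 1) * \<bar>v x\<bar>" by (intro mult_right_mono) auto
      moreover have "0 \<le> \<epsilon> * \<Phi> (norm (v x))" using assms by (simp add: Phi_nonneg)
      ultimately show ?thesis using False by (simp add: abs_mult)
    qed
    have i: "integrable lebesgue (\<lambda>x. C * ?T n x)" "integrable lebesgue (\<lambda>x. \<epsilon> * \<Phi> (norm (v x)))"
      "integrable lebesgue (\<lambda>x. (real n + 1) * \<bar>v x\<bar>)"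
      using iT[of n] v iv by (auto simp: in_LPhi_def)
    have "integral\<^sup>L lebesgue (\<lambda>x. \<bar>F x * v x\<bar>) \<le> integral\<^sup>L lebesgue (\<lambda>x. C * ?T n x + \<epsilon> * \<Phi> (norm (v x)) + (real n + 1) * \<bar>v x\<bar>)"
      using pairing_integrable[OF v] i by (intro integral_mono le integrable_abs Bochner_Integration.integrable_add)
    also have "\<dots> = C * integral\<^sup>L lebesgue (?T n) + \<epsilon> * modular v + (real n + 1) * integral\<^sup>L lebesgue (\<lambda>x. \<bar>v x\<bar>)"
      using i by (simp only: Bochner_Integration.integral_add Bochner_Integration.integrable_add integral_mult_right_zero modular_def)
    also have "C * integral\<^sup>L lebesgue (?T n) \<le> C * (\<epsilon> / C)" using n C(1) by (intro mult_left_mono) auto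
    finally show ?thesis using C(1) by simp
  qed
  then show ?thesis using that[of "real n + 1"] by simp
qed

lemma in_LPhi_L1:
  assumes v: "in_LPhi v" and out: "\<And>x. x \<notin> D \<Longrightarrow> v x = (0::real)"
  shows "integrable lebesgue v"
    and "0 \<le> \<delta> \<Longrightarrow> (\<And>t. 0 \<le> t \<Longrightarrow> t \<le> \<delta> + C * \<Phi> t) \<Longrightarrow> integral\<^sup>L lebesgue (\<lambda>x. \<bar>v x\<bar>) \<le> \<delta> * vol + C * modular v"
proof -
  have "(0::real) < 1" by simp
  then obtain C0 where "\<And>t. 0 \<le> t \<Longrightarrow> t \<le> 1 + C0 * \<Phi> t" by (rule linear_le_eps_Phi) blast
  then show "integrable lebesgue v" using in_LPhi_integrable(1)[OF v D_lmeasurable out, of 1 C0] by simp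
  show "0 \<le> \<delta> \<Longrightarrow> (\<And>t. 0 \<le> t \<Longrightarrow> t \<le> \<delta> + C * \<Phi> t) \<Longrightarrow> integral\<^sup>L lebesgue (\<lambda>x. \<bar>v x\<bar>) \<le> \<delta> * vol + C * modular v"
    using in_LPhi_integrable(2)[OF v D_lmeasurable out, of \<delta> C] by simp
qed

lemma pairing_le_abs: "integral\<^sup>L lebesgue (\<lambda>x. F x * v x) \<le> integral\<^sup>L lebesgue (\<lambda>x. \<bar>F x * v x\<bar>)"
  using integral_norm_bound[of lebesgue "\<lambda>x. F x * v x"] by (simp add: abs_le_iff)

text \<open>Superlinearity of \<open>\<Phi>\<close> absorbs the \<open>L\<^sup>1\<close> norm of \<open>pairing_eps\<close>.  This makes the energy coercive.\<close>

lemma pairing_bound: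
  assumes "\<epsilon> > 0"
  obtains C where "C \<ge> 0"
    "\<And>v. in_LPhi v \<Longrightarrow> (\<And>x. x \<notin> D \<Longrightarrow> v x = 0) \<Longrightarrow>
      integral\<^sup>L lebesgue (\<lambda>x. F x * v x) \<le> C + \<epsilon> * modular v"
proof -
  have "\<epsilon> / 2 > 0" using assms by simp
  then obtain L where L: "L > 0" "\<And>v. in_LPhi v \<Longrightarrow> integrable lebesgue v \<Longrightarrow>
      integral\<^sup>L lebesgue (\<lambda>x. \<bar>F x * v x\<bar>) \<le> \<epsilon>/2 + \<epsilon>/2 * modular v + L * integral\<^sup>L lebesgue (\<lambda>x. \<bar>v x\<bar>)"
    by (rule pairing_eps) blast
  have "\<epsilon> / (2 * L) > 0" using assms L by simp
  then obtain R where R: "R > 0" "\<And>t. R \<le> t \<Longrightarrow> t \<le> \<epsilon> / (2 * L) * \<Phi> t" by (rule Phi_superlinear) blast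
  have R': "t \<le> R + \<epsilon> / (2 * L) * \<Phi> t" if "0 \<le> t" for t
  proof (cases "R \<le> t")
    case True then show ?thesis using R(1) R(2)[OF True] by linarith
  next
    case False
    have "0 \<le> \<epsilon> / (2 * L) * \<Phi> t" using assms L that by (simp add: Phi_nonneg)
    then show ?thesis using False by linarith
  qed
  have "integral\<^sup>L lebesgue (\<lambda>x. F x * v x) \<le> (\<epsilon>/2 + L * (R * vol)) + \<epsilon> * modular v"
    if v: "in_LPhi v" and out: "\<And>x. x \<notin> D \<Longrightarrow> v x = 0" for v
  proof -
    have "L * integral\<^sup>L lebesgue (\<lambda>x. \<bar>v x\<bar>) \<le> L * (R * vol + \<epsilon> / (2 * L) * modular v)"
      using in_LPhi_L1(2)[OF v out _ R'] R(1) L(1) by (intro mult_left_mono) auto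
    also have "\<dots> = L * (R * vol) + \<epsilon>/2 * modular v" using L(1) by (simp add: field_simps)
    finally show ?thesis
      using L(2)[OF v in_LPhi_L1(1)[OF v out]] pairing_le_abs[of v] by (simp add: field_simps)
  qed
  then show ?thesis using that[of "\<epsilon>/2 + L * (R * vol)"] assms L(1) R(1) by simp
qed

lemma flux_inner_integrable:
  assumes G: "in_LPhi (G :: 'a \<Rightarrow> 'a)" and H: "in_LPhi (H :: 'a \<Rightarrow> 'a)"
  shows "integrable lebesgue (\<lambda>x. flux \<phi> (G x) \<bullet> H x)"
proof -
  have "(0::real) < 1" by simp
  then obtain C where C: "C > 0" "\<And>s t. 0 \<le> s \<Longrightarrow> 0 \<le> t \<Longrightarrow> \<phi> s * t \<le> 1 * \<Phi> s + C * \<Phi> t"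
    by (rule phi_mult_eps) blast
  show ?thesis
  proof (rule Bochner_Integration.integrable_bound)
    show "integrable lebesgue (\<lambda>x. \<Phi> (norm (G x)) + C * \<Phi> (norm (H x)))"
      using G H by (auto simp: in_LPhi_def)
    show "(\<lambda>x. flux \<phi> (G x) \<bullet> H x) \<in> borel_measurable lebesgue"
      using G H by (intro borel_measurable_inner flux_measurable) (auto simp: in_LPhi_def)
    have "norm (flux \<phi> (G x) \<bullet> H x) \<le> norm (\<Phi> (norm (G x)) + C * \<Phi> (norm (H x)))" for x
      using Cauchy_Schwarz_ineq2[of "flux \<phi> (G x)" "H x"] C(2)[of "norm (G x)" "norm (H x)"] by (simp add: norm_flux)
    then show "AE x in lebesgue. norm (flux \<phi> (G x) \<bullet> H x) \<le> norm (\<Phi> (norm (G x)) + C * \<Phi> (norm (H x)))" by simp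
  qed
qed

definition weak_solution_on :: "'a set \<Rightarrow> ('a \<Rightarrow> real) \<Rightarrow> ('a \<Rightarrow> 'a) \<Rightarrow> bool" where
  "weak_solution_on \<Omega> v G \<longleftrightarrow> W0_pair \<Omega> v G \<and>
    (\<forall>\<psi>\<in>test_functions \<Omega>. integral\<^sup>L lebesgue (\<lambda>x. flux \<phi> (G x) \<bullet> grad \<psi> x) = integral\<^sup>L lebesgue (\<lambda>x. F x * \<psi> x)) \<and>
    integral\<^sup>L lebesgue (\<lambda>x. flux \<phi> (G x) \<bullet> G x) = integral\<^sup>L lebesgue (\<lambda>x. F x * v x)"

text \<open>The first-order terms of \<open>flux_convexity\<close> integrate to the difference of the pairings by the weak
  equation, so only the remainder survives.\<close>

lemma energy_gap:
  assumes W: "weak_solution_on \<Omega> v G" and \<psi>: "\<psi> \<in> test_functions \<Omega>"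
  shows "energy v G + 2 * modular (\<lambda>x. (1/2) *\<^sub>R (grad \<psi> x - G x)) \<le> energy \<psi> (grad \<psi>)"
proof -
  have v: "in_LPhi v" "in_LPhi G" and e1: "integral\<^sup>L lebesgue (\<lambda>x. flux \<phi> (G x) \<bullet> grad \<psi> x) = integral\<^sup>L lebesgue (\<lambda>x. F x * \<psi> x)"
    and e2: "integral\<^sup>L lebesgue (\<lambda>x. flux \<phi> (G x) \<bullet> G x) = integral\<^sup>L lebesgue (\<lambda>x. F x * v x)"
    using W \<psi> by (auto simp: weak_solution_on_def W0_pair_def)
  have g: "in_LPhi (grad \<psi>)" by (rule in_LPhi_grad_test[OF \<psi>])
  have "0 \<le> \<bar>1/2::real\<bar>" by simp
  then obtain C where C: "\<And>t. 0 \<le> t \<Longrightarrow> \<Phi> (\<bar>1/2\<bar> * t) \<le> C * \<Phi> t" by (rule Phi_scale) blast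
  have h: "in_LPhi (\<lambda>x. (1/2) *\<^sub>R (grad \<psi> x - G x))" by (rule in_LPhi_scale[OF in_LPhi_diff[OF g v(2)] C])
  have i: "integrable lebesgue (\<lambda>x. \<Phi> (norm (G x)))" "integrable lebesgue (\<lambda>x. \<Phi> (norm (grad \<psi> x)))"
    "integrable lebesgue (\<lambda>x. 2 * \<Phi> (norm ((1/2) *\<^sub>R (grad \<psi> x - G x))))"
    using v(2) g h unfolding in_LPhi_def by (auto simp del: norm_scaleR)
  have j: "integrable lebesgue (\<lambda>x. flux \<phi> (G x) \<bullet> (grad \<psi> x - G x))"
    by (rule flux_inner_integrable[OF v(2) in_LPhi_diff[OF g v(2)]])
  have "integral\<^sup>L lebesgue (\<lambda>x. \<Phi> (norm (G x)) + flux \<phi> (G x) \<bullet> (grad \<psi> x - G x) + 2 * \<Phi> (norm ((1/2) *\<^sub>R (grad \<psi> x - G x))))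
      \<le> integral\<^sup>L lebesgue (\<lambda>x. \<Phi> (norm (grad \<psi> x)))"
    by (intro integral_mono Bochner_Integration.integrable_add i j flux_convexity)
  moreover have "integral\<^sup>L lebesgue (\<lambda>x. \<Phi> (norm (G x)) + flux \<phi> (G x) \<bullet> (grad \<psi> x - G x) + 2 * \<Phi> (norm ((1/2) *\<^sub>R (grad \<psi> x - G x))))
      = modular G + integral\<^sup>L lebesgue (\<lambda>x. flux \<phi> (G x) \<bullet> (grad \<psi> x - G x)) + 2 * modular (\<lambda>x. (1/2) *\<^sub>R (grad \<psi> x - G x))"
    using i j by (simp only: Bochner_Integration.integral_add Bochner_Integration.integrable_add integral_mult_right_zero modular_def)
  moreover have "integral\<^sup>L lebesgue (\<lambda>x. flux \<phi> (G x) \<bullet> (grad \<psi> x - G x)) = integral\<^sup>L lebesgue (\<lambda>x. F x * \<psi> x) - integral\<^sup>L lebesgue (\<lambda>x. F x * v x)"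
    using flux_inner_integrable[OF v(2) g] flux_inner_integrable[OF v(2) v(2)] by (simp add: inner_diff_right e1 e2)
  ultimately show ?thesis by (simp add: energy_def modular_def)
qed

lemma energy_le_test: "weak_solution_on \<Omega> v G \<Longrightarrow> \<psi> \<in> test_functions \<Omega> \<Longrightarrow> energy v G \<le> energy \<psi> (grad \<psi>)"
  using energy_gap[of \<Omega> v G \<psi>] modular_nonneg[of "\<lambda>x. (1/2) *\<^sub>R (grad \<psi> x - G x)"] by linarith

lemma energy_nonpos: "weak_solution_on \<Omega> v G \<Longrightarrow> energy v G \<le> 0"
proof -
  assume "weak_solution_on \<Omega> v G"
  then have "energy v G \<le> energy (\<lambda>x. 0) (grad (\<lambda>x. 0))" by (rule energy_le_test[OF _ test_functions_zero])
  also have "grad (\<lambda>x::'a. 0) = (\<lambda>x. 0)" by (rule ext, rule grad_eqI) simp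
  finally show ?thesis by (simp add: energy_def modular_def Phi_0)
qed

lemma energy_approximation:
  assumes W: "W0_pair \<Omega> v G" and sub: "\<Omega> \<subseteq> D" and e: "\<epsilon> > 0"
  obtains \<psi> where "\<psi> \<in> test_functions \<Omega>" "modular (\<lambda>x. v x - \<psi> x) < \<epsilon>" "modular (\<lambda>x. G x - grad \<psi> x) < \<epsilon>"
    "energy \<psi> (grad \<psi>) \<le> energy v G + \<epsilon>"
proof -
  have v: "in_LPhi v" and G: "in_LPhi G" and out: "\<And>x. x \<notin> D \<Longrightarrow> v x = 0" "\<And>x. x \<notin> D \<Longrightarrow> G x = 0"
    and ap: "\<And>e. e > 0 \<Longrightarrow> \<exists>\<psi>\<in>test_functions \<Omega>. modular (\<lambda>x. v x - \<psi> x) < e \<and> modular (\<lambda>x. G x - grad \<psi> x) < e"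
    using W sub unfolding W0_pair_def by blast+
  have "\<epsilon> / (4 * (modular G + 1)) > 0" using e modular_nonneg[of G] by (simp add: add_nonneg_pos)
  then obtain C1 where C1: "C1 > 0" "\<And>a b. 0 \<le> a \<Longrightarrow> 0 \<le> b \<Longrightarrow> \<Phi> (a + b) \<le> (1 + \<epsilon> / (4 * (modular G + 1))) * \<Phi> a + C1 * \<Phi> b"
    by (rule Phi_add_eps) blast
  have "\<epsilon> / 8 > 0" using e by simp
  then obtain L where L: "L > 0" "\<And>v. in_LPhi v \<Longrightarrow> integrable lebesgue v \<Longrightarrow>
      integral\<^sup>L lebesgue (\<lambda>x. \<bar>F x * v x\<bar>) \<le> \<epsilon>/8 + \<epsilon>/8 * modular v + L * integral\<^sup>L lebesgue (\<lambda>x. \<bar>v x\<bar>)"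
    by (rule pairing_eps) blast
  define \<delta> where "\<delta> = \<epsilon> / (8 * L * (vol + 1))"
  have \<delta>: "\<delta> > 0" using e L(1) by (simp add: \<delta>_def add_nonneg_pos)
  then obtain C2 where C2: "C2 > 0" "\<And>t. 0 \<le> t \<Longrightarrow> t \<le> \<delta> + C2 * \<Phi> t" by (rule linear_le_eps_Phi) blast
  define d where "d = Min {\<epsilon>, 1, \<epsilon> / (4 * C1), \<epsilon> / (8 * L * C2)}"
  have d: "d > 0" "d \<le> \<epsilon>" "d \<le> 1" "d \<le> \<epsilon> / (4 * C1)" "d \<le> \<epsilon> / (8 * L * C2)"
    using e C1(1) C2(1) L(1) by (auto simp: d_def)
  obtain \<psi> where \<psi>: "\<psi> \<in> test_functions \<Omega>" "modular (\<lambda>x. v x - \<psi> x) < d" "modular (\<lambda>x. G x - grad \<psi> x) < d"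
    using ap[OF d(1)] by blast
  have g: "in_LPhi (grad \<psi>)" "in_LPhi \<psi>" by (rule in_LPhi_grad_test[OF \<psi>(1)], rule in_LPhi_test[OF \<psi>(1)])
  have "modular (grad \<psi>) \<le> (1 + \<epsilon> / (4 * (modular G + 1))) * modular G + C1 * modular (\<lambda>x. G x - grad \<psi> x)"
  proof (rule in_LPhi_add_eps(2)[OF G in_LPhi_diff[OF G g(1)] _ _ C1(2)])
    show "norm (grad \<psi> x) \<le> norm (G x) + norm (G x - grad \<psi> x)" for x
      using norm_triangle_ineq4[of "G x" "G x - grad \<psi> x"] by simp
  qed (use g(1) in \<open>auto simp: in_LPhi_def\<close>)
  moreover have "C1 * modular (\<lambda>x. G x - grad \<psi> x) \<le> \<epsilon> / 4"
  proof -
    have "C1 * modular (\<lambda>x. G x - grad \<psi> x) \<le> C1 * (\<epsilon> / (4 * C1))"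
      using \<psi>(3) d(4) C1(1) by (intro mult_left_mono) auto
    then show ?thesis using C1(1) by simp
  qed
  moreover have "(1 + \<epsilon> / (4 * (modular G + 1))) * modular G \<le> modular G + \<epsilon> / 4"
    using e modular_nonneg[of G] by (simp add: field_simps)
  ultimately have 1: "modular (grad \<psi>) \<le> modular G + \<epsilon> / 2" by linarith
  have dl: "in_LPhi (\<lambda>x. v x - \<psi> x)" by (rule in_LPhi_diff[OF v g(2)])
  have do: "v x - \<psi> x = 0" if "x \<notin> D" for x
    using out(1)[OF that] test_functions_outside[OF test_functions_mono[OF sub \<psi>(1)] that] by simp
  have l1: "L * integral\<^sup>L lebesgue (\<lambda>x. \<bar>v x - \<psi> x\<bar>) \<le> \<epsilon> / 4"
  proof -
    have "integral\<^sup>L lebesgue (\<lambda>x. \<bar>v x - \<psi> x\<bar>) \<le> \<delta> * vol + C2 * modular (\<lambda>x. v x - \<psi> x)"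
      by (rule in_LPhi_L1(2)[OF dl do _ C2(2)]) (use \<delta> in auto)
    also have "\<dots> \<le> \<delta> * (vol + 1) + C2 * (\<epsilon> / (8 * L * C2))"
      using \<psi>(2) d(5) C2(1) \<delta> by (intro add_mono mult_left_mono) auto
    also have "\<dots> = \<epsilon> / (4 * L)"
      using L(1) C2(1) by (simp add: \<delta>_def field_simps add_nonneg_eq_0_iff) 
    finally show ?thesis using L(1) by (simp add: field_simps)
  qed
  have "integral\<^sup>L lebesgue (\<lambda>x. F x * v x) - integral\<^sup>L lebesgue (\<lambda>x. F x * \<psi> x) = integral\<^sup>L lebesgue (\<lambda>x. F x * (v x - \<psi> x))"
    using pairing_integrable[OF v] pairing_integrable[OF g(2)] by (simp add: right_diff_distrib)
  also have "\<dots> \<le> \<epsilon>/8 + \<epsilon>/8 * modular (\<lambda>x. v x - \<psi> x) + L * integral\<^sup>L lebesgue (\<lambda>x. \<bar>v x - \<psi> x\<bar>)"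
    by (rule order_trans[OF pairing_le_abs L(2)[OF dl in_LPhi_L1(1)[OF dl do]]])
  also have "\<epsilon>/8 * modular (\<lambda>x. v x - \<psi> x) \<le> \<epsilon>/8 * 1"
    using \<psi>(2) d(3) e by (intro mult_left_mono) auto
  finally have "integral\<^sup>L lebesgue (\<lambda>x. F x * v x) - integral\<^sup>L lebesgue (\<lambda>x. F x * \<psi> x) \<le> \<epsilon> / 2" using l1 by linarith
  then have "energy \<psi> (grad \<psi>) \<le> energy v G + \<epsilon>" using 1 by (simp add: energy_def)
  then show ?thesis using that \<psi> d(2) by force
qed

end

section \<open>Truncation and cut-off\<close>

lemma sin_minus_self_le: "\<bar>x - sin x\<bar> \<le> x\<^sup>2" for x :: real
proof -
  have pos: "\<bar>x - sin x\<bar> \<le> x\<^sup>2" if x: "x > 0" for x :: real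
  proof -
    obtain z where z: "0 < z" "z < x" "(x - sin x) - (0 - sin 0) = (x - 0) * (1 - cos z)"
    proof -
      have "((\<lambda>x. x - sin x) has_real_derivative 1 - cos t) (at t)" for t :: real
        by (auto intro!: derivative_eq_intros)
      from MVT2[OF x this] show ?thesis using that by auto
    qed
    have "1 - cos z = 2 * (sin (z/2))\<^sup>2" using cos_double_sin[of "z/2"] by simp
    also have "\<dots> = 2 * (\<bar>sin (z/2)\<bar> * \<bar>sin (z/2)\<bar>)" by (simp add: power2_eq_square)
    also have "\<dots> \<le> 2 * (\<bar>z/2\<bar> * 1)"
      by (intro mult_left_mono mult_mono abs_sin_x_le_abs_x abs_sin_le_one) auto
    finally have "1 - cos z \<le> x" using z by simp
    then have "x * (1 - cos z) \<le> x * x" using x by (intro mult_left_mono) auto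
    moreover have "0 \<le> x * (1 - cos z)" using x by simp
    ultimately show ?thesis using z(3) by (simp add: power2_eq_square)
  qed
  consider "x > 0" | "x < 0" | "x = 0" by linarith
  then show ?thesis
  proof cases
    case 2
    then show ?thesis using pos[of "- x"] by simp
  qed (use pos in auto)
qed

text \<open>The flat function yields a smooth cut-off that is \<open>1\<close> at \<open>0\<close> and vanishes beyond \<open>1\<close>.\<close>

definition cutoff :: "real \<Rightarrow> real" where "cutoff t = exp 1 * flat 0 (1 - t)"

lemma cutoff_has_derivative: "(cutoff has_real_derivative - (exp 1 * flat 2 (1 - t))) (at t)"
proof -
  have "((\<lambda>t. flat 0 (1 - t)) has_real_derivative flat 2 (1 - t) * (- 1)) (at t)"
    by (rule DERIV_chain2[of "flat 0"])
      (use flat_has_derivative[of 0 "1 - t"] in \<open>auto intro!: derivative_eq_intros simp: numeral_2_eq_2\<close>)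
  then have "((\<lambda>t. exp 1 * flat 0 (1 - t)) has_real_derivative exp 1 * (flat 2 (1 - t) * (- 1))) (at t)"
    by (rule DERIV_cmult)
  then show ?thesis by (simp add: cutoff_def[abs_def])
qed

lemma cutoff_props:
  shows "0 \<le> cutoff t" "0 \<le> t \<Longrightarrow> cutoff t \<le> 1" "1 \<le> t \<Longrightarrow> cutoff t = 0"
    and cutoff_deriv_bound: "0 \<le> t \<Longrightarrow> \<bar>exp 1 * flat 2 (1 - t)\<bar> \<le> 6 * exp 1"
    and cutoff_lipschitz: "0 \<le> t \<Longrightarrow> 1 - cutoff t \<le> 6 * exp 1 * t"
proof -
  show "0 \<le> cutoff t" "1 \<le> t \<Longrightarrow> cutoff t = 0" by (simp_all add: cutoff_def flat_def)
  show "cutoff t \<le> 1" if "0 \<le> t"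
  proof (cases "t < 1")
    case True
    have "1 \<le> 1 / (1 - t)" using True that by simp
    then have "exp 1 * exp (- (1 / (1 - t))) \<le> exp 1 * exp (- 1 :: real)" by (intro mult_left_mono) auto
    also have "\<dots> = 1" by (simp add: exp_minus)
    finally show ?thesis using True by (simp add: cutoff_def flat_def)
  qed (simp add: cutoff_def flat_def)
  have d: "\<bar>exp 1 * flat 2 (1 - t)\<bar> \<le> 6 * exp 1" if "0 \<le> t" for t
  proof -
    have "\<bar>flat 2 (1 - t)\<bar> \<le> 6"
    proof (cases "t \<le> 1")
      case True
      have "\<bar>flat 2 (1 - t)\<bar> \<le> fact 3 * \<bar>1 - t\<bar>" using flat_bound[of 2 "1 - t"] by (simp add: numeral_3_eq_3)
      also have "\<dots> \<le> fact 3 * 1" using True that by (intro mult_left_mono) auto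
      finally show ?thesis by (simp add: fact_numeral)
    qed (simp add: flat_def)
    then have "exp 1 * \<bar>flat 2 (1 - t)\<bar> \<le> exp 1 * 6" by (intro mult_left_mono) auto
    then show ?thesis by (simp add: abs_mult mult.commute)
  qed
  then show "0 \<le> t \<Longrightarrow> \<bar>exp 1 * flat 2 (1 - t)\<bar> \<le> 6 * exp 1" .
  show "1 - cutoff t \<le> 6 * exp 1 * t" if "0 \<le> t"
  proof (cases "t = 0")
    case True
    then show ?thesis by (simp add: cutoff_def flat_def exp_minus)
  next
    case False
    then have t: "0 < t" using that by simp
    obtain z where z: "0 < z" "z < t" "cutoff t - cutoff 0 = (t - 0) * (- (exp 1 * flat 2 (1 - z)))"
      using MVT2[OF t, of cutoff "\<lambda>t. - (exp 1 * flat 2 (1 - t))"] cutoff_has_derivative by auto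
    have c0: "cutoff 0 = 1" by (simp add: cutoff_def flat_def exp_minus)
    have "1 - cutoff t = t * (exp 1 * flat 2 (1 - z))" using z(3) c0 by simp
    also have "\<dots> \<le> t * (6 * exp 1)" using order_trans[OF abs_ge_self d[of z]] z(1) t by (intro mult_left_mono) auto
    finally show ?thesis by (simp add: mult.commute)
  qed
qed

lemma smooth_cutoff: "smooth g \<Longrightarrow> smooth (\<lambda>x. cutoff (g x))"
  unfolding cutoff_def by (intro smooth_mult smooth_const smooth_flat smooth_diff)

context young
begin

text \<open>For \<open>|s| \<ge> R\<close> the error is at most \<open>2|s|\<close>, which superlinearity makes small against \<open>\<Phi>\<close>; for \<open>|s| < R\<close>
  it is at most \<open>R\<^sup>2/M\<close>.  The truncation \<open>M sin (s/M)\<close> is smooth with slope at most \<open>1\<close>.\<close>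

lemma truncation_eps:
  assumes "\<delta> > 0"
  obtains M where "M > 0" "\<And>s. \<bar>s - M * sin (s / M)\<bar> \<le> \<delta> + \<delta> * \<Phi> \<bar>s\<bar>"
proof -
  have "\<delta> / 2 > 0" using assms by simp
  then obtain R where R: "R > 0" "\<And>t. R \<le> t \<Longrightarrow> t \<le> \<delta> / 2 * \<Phi> t" by (rule Phi_superlinear) blast
  define M where "M = R\<^sup>2 / \<delta>"
  have M: "M > 0" using R(1) assms by (simp add: M_def)
  have "\<bar>s - M * sin (s / M)\<bar> \<le> \<delta> + \<delta> * \<Phi> \<bar>s\<bar>" for s
  proof (cases "R \<le> \<bar>s\<bar>")
    case True
    have "\<bar>M * sin (s / M)\<bar> \<le> M * \<bar>s / M\<bar>"
      using M mult_left_mono[OF abs_sin_x_le_abs_x[of "s / M"], of M] by (simp add: abs_mult)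
    then have "\<bar>s - M * sin (s / M)\<bar> \<le> 2 * \<bar>s\<bar>" using M by simp
    also have "\<dots> \<le> \<delta> * \<Phi> \<bar>s\<bar>" using R(2)[OF True] by simp
    finally show ?thesis using assms by simp
  next
    case False
    have "s - M * sin (s / M) = M * (s / M - sin (s / M))" using M by (simp add: right_diff_distrib)
    then have "\<bar>s - M * sin (s / M)\<bar> = M * \<bar>s / M - sin (s / M)\<bar>" using M by (simp add: abs_mult)
    also have "\<dots> \<le> M * (s / M)\<^sup>2" using M sin_minus_self_le by (intro mult_left_mono) auto
    also have "\<dots> = \<bar>s\<bar>\<^sup>2 / M" using M by (simp add: power2_eq_square)
    also have "\<dots> \<le> R\<^sup>2 / M" using False M by (intro divide_right_mono power_mono) auto
    also have "\<dots> = \<delta>" using R(1) by (simp add: M_def)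
    finally show ?thesis using assms Phi_nonneg[of "\<bar>s\<bar>"] by (simp add: add_increasing2)
  qed
  then show ?thesis using that M by blast
qed

end

section \<open>Stability of the energy under sets of small capacity\<close>

text \<open>A point of \<open>K\<close> outside \<open>\<Omega>\<^sub>k\<close> would have distance to the complement of \<open>\<Omega>\<close> bounded below, contrary to
  the convergence of the complements.\<close>

lemma compact_subset_hausdorff_limit:
  fixes \<Omega> D :: "'a::euclidean_space set"
  assumes D: "bounded D" and sub: "\<And>k. \<Omega>s k \<subseteq> D" "\<Omega> \<subseteq> D" "open \<Omega>"
    and lim: "(\<lambda>k. hausdorff_compl_distance (\<Omega>s k) \<Omega>) \<longlonglongrightarrow> 0"
    and K: "compact K" "K \<subseteq> \<Omega>"
  shows "\<forall>\<^sub>F k in sequentially. K \<subseteq> \<Omega>s k"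
proof -
  obtain \<delta> where \<delta>: "\<delta> > 0" "(\<Union>x\<in>K. cball x \<delta>) \<subseteq> \<Omega>"
    using compact_subset_open_imp_cball_epsilon_subset[OF K(1) sub(3) K(2)] by blast
  have "- D \<noteq> {}" using D not_bounded_UNIV by (metis Compl_empty_eq double_complement)
  then obtain y0 where y0: "y0 \<notin> D" by blast
  then have ne: "y0 \<in> - \<Omega>" using sub(2) by auto
  obtain R where R: "\<And>x. x \<in> D \<Longrightarrow> dist y0 x \<le> R" using D bounded_any_center by metis
  have bdd: "bdd_above ((\<lambda>x. infdist x (- \<Omega>)) ` (- \<Omega>s k))" for k
  proof (rule bdd_aboveI2)
    fix x assume "x \<in> - \<Omega>s k"
    show "infdist x (- \<Omega>) \<le> max R 0"
    proof (cases "x \<in> D")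
      case True
      have "infdist x (- \<Omega>) \<le> dist x y0" by (rule infdist_le[OF ne])
      then show ?thesis using R[OF True] by (simp add: dist_commute)
    next
      case False
      then have "x \<in> - \<Omega>" using sub(2) by auto
      then show ?thesis by simp
    qed
  qed
  have "\<forall>\<^sub>F k in sequentially. hausdorff_compl_distance (\<Omega>s k) \<Omega> < \<delta>"
    using lim \<delta>(1) by (rule order_tendstoD(2))
  then show ?thesis
  proof eventually_elim
    case (elim k)
    show ?case
    proof (rule ccontr)
      assume "\<not> K \<subseteq> \<Omega>s k"
      then obtain x where x: "x \<in> K" "x \<in> - \<Omega>s k" by auto
      have "infdist x (- \<Omega>) \<le> (SUP x\<in>- \<Omega>s k. infdist x (- \<Omega>))"
        by (rule cSUP_upper[OF x(2) bdd])
      also have "\<dots> < \<delta>" using elim by (simp add: hausdorff_compl_distance_def hausdorff_distance_def)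
      finally have "infdist x (- \<Omega>) < \<delta>" .
      moreover have "\<delta> \<le> infdist x (- \<Omega>)"
      proof -
        have "\<delta> \<le> dist x a" if "a \<in> - \<Omega>" for a
        proof (rule ccontr)
          assume "\<not> \<delta> \<le> dist x a"
          then have "a \<in> (\<Union>x\<in>K. cball x \<delta>)" using x(1) by (intro UN_I[of x]) auto
          then show False using \<delta>(2) that by blast
        qed
        then show ?thesis using ne by (subst infdist_notempty) (auto intro!: cINF_greatest)
      qed
      ultimately show False by simp
    qed
  qed
qed

context dirichlet_data
begin

text \<open>The capacity of an open set is a supremum over its compact subsets, so \<open>K\<close> itself has small
  capacity, and a competitor for it can be mollified.\<close>

lemma capacity_potential:
  assumes cap: "capacity \<Phi> E D < ennreal \<eta>" and \<eta>: "\<eta> > 0" and K: "compact K" "K \<subseteq> E"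
  obtains \<zeta> where "\<zeta> \<in> test_functions D" "\<And>x. 0 \<le> \<zeta> x" "\<And>x. x \<in> K \<Longrightarrow> 1 < \<zeta> x" "modular (grad \<zeta>) \<le> \<eta>"
proof -
  have Ds: "D \<in> sets lebesgue" using D_open by auto
  obtain U where U: "open U" "E \<subseteq> U" "U \<subseteq> D" "capacity_open \<Phi> U D < ennreal \<eta>"
    using cap unfolding capacity_def INF_less_iff by auto
  have "capacity_compact \<Phi> K D \<le> capacity_open \<Phi> U D"
    unfolding capacity_open_def using K U(2) by (intro SUP_upper) auto
  then have "capacity_compact \<Phi> K D < ennreal \<eta>" using U(4) by (rule le_less_trans)
  then obtain w where w: "w \<in> capacity_admissible \<Phi> K D"
    and wn: "(\<integral>\<^sup>+x. ennreal (\<Phi> (norm (weak_gradient D w x))) \<partial>lebesgue_on D) < ennreal \<eta>"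
    unfolding capacity_compact_def INF_less_iff by auto
  obtain C where C: "compact C" "C \<subseteq> D" "\<And>x. x \<in> D - C \<Longrightarrow> w x = 0"
    using w by (auto simp: capacity_admissible_def)
  have w': "w \<in> sobolev_space \<Phi> D" "continuous_on D w" "\<And>x. x \<in> K \<Longrightarrow> 1 < w x" "\<And>x. x \<in> D \<Longrightarrow> 0 \<le> w x"
    using w by (auto simp: capacity_admissible_def)
  note s = sobolev_weak_gradient[OF D_open w'(1)]
  have KD: "K \<subseteq> D" using K(2) U(2,3) by auto
  obtain \<zeta> where \<zeta>: "\<zeta> \<in> test_functions D" "\<And>x. 0 \<le> \<zeta> x" "\<And>x. x \<in> K \<Longrightarrow> 1 < \<zeta> x"
    "modular (grad \<zeta>) \<le> modular (\<lambda>x. indicator D x *\<^sub>R weak_gradient D w x)"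
    using mollify_weak_gradient[OF D_open w'(2,4) C K(1) KD w'(3) s(1,3)] by blast
  have "(\<integral>\<^sup>+x. ennreal (\<Phi> (norm (weak_gradient D w x))) \<partial>lebesgue_on D)
     = (\<integral>\<^sup>+x. ennreal (\<Phi> (norm (weak_gradient D w x))) * indicator D x \<partial>lebesgue)"
    using Ds by (intro nn_integral_restrict_space) simp
  also have "\<dots> = (\<integral>\<^sup>+x. ennreal (\<Phi> (norm (indicator D x *\<^sub>R weak_gradient D w x))) \<partial>lebesgue)"
    by (intro nn_integral_cong) (auto simp: indicator_def Phi_0)
  also have "\<dots> = ennreal (modular (\<lambda>x. indicator D x *\<^sub>R weak_gradient D w x))"
    unfolding modular_def by (rule nn_integral_eq_integral) (use s(3) in \<open>auto simp: in_LPhi_def Phi_nonneg\<close>)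
  finally have "ennreal (modular (\<lambda>x. indicator D x *\<^sub>R weak_gradient D w x)) < ennreal \<eta>" using wn by simp
  then have "modular (grad \<zeta>) \<le> \<eta>" using \<zeta>(4) \<eta> by (simp add: ennreal_less_iff modular_nonneg)
  then show ?thesis using that \<zeta>(1-3) by blast
qed

text \<open>The competitor is \<open>v = M sin (\<psi>/M)\<close> times the cut-off of \<open>w\<close>.  Since sine has slope at most \<open>1\<close> and the
  cut-off lies between \<open>0\<close> and \<open>1\<close>, the gradient satisfies \<open>|\<nabla>v| \<le> |\<nabla>\<psi>| + M B |\<nabla>w|\<close>.  The bound \<open>A\<close>
  keeps all pairings with the small part of \<open>F\<close> uniformly small.\<close>

lemma truncated_competitor:
  assumes e: "\<epsilon> > 0" and A: "A \<ge> 0"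
  obtains \<eta> where "\<eta> > 0"
    "\<And>\<psi> w. \<psi> \<in> test_functions D \<Longrightarrow> w \<in> test_functions D \<Longrightarrow> modular \<psi> \<le> A \<Longrightarrow> modular (grad \<psi>) \<le> A \<Longrightarrow>
      (\<And>x. 0 \<le> w x) \<Longrightarrow> modular (grad w) \<le> \<eta> \<Longrightarrow>
      \<exists>v. smooth v \<and> (\<forall>x. \<psi> x = 0 \<or> 1 \<le> w x \<longrightarrow> v x = 0) \<and> energy v (grad v) \<le> energy \<psi> (grad \<psi>) + \<epsilon>"
proof -
  obtain Cp where Cp: "Cp > 0" "\<And>\<psi>. \<psi> \<in> test_functions D \<Longrightarrow> modular \<psi> \<le> Cp * modular (grad \<psi>)"
    using poincare[OF D_bounded] by metis
  \<comment> \<open>Seven errors of size \<open>\<epsilon>/8\<close> are allowed: two in the gradient term, two in the pairing for replacing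
    \<open>\<psi>\<close> by its truncation, and three there for the cut-off.  The truncation level \<open>M\<close> is fixed before \<open>\<eta>\<close>.\<close>
  have eighth: "\<epsilon> / (8 * r) * r = \<epsilon> / 8" if "r \<noteq> 0" for r :: real
    using that by (simp add: field_simps)
  define \<delta>1 where "\<delta>1 = \<epsilon> / (8 * (A + 1))"
  have \<delta>1: "\<delta>1 > 0" using e A by (simp add: \<delta>1_def)
  then obtain C1 where C1: "C1 > 0" "\<And>a b. 0 \<le> a \<Longrightarrow> 0 \<le> b \<Longrightarrow> \<Phi> (a + b) \<le> (1 + \<delta>1) * \<Phi> a + C1 * \<Phi> b"
    by (rule Phi_add_eps) blast
  define k1 where "k1 = 4 * \<kappa>\<^sup>2 + 1"
  have k1: "k1 \<ge> 1" by (simp add: k1_def)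
  define \<delta>2 where "\<delta>2 = \<epsilon> / (8 * (1 + k1 * A))"
  have \<delta>2: "\<delta>2 > 0" using e A k1 by (simp add: \<delta>2_def add_pos_nonneg)
  then obtain L where L: "L > 0" "\<And>v. in_LPhi v \<Longrightarrow> integrable lebesgue v \<Longrightarrow>
      integral\<^sup>L lebesgue (\<lambda>x. \<bar>F x * v x\<bar>) \<le> \<delta>2 + \<delta>2 * modular v + L * integral\<^sup>L lebesgue (\<lambda>x. \<bar>v x\<bar>)"
    by (rule pairing_eps) blast
  define \<delta>3 where "\<delta>3 = \<epsilon> / (8 * L * (vol + A + 1))"
  have \<delta>3: "\<delta>3 > 0" using e A L by (simp add: \<delta>3_def add_nonneg_pos)
  then obtain M where M: "M > 0" "\<And>s. \<bar>s - M * sin (s / M)\<bar> \<le> \<delta>3 + \<delta>3 * \<Phi> \<bar>s\<bar>"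
    by (rule truncation_eps) blast
  define B where "B = 6 * exp (1::real)"
  have B: "B > 0" by (simp add: B_def)
  have MB: "0 \<le> \<bar>M * B\<bar>" by simp
  obtain C2 where C2: "C2 > 0" "\<And>t. 0 \<le> t \<Longrightarrow> \<Phi> (\<bar>M * B\<bar> * t) \<le> C2 * \<Phi> t" by (rule Phi_scale[OF MB]) blast
  define \<delta>4 where "\<delta>4 = \<epsilon> / (8 * (L * M * B) * (vol + 1))"
  have \<delta>4: "\<delta>4 > 0" using e L M B by (simp add: \<delta>4_def add_nonneg_pos)
  then obtain C3 where C3: "C3 > 0" "\<And>t. 0 \<le> t \<Longrightarrow> t \<le> \<delta>4 + C3 * \<Phi> t" by (rule linear_le_eps_Phi) blast
  define \<eta> where "\<eta> = min (\<epsilon> / (8 * (C1 * C2))) (\<epsilon> / (8 * (L * M * B * (C3 * Cp))))"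
  have \<eta>: "\<eta> > 0" using e C1(1) C2(1) L(1) M(1) B C3(1) Cp(1) by (simp add: \<eta>_def)
  have \<eta>1: "C1 * C2 * \<eta> \<le> \<epsilon> / 8"
  proof -
    have "C1 * C2 * \<eta> \<le> C1 * C2 * (\<epsilon> / (8 * (C1 * C2)))"
      using C1(1) C2(1) by (intro mult_left_mono) (auto simp: \<eta>_def)
    then show ?thesis using C1(1) C2(1) by simp
  qed
  have \<eta>2: "L * M * B * (C3 * Cp) * \<eta> \<le> \<epsilon> / 8"
  proof -
    have "L * M * B * (C3 * Cp) * \<eta> \<le> L * M * B * (C3 * Cp) * (\<epsilon> / (8 * (L * M * B * (C3 * Cp))))"
      using L(1) M(1) B C3(1) Cp(1) by (intro mult_left_mono) (auto simp: \<eta>_def)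
    then show ?thesis using L(1) M(1) B C3(1) Cp(1) by simp
  qed
  have main: "\<exists>v. smooth v \<and> (\<forall>x. \<psi> x = 0 \<or> 1 \<le> w x \<longrightarrow> v x = 0) \<and> energy v (grad v) \<le> energy \<psi> (grad \<psi>) + \<epsilon>"
    if \<psi>: "\<psi> \<in> test_functions D" and w: "w \<in> test_functions D" and m: "modular \<psi> \<le> A" "modular (grad \<psi>) \<le> A"
      and nn: "\<And>x. 0 \<le> w x" and mw: "modular (grad w) \<le> \<eta>" for \<psi> w
  proof -
    define T where "T x = M * sin (\<psi> x / M)" for x
    define S where "S x = cutoff (w x)" for x
    define v where "v x = T x * S x" for x
    have s\<psi>: "smooth \<psi>" and sw: "smooth w" using \<psi> w by (auto intro: test_functions_smooth)
    have sT: "smooth T"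
      using smooth_mult[OF smooth_const smooth_sin[OF smooth_mult[OF s\<psi> smooth_const[of "1/M"]]], of M]
      by (simp add: T_def[abs_def])
    have sS: "smooth S" unfolding S_def[abs_def] by (rule smooth_cutoff[OF sw])
    have sv: "smooth v" unfolding v_def[abs_def] by (rule smooth_mult[OF sT sS])
    have vanish: "v x = 0" if "\<psi> x = 0 \<or> 1 \<le> w x" for x
      using that cutoff_props(3)[of "w x"] by (auto simp: v_def T_def S_def)
    obtain K where K: "compact K" "K \<subseteq> D" "\<And>x. x \<notin> K \<Longrightarrow> \<psi> x = 0"
      using test_functionsE[OF \<psi>] by metis
    have vD: "v \<in> test_functions D"
      by (rule test_functionsI[OF sv K(1,2)]) (simp add: vanish K(3))
    have TD: "T \<in> test_functions D"
      by (rule test_functionsI[OF sT K(1,2)]) (simp add: T_def K(3))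
    have S01: "0 \<le> S x" "S x \<le> 1" for x using cutoff_props(1,2)[of "w x"] nn[of x] by (simp_all add: S_def)
    have TM: "\<bar>T x\<bar> \<le> M" for x
      using abs_sin_le_one[of "\<psi> x / M"] M(1) by (simp add: T_def abs_mult mult_left_le)
    have T\<psi>: "\<bar>T x\<bar> \<le> \<bar>\<psi> x\<bar>" for x
      using mult_left_mono[OF abs_sin_x_le_abs_x[of "\<psi> x / M"], of M] M(1) by (simp add: T_def abs_mult)
    have gv: "grad v x = (cos (\<psi> x / M) * S x) *\<^sub>R grad \<psi> x + (T x * - (exp 1 * flat 2 (1 - w x))) *\<^sub>R grad w x" for x
    proof (rule grad_eqI)
      have "((\<lambda>s. M * sin (s / M)) has_real_derivative cos (\<psi> x / M)) (at (\<psi> x))"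
        using M(1) by (auto intro!: derivative_eq_intros)
      then have "((\<lambda>s. M * sin (s / M)) has_derivative (\<lambda>h. cos (\<psi> x / M) * h)) (at (\<psi> x))"
        by (simp add: has_field_derivative_def)
      from has_derivative_compose[OF has_derivative_grad[OF s\<psi>] this]
      have dT: "(T has_derivative (\<lambda>h. cos (\<psi> x / M) * (grad \<psi> x \<bullet> h))) (at x)" by (simp add: T_def[abs_def])
      have "(cutoff has_derivative (\<lambda>h. - (exp 1 * flat 2 (1 - w x)) * h)) (at (w x))"
        using cutoff_has_derivative[of "w x"] unfolding has_field_derivative_def .
      from has_derivative_compose[OF has_derivative_grad[OF sw] this]
      have dS: "(S has_derivative (\<lambda>h. - (exp 1 * flat 2 (1 - w x)) * (grad w x \<bullet> h))) (at x)" by (simp add: S_def[abs_def])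
      have "(v has_derivative (\<lambda>h. T x * (- (exp 1 * flat 2 (1 - w x)) * (grad w x \<bullet> h)) + cos (\<psi> x / M) * (grad \<psi> x \<bullet> h) * S x)) (at x)"
        unfolding v_def[abs_def] by (rule has_derivative_mult[OF dT dS])
      then show "(v has_derivative (\<lambda>h. ((cos (\<psi> x / M) * S x) *\<^sub>R grad \<psi> x + (T x * - (exp 1 * flat 2 (1 - w x))) *\<^sub>R grad w x) \<bullet> h)) (at x)"
        by (rule has_derivative_eq_rhs) (simp add: fun_eq_iff inner_add_left inner_diff_left)
    qed
    have gle: "norm (grad v x) \<le> norm (grad \<psi> x) + norm ((M * B) *\<^sub>R grad w x)" for x
    proof -
      have "\<bar>cos (\<psi> x / M) * S x\<bar> \<le> 1 * 1"
        unfolding abs_mult using S01[of x] by (intro mult_mono) auto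
      then have 1: "norm ((cos (\<psi> x / M) * S x) *\<^sub>R grad \<psi> x) \<le> norm (grad \<psi> x)"
        using mult_right_mono[of "\<bar>cos (\<psi> x / M) * S x\<bar>" 1 "norm (grad \<psi> x)"] by simp
      have "\<bar>T x * - (exp 1 * flat 2 (1 - w x))\<bar> \<le> M * B"
        unfolding abs_mult[of "T x"] using TM[of x] cutoff_deriv_bound[OF nn[of x]] M(1) by (intro mult_mono) (auto simp: B_def)
      then have 2: "norm ((T x * - (exp 1 * flat 2 (1 - w x))) *\<^sub>R grad w x) \<le> norm ((M * B) *\<^sub>R grad w x)"
        using mult_right_mono[of "\<bar>T x * - (exp 1 * flat 2 (1 - w x))\<bar>" "M * B" "norm (grad w x)"] M(1) B by simp
      show ?thesis unfolding gv by (rule order_trans[OF norm_triangle_ineq add_mono[OF 1 2]])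
    qed
    have lw: "in_LPhi (\<lambda>x. (M * B) *\<^sub>R grad w x)" by (rule in_LPhi_scale[OF in_LPhi_grad_test[OF w] C2(2)])
    have "modular (grad v) \<le> (1 + \<delta>1) * modular (grad \<psi>) + C1 * modular (\<lambda>x. (M * B) *\<^sub>R grad w x)"
      by (rule in_LPhi_add_eps(2)[OF in_LPhi_grad_test[OF \<psi>] lw _ gle C1(2)])
        (use in_LPhi_grad_test[OF vD] in \<open>auto simp: in_LPhi_def\<close>)
    moreover have "\<delta>1 * modular (grad \<psi>) \<le> \<epsilon> / 8"
    proof -
      have "\<delta>1 * modular (grad \<psi>) \<le> \<delta>1 * (A + 1)" using m(2) \<delta>1 by (intro mult_left_mono) auto
      also have "\<dots> = \<epsilon> / 8" unfolding \<delta>1_def by (rule eighth) (use A in simp)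
      finally show ?thesis .
    qed
    moreover have "C1 * modular (\<lambda>x. (M * B) *\<^sub>R grad w x) \<le> \<epsilon> / 8"
    proof -
      have "C1 * modular (\<lambda>x. (M * B) *\<^sub>R grad w x) \<le> C1 * (C2 * \<eta>)"
        using modular_scale[OF in_LPhi_grad_test[OF w] C2(2)] mw C1(1) C2(1)
        by (intro mult_left_mono) (auto intro: order_trans mult_left_mono)
      then show ?thesis using \<eta>1 by simp
    qed
    ultimately have E1: "modular (grad v) \<le> modular (grad \<psi>) + \<epsilon> / 4" by (simp add: distrib_right)
    have l\<psi>: "in_LPhi \<psi>" and lT: "in_LPhi T" and lv: "in_LPhi v" using in_LPhi_test \<psi> TD vD by blast+
    have la: "in_LPhi (\<lambda>x. \<psi> x - T x)" and lb: "in_LPhi (\<lambda>x. T x - v x)"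
      by (rule in_LPhi_diff[OF l\<psi> lT], rule in_LPhi_diff[OF lT lv])
    have oa: "\<psi> x - T x = 0" and ob: "T x - v x = 0" if "x \<notin> D" for x
      using that test_functions_outside[OF \<psi>] test_functions_outside[OF TD] test_functions_outside[OF vD] by auto
    have a: "integral\<^sup>L lebesgue (\<lambda>x. F x * (\<psi> x - T x)) \<le> \<epsilon> / 4"
    proof -
      have "modular (\<lambda>x. \<psi> x - T x) \<le> k1 * A"
      proof -
        have "modular (\<lambda>x. \<psi> x - T x) \<le> modular (\<lambda>x. 2 *\<^sub>R \<psi> x)"
        proof (rule in_LPhi_mono(2))
          show "in_LPhi (\<lambda>x. 2 *\<^sub>R \<psi> x)" by (rule in_LPhi_scale[OF l\<psi>, of _ "4 * \<kappa>\<^sup>2"]) (use Phi_double in simp)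
          show "norm (\<psi> x - T x) \<le> norm (2 *\<^sub>R \<psi> x)" for x using T\<psi>[of x] by simp
        qed (use la in \<open>simp add: in_LPhi_def\<close>)
        also have "\<dots> \<le> 4 * \<kappa>\<^sup>2 * modular \<psi>" by (rule modular_scale[OF l\<psi>]) (use Phi_double in simp)
        also have "\<dots> \<le> k1 * A" using m(1) modular_nonneg[of \<psi>] by (intro mult_mono) (auto simp: k1_def)
        finally show ?thesis .
      qed
      then have "\<delta>2 + \<delta>2 * modular (\<lambda>x. \<psi> x - T x) \<le> \<delta>2 * (1 + k1 * A)"
        using \<delta>2 by (simp add: distrib_left)
      also have "\<dots> = \<epsilon> / 8" unfolding \<delta>2_def by (rule eighth) (use A k1 in \<open>simp add: add_nonneg_eq_0_iff\<close>)
      finally have 1: "\<delta>2 + \<delta>2 * modular (\<lambda>x. \<psi> x - T x) \<le> \<epsilon> / 8" .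
      have "integral\<^sup>L lebesgue (\<lambda>x. \<bar>\<psi> x - T x\<bar>) \<le> integral\<^sup>L lebesgue (\<lambda>x. \<delta>3 * indicator D x + \<delta>3 * \<Phi> (norm (\<psi> x)))"
      proof (rule integral_mono)
        show "integrable lebesgue (\<lambda>x. \<bar>\<psi> x - T x\<bar>)" using in_LPhi_L1(1)[OF la oa] by simp
        show "integrable lebesgue (\<lambda>x. \<delta>3 * indicator D x + \<delta>3 * \<Phi> (norm (\<psi> x)))"
          using l\<psi> D_lmeasurable by (auto simp: in_LPhi_def fmeasurable_def)
        show "\<bar>\<psi> x - T x\<bar> \<le> \<delta>3 * indicator D x + \<delta>3 * \<Phi> (norm (\<psi> x))" for x
          using M(2)[of "\<psi> x"] oa[of x] \<delta>3 by (cases "x \<in> D") (auto simp: T_def Phi_nonneg)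
      qed
      also have "\<dots> = \<delta>3 * vol + \<delta>3 * modular \<psi>"
        using l\<psi> D_lmeasurable by (subst Bochner_Integration.integral_add) (auto simp: in_LPhi_def fmeasurable_def modular_def)
      also have "\<dots> = \<delta>3 * (vol + modular \<psi>)" by (simp add: distrib_left)
      also have "\<dots> \<le> \<delta>3 * (vol + A + 1)" using m(1) \<delta>3 by (intro mult_left_mono) auto
      finally have "L * integral\<^sup>L lebesgue (\<lambda>x. \<bar>\<psi> x - T x\<bar>) \<le> L * (\<delta>3 * (vol + A + 1))"
        using L(1) by (intro mult_left_mono) auto
      also have "\<dots> = \<delta>3 * (L * (vol + A + 1))" by simp
      also have "\<dots> = \<epsilon> / 8"
      proof -
        have "L * (vol + A + 1) > 0" using L(1) A by (simp add: add_nonneg_pos)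
        then have "L * (vol + A + 1) \<noteq> 0" by linarith
        from eighth[OF this] show ?thesis by (simp only: \<delta>3_def mult.assoc)
      qed
      finally show ?thesis
        using order_trans[OF pairing_le_abs L(2)[OF la in_LPhi_L1(1)[OF la oa]]] 1 by simp
    qed
    have b: "integral\<^sup>L lebesgue (\<lambda>x. F x * (T x - v x)) \<le> 3 * \<epsilon> / 8"
    proof -
      have d: "\<bar>T x - v x\<bar> = \<bar>T x\<bar> * (1 - S x)" for x
      proof -
        have "T x - v x = T x * (1 - S x)" by (simp add: v_def right_diff_distrib)
        then show ?thesis using S01[of x] by (simp add: abs_mult)
      qed
      have "modular (\<lambda>x. T x - v x) \<le> modular \<psi>"
      proof (rule in_LPhi_mono(2)[OF _ l\<psi>])
        have "\<bar>T x\<bar> * (1 - S x) \<le> \<bar>T x\<bar> * 1" for x using S01[of x] by (intro mult_left_mono) auto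
        then show "norm (T x - v x) \<le> norm (\<psi> x)" for x using T\<psi>[of x] by (simp add: d) (meson order_trans)
      qed (use lb in \<open>simp add: in_LPhi_def\<close>)
      also have "\<dots> \<le> k1 * A" using m(1) mult_right_mono[OF k1 A] by linarith
      finally have "\<delta>2 + \<delta>2 * modular (\<lambda>x. T x - v x) \<le> \<delta>2 * (1 + k1 * A)"
        using \<delta>2 by (simp add: distrib_left)
      also have "\<dots> = \<epsilon> / 8" unfolding \<delta>2_def by (rule eighth) (use A k1 in \<open>simp add: add_nonneg_eq_0_iff\<close>)
      finally have 1: "\<delta>2 + \<delta>2 * modular (\<lambda>x. T x - v x) \<le> \<epsilon> / 8" .
      have lw0: "in_LPhi w" and ow: "\<And>x. x \<notin> D \<Longrightarrow> w x = 0" using in_LPhi_test[OF w] test_functions_outside[OF w] by auto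
      have iw: "integrable lebesgue w" by (rule in_LPhi_L1(1)[OF lw0 ow])
      have "integral\<^sup>L lebesgue (\<lambda>x. \<bar>T x - v x\<bar>) \<le> integral\<^sup>L lebesgue (\<lambda>x. (M * B) * \<bar>w x\<bar>)"
      proof (rule integral_mono)
        show "integrable lebesgue (\<lambda>x. \<bar>T x - v x\<bar>)" using in_LPhi_L1(1)[OF lb ob] by simp
        show "integrable lebesgue (\<lambda>x. (M * B) * \<bar>w x\<bar>)" using iw by simp
        have "\<bar>T x\<bar> * (1 - S x) \<le> M * (B * w x)" for x
          using TM[of x] cutoff_lipschitz[OF nn[of x]] S01[of x] M(1) by (intro mult_mono) (auto simp: S_def B_def)
        then show "\<bar>T x - v x\<bar> \<le> (M * B) * \<bar>w x\<bar>" for x using nn[of x] by (simp add: d mult.assoc)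
      qed
      also have "\<dots> = (M * B) * integral\<^sup>L lebesgue (\<lambda>x. \<bar>w x\<bar>)" by simp
      also have "\<dots> \<le> (M * B) * (\<delta>4 * vol + C3 * modular w)"
        using in_LPhi_L1(2)[OF lw0 ow _ C3(2)] \<delta>4 M(1) B by (intro mult_left_mono) auto
      also have "\<dots> \<le> (M * B) * (\<delta>4 * (vol + 1) + C3 * (Cp * \<eta>))"
      proof -
        have "modular w \<le> Cp * \<eta>" using Cp(2)[OF w] mult_left_mono[OF mw, of Cp] Cp(1) by linarith
        then have "C3 * modular w \<le> C3 * (Cp * \<eta>)" using C3(1) by (intro mult_left_mono) auto
        moreover have "\<delta>4 * vol \<le> \<delta>4 * (vol + 1)" using \<delta>4 by (intro mult_left_mono) auto
        ultimately have "\<delta>4 * vol + C3 * modular w \<le> \<delta>4 * (vol + 1) + C3 * (Cp * \<eta>)" by linarith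
        then show ?thesis using M(1) B by (intro mult_left_mono) auto
      qed
      finally have "L * integral\<^sup>L lebesgue (\<lambda>x. \<bar>T x - v x\<bar>) \<le> L * ((M * B) * (\<delta>4 * (vol + 1) + C3 * (Cp * \<eta>)))"
        using L(1) by (intro mult_left_mono) auto
      also have "\<dots> = \<delta>4 * (L * M * B * (vol + 1)) + L * M * B * (C3 * Cp) * \<eta>"
        by (simp add: algebra_simps)
      also have "\<delta>4 * (L * M * B * (vol + 1)) = \<epsilon> / 8"
      proof -
        have "L * M * B * (vol + 1) > 0" using L(1) M(1) B by (simp add: add_nonneg_pos)
        then have "L * M * B * (vol + 1) \<noteq> 0" by linarith
        from eighth[OF this] show ?thesis by (simp only: \<delta>4_def mult.assoc)
      qed
      finally show ?thesis
        using order_trans[OF pairing_le_abs L(2)[OF lb in_LPhi_L1(1)[OF lb ob]]] 1 \<eta>2 by simp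
    qed
    have "integral\<^sup>L lebesgue (\<lambda>x. F x * \<psi> x) - integral\<^sup>L lebesgue (\<lambda>x. F x * v x)
       = integral\<^sup>L lebesgue (\<lambda>x. F x * (\<psi> x - T x)) + integral\<^sup>L lebesgue (\<lambda>x. F x * (T x - v x))"
      using pairing_integrable[OF l\<psi>] pairing_integrable[OF lT] pairing_integrable[OF lv] by (simp add: right_diff_distrib)
    then have "energy v (grad v) \<le> energy \<psi> (grad \<psi>) + \<epsilon>"
      using a b E1 e by (simp add: energy_def)
    then show ?thesis using sv vanish by blast
  qed
  show ?thesis by (rule that[OF \<eta> main])
qed

text \<open>Test functions close to the solution on \<open>\<Omega>'\<close> have energy at most \<open>1\<close>, hence by coercivity modulars
  bounded by a constant \<open>A\<close> that is independent of \<open>\<Omega>'\<close>.  Their truncated competitors vanish where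
  \<open>w \<ge> 1\<close>, in particular near \<open>K - \<Omega>\<close>, and are therefore test functions in \<open>\<Omega>\<close>.\<close>

lemma energy_lower_bound:
  assumes W: "weak_solution_on \<Omega> v G" and \<Omega>: "open \<Omega>" "\<Omega> \<subseteq> D" and e: "\<epsilon> > 0"
  obtains \<eta> where "\<eta> > 0"
    "\<And>\<Omega>' v' G'. \<Omega>' \<subseteq> D \<Longrightarrow> weak_solution_on \<Omega>' v' G' \<Longrightarrow> capacity \<Phi> (\<Omega>' - \<Omega>) D < ennreal \<eta> \<Longrightarrow>
      energy v G \<le> energy v' G' + \<epsilon>"
proof -
  obtain Cp where Cp: "Cp > 0" "\<And>\<psi>. \<psi> \<in> test_functions D \<Longrightarrow> modular \<psi> \<le> Cp * modular (grad \<psi>)"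
    using poincare[OF D_bounded] by metis
  have "1 / (2 * Cp) > 0" using Cp(1) by simp
  then obtain C where C: "C \<ge> 0" "\<And>v. in_LPhi v \<Longrightarrow> (\<And>x. x \<notin> D \<Longrightarrow> v x = 0) \<Longrightarrow>
      integral\<^sup>L lebesgue (\<lambda>x. F x * v x) \<le> C + 1 / (2 * Cp) * modular v"
    by (rule pairing_bound) blast
  define A where "A = max (2 * (1 + C)) (Cp * (2 * (1 + C)))"
  have A: "A \<ge> 0" "2 * (1 + C) \<le> A" "Cp * (2 * (1 + C)) \<le> A" using C(1) by (auto simp: A_def)
  have "\<epsilon> / 2 > 0" using e by simp
  then obtain \<eta> where \<eta>: "\<eta> > 0" "\<And>\<psi> w. \<psi> \<in> test_functions D \<Longrightarrow> w \<in> test_functions D \<Longrightarrow> modular \<psi> \<le> A \<Longrightarrow> modular (grad \<psi>) \<le> A \<Longrightarrow>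
      (\<And>x. 0 \<le> w x) \<Longrightarrow> modular (grad w) \<le> \<eta> \<Longrightarrow>
      \<exists>v. smooth v \<and> (\<forall>x. \<psi> x = 0 \<or> 1 \<le> w x \<longrightarrow> v x = 0) \<and> energy v (grad v) \<le> energy \<psi> (grad \<psi>) + \<epsilon> / 2"
    using truncated_competitor[OF _ A(1), of "\<epsilon> / 2"] by metis
  have "energy v G \<le> energy v' G' + \<epsilon>"
    if \<Omega>': "\<Omega>' \<subseteq> D" and W': "weak_solution_on \<Omega>' v' G'" and cap: "capacity \<Phi> (\<Omega>' - \<Omega>) D < ennreal \<eta>" for \<Omega>' v' G'
  proof -
    have p: "min 1 (\<epsilon> / 2) > 0" using e by simp
    have "W0_pair \<Omega>' v' G'" using W' by (simp add: weak_solution_on_def)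
    then obtain \<psi> where \<psi>: "\<psi> \<in> test_functions \<Omega>'" "energy \<psi> (grad \<psi>) \<le> energy v' G' + min 1 (\<epsilon> / 2)"
      using energy_approximation[OF _ \<Omega>' p] by metis
    have \<psi>D: "\<psi> \<in> test_functions D" by (rule test_functions_mono[OF \<Omega>' \<psi>(1)])
    have "energy \<psi> (grad \<psi>) \<le> 1" using \<psi>(2) energy_nonpos[OF W'] by linarith
    then have "modular (grad \<psi>) \<le> 1 + (C + 1 / (2 * Cp) * modular \<psi>)"
      using C(2)[OF in_LPhi_test[OF \<psi>D] test_functions_outside[OF \<psi>D]] by (simp add: energy_def)
    also have "1 / (2 * Cp) * modular \<psi> \<le> 1 / (2 * Cp) * (Cp * modular (grad \<psi>))"
      using Cp by (intro mult_left_mono Cp(2)[OF \<psi>D]) auto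
    finally have g: "modular (grad \<psi>) \<le> 2 * (1 + C)" using Cp(1) by simp
    have f: "modular \<psi> \<le> Cp * (2 * (1 + C))"
      using Cp(2)[OF \<psi>D] mult_left_mono[OF g, of Cp] Cp(1) by linarith
    obtain K where K: "compact K" "K \<subseteq> \<Omega>'" "\<And>x. x \<notin> K \<Longrightarrow> \<psi> x = 0"
      using test_functionsE[OF \<psi>(1)] by metis
    have KK: "compact (K - \<Omega>)" "K - \<Omega> \<subseteq> \<Omega>' - \<Omega>" using K(2) compact_diff[OF K(1) \<Omega>(1)] by auto
    obtain w where w: "w \<in> test_functions D" "\<And>x. 0 \<le> w x" "\<And>x. x \<in> K - \<Omega> \<Longrightarrow> 1 < w x" "modular (grad w) \<le> \<eta>"
      using capacity_potential[OF cap \<eta>(1) KK] by metis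
    obtain z where z: "smooth z" "\<And>x. \<psi> x = 0 \<or> 1 \<le> w x \<Longrightarrow> z x = 0" "energy z (grad z) \<le> energy \<psi> (grad \<psi>) + \<epsilon> / 2"
      using \<eta>(2)[OF \<psi>D w(1) _ _ w(2,4)] f g A by (meson order_trans)
    have "z \<in> test_functions \<Omega>"
    proof (rule test_functionsI[OF z(1)])
      have "closed {x. w x \<le> 1}"
        by (intro closed_Collect_le continuous_on_const smooth_continuous test_functions_smooth[OF w(1)])
      then show "compact (K \<inter> {x. w x \<le> 1})" using K(1) by (rule compact_Int_closed[rotated])
      show "K \<inter> {x. w x \<le> 1} \<subseteq> \<Omega>" using w(3) by force
      show "z x = 0" if "x \<notin> K \<inter> {x. w x \<le> 1}" for x
        using that K(3)[of x] z(2)[of x] by force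
    qed
    then have "energy v G \<le> energy z (grad z)" by (rule energy_le_test[OF W])
    then show ?thesis using z(3) \<psi>(2) by linarith
  qed
  then show ?thesis using that \<eta>(1) by blast
qed

section \<open>Convergence of the solutions\<close>

text \<open>One fixed test function \<open>\<psi>\<close> near the limit is compared with every \<open>vs k\<close>.  The gap controls the
  gradients; the functions follow from Poincare's inequality for \<open>\<zeta> - \<psi>\<close>, where the test function \<open>\<zeta>\<close> is
  close to \<open>vs k\<close>.\<close>

lemma solutions_converge:
  assumes \<Omega>: "open \<Omega>" "\<Omega> \<subseteq> D" and \<Omega>s: "\<And>k. \<Omega>s k \<subseteq> D"
    and haus: "(\<lambda>k. hausdorff_compl_distance (\<Omega>s k) \<Omega>) \<longlonglongrightarrow> 0"
    and cap: "(\<lambda>k. capacity \<Phi> (\<Omega>s k - \<Omega>) D) \<longlonglongrightarrow> 0"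
    and Ws: "\<And>k. weak_solution_on (\<Omega>s k) (vs k) (Gs k)" and W: "weak_solution_on \<Omega> v G"
  shows "(\<lambda>k. modular (\<lambda>x. vs k x - v x)) \<longlonglongrightarrow> 0" "(\<lambda>k. modular (\<lambda>x. Gs k x - G x)) \<longlonglongrightarrow> 0"
proof -
  obtain Cp where Cp: "Cp > 0" "\<And>\<psi>. \<psi> \<in> test_functions D \<Longrightarrow> modular \<psi> \<le> Cp * modular (grad \<psi>)"
    using poincare[OF D_bounded] by metis
  define q where "q = 4 * \<kappa>\<^sup>2"
  have q: "q > 0" using kappa_ge_1 by (simp add: q_def)
  have P: "W0_pair \<Omega> v G" and Ps: "W0_pair (\<Omega>s k) (vs k) (Gs k)" for k
    using W Ws by (auto simp: weak_solution_on_def)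
  have l: "in_LPhi v" "in_LPhi G" "in_LPhi (vs k)" "in_LPhi (Gs k)" for k
    using P Ps[of k] by (auto simp: W0_pair_def)
  define c where "c = q * (q * (1 + Cp * (q * (q + 1))) + 1)"
  have cpos: "c > 0" using q Cp(1) unfolding c_def by (intro mult_pos_pos add_pos_pos add_nonneg_pos mult_nonneg_nonneg) auto
  have key: "\<forall>\<^sub>F k in sequentially. modular (\<lambda>x. vs k x - v x) \<le> c * \<epsilon> \<and> modular (\<lambda>x. Gs k x - G x) \<le> q * (q + 1) * \<epsilon>"
    if e: "\<epsilon> > 0" for \<epsilon>
  proof -
    obtain \<psi> where \<psi>: "\<psi> \<in> test_functions \<Omega>" "modular (\<lambda>x. v x - \<psi> x) < \<epsilon>" "modular (\<lambda>x. G x - grad \<psi> x) < \<epsilon>"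
      "energy \<psi> (grad \<psi>) \<le> energy v G + \<epsilon>"
      using energy_approximation[OF P \<Omega>(2) e] by metis
    obtain K where K: "smooth \<psi>" "compact K" "K \<subseteq> \<Omega>" "\<And>x. x \<notin> K \<Longrightarrow> \<psi> x = 0"
      using test_functionsE[OF \<psi>(1)] by metis
    obtain \<eta> where \<eta>: "\<eta> > 0" "\<And>\<Omega>' v' G'. \<Omega>' \<subseteq> D \<Longrightarrow> weak_solution_on \<Omega>' v' G' \<Longrightarrow> capacity \<Phi> (\<Omega>' - \<Omega>) D < ennreal \<eta> \<Longrightarrow>
      energy v G \<le> energy v' G' + \<epsilon>"
      using energy_lower_bound[OF W \<Omega> e] by metis
    have "\<forall>\<^sub>F k in sequentially. capacity \<Phi> (\<Omega>s k - \<Omega>) D < ennreal \<eta>"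
      using cap \<eta>(1) by (intro order_tendstoD(2)) auto
    moreover have "\<forall>\<^sub>F k in sequentially. K \<subseteq> \<Omega>s k"
      by (rule compact_subset_hausdorff_limit[OF D_bounded \<Omega>s \<Omega>(2,1) haus K(2,3)])
    ultimately show ?thesis
    proof eventually_elim
      case (elim k)
      have \<psi>k: "\<psi> \<in> test_functions (\<Omega>s k)" by (rule test_functionsI[OF K(1,2) elim(2) K(4)])
      have \<psi>D: "\<psi> \<in> test_functions D" by (rule test_functions_mono[OF \<Omega>s \<psi>k])
      have l\<psi>: "in_LPhi \<psi>" "in_LPhi (grad \<psi>)" by (rule in_LPhi_test[OF \<psi>D], rule in_LPhi_grad_test[OF \<psi>D])
      have "2 * modular (\<lambda>x. (1/2) *\<^sub>R (grad \<psi> x - Gs k x)) \<le> 2 * \<epsilon>"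
        using energy_gap[OF Ws \<psi>k] \<eta>(2)[OF \<Omega>s Ws elim(1)] \<psi>(4) by linarith
      then have h: "modular (\<lambda>x. (1/2) *\<^sub>R (grad \<psi> x - Gs k x)) \<le> \<epsilon>" by simp
      have "0 \<le> \<bar>1/2::real\<bar>" by simp
      then obtain C where C: "\<And>t. 0 \<le> t \<Longrightarrow> \<Phi> (\<bar>1/2\<bar> * t) \<le> C * \<Phi> t" by (rule Phi_scale) blast
      have lh: "in_LPhi (\<lambda>x. (1/2) *\<^sub>R (grad \<psi> x - Gs k x))" by (rule in_LPhi_scale[OF in_LPhi_diff[OF l\<psi>(2) l(4)] C])
      have "modular (\<lambda>x. 2 *\<^sub>R ((1/2) *\<^sub>R (grad \<psi> x - Gs k x))) \<le> q * modular (\<lambda>x. (1/2) *\<^sub>R (grad \<psi> x - Gs k x))"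
        by (rule modular_scale[OF lh]) (use Phi_double in \<open>simp add: q_def\<close>)
      also have "\<dots> \<le> q * \<epsilon>" using h q by (intro mult_left_mono) auto
      finally have g1: "modular (\<lambda>x. grad \<psi> x - Gs k x) \<le> q * \<epsilon>" by simp
      have "modular (\<lambda>x. Gs k x - G x) \<le> q * (modular (\<lambda>x. Gs k x - grad \<psi> x) + modular (\<lambda>x. grad \<psi> x - G x))"
        unfolding q_def by (rule modular_triangle[OF l(4) l\<psi>(2) l(2)])
      also have "\<dots> \<le> q * (q * \<epsilon> + \<epsilon>)"
        using g1 \<psi>(3) q modular_minus_commute[of "Gs k" "grad \<psi>"] modular_minus_commute[of "grad \<psi>" G]
        by (intro mult_left_mono add_mono) auto
      finally have R2: "modular (\<lambda>x. Gs k x - G x) \<le> q * (q + 1) * \<epsilon>" by (simp add: algebra_simps)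
      obtain \<zeta> where \<zeta>: "\<zeta> \<in> test_functions (\<Omega>s k)" "modular (\<lambda>x. vs k x - \<zeta> x) < \<epsilon>" "modular (\<lambda>x. Gs k x - grad \<zeta> x) < \<epsilon>"
        using Ps[of k] e by (auto simp: W0_pair_def)
      have \<zeta>D: "\<zeta> \<in> test_functions D" by (rule test_functions_mono[OF \<Omega>s \<zeta>(1)])
      have l\<zeta>: "in_LPhi \<zeta>" "in_LPhi (grad \<zeta>)" by (rule in_LPhi_test[OF \<zeta>D], rule in_LPhi_grad_test[OF \<zeta>D])
      have "modular (\<lambda>x. grad \<zeta> x - grad \<psi> x) \<le> q * (modular (\<lambda>x. grad \<zeta> x - Gs k x) + modular (\<lambda>x. Gs k x - grad \<psi> x))"
        unfolding q_def by (rule modular_triangle[OF l\<zeta>(2) l(4) l\<psi>(2)])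
      also have "\<dots> \<le> q * (\<epsilon> + q * \<epsilon>)"
        using g1 \<zeta>(3) q modular_minus_commute[of "Gs k" "grad \<zeta>"] modular_minus_commute[of "Gs k" "grad \<psi>"]
        by (intro mult_left_mono add_mono) auto
      finally have g2: "modular (\<lambda>x. grad \<zeta> x - grad \<psi> x) \<le> q * (q + 1) * \<epsilon>" by (simp add: algebra_simps)
      have "grad (\<lambda>x. \<zeta> x - \<psi> x) = (\<lambda>x. grad \<zeta> x - grad \<psi> x)"
        by (rule ext, rule grad_diff) (use \<zeta>D \<psi>D test_functions_smooth in auto)
      then have "modular (\<lambda>x. \<zeta> x - \<psi> x) \<le> Cp * modular (\<lambda>x. grad \<zeta> x - grad \<psi> x)"
        using Cp(2)[OF test_functions_diff[OF \<zeta>D \<psi>D]] by simp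
      also have "\<dots> \<le> Cp * (q * (q + 1) * \<epsilon>)" using g2 Cp(1) by (intro mult_left_mono) auto
      finally have f1: "modular (\<lambda>x. \<zeta> x - \<psi> x) \<le> Cp * (q * (q + 1) * \<epsilon>)" .
      have "modular (\<lambda>x. vs k x - \<psi> x) \<le> q * (modular (\<lambda>x. vs k x - \<zeta> x) + modular (\<lambda>x. \<zeta> x - \<psi> x))"
        unfolding q_def by (rule modular_triangle[OF l(3) l\<zeta>(1) l\<psi>(1)])
      also have "\<dots> \<le> q * (\<epsilon> + Cp * (q * (q + 1) * \<epsilon>))"
        using f1 \<zeta>(2) q by (intro mult_left_mono add_mono) auto
      finally have f2: "modular (\<lambda>x. vs k x - \<psi> x) \<le> q * (\<epsilon> + Cp * (q * (q + 1) * \<epsilon>))" .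
      have "modular (\<lambda>x. vs k x - v x) \<le> q * (modular (\<lambda>x. vs k x - \<psi> x) + modular (\<lambda>x. \<psi> x - v x))"
        unfolding q_def by (rule modular_triangle[OF l(3) l\<psi>(1) l(1)])
      also have "\<dots> \<le> q * (q * (\<epsilon> + Cp * (q * (q + 1) * \<epsilon>)) + \<epsilon>)"
        using f2 \<psi>(2) q modular_minus_commute[of v \<psi>] by (intro mult_left_mono add_mono) auto
      also have "\<dots> = c * \<epsilon>" by (simp add: c_def algebra_simps)
      finally show ?case using R2 by simp
    qed
  qed
  show "(\<lambda>k. modular (\<lambda>x. vs k x - v x)) \<longlonglongrightarrow> 0"
  proof (rule tendstoI)
    fix e :: real assume e: "e > 0"
    then have "e / (2 * c) > 0" using cpos by simp
    from key[OF this] show "\<forall>\<^sub>F k in sequentially. dist (modular (\<lambda>x. vs k x - v x)) 0 < e"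
    proof eventually_elim
      case (elim k)
      have "c * (e / (2 * c)) = e / 2" using cpos by simp
      then show ?case using elim e modular_nonneg[of "\<lambda>x. vs k x - v x"] by (simp add: dist_real_def)
    qed
  qed
  show "(\<lambda>k. modular (\<lambda>x. Gs k x - G x)) \<longlonglongrightarrow> 0"
  proof (rule tendstoI)
    fix e :: real assume e: "e > 0"
    have p: "q * (q + 1) > 0" using q by simp
    then have "e / (2 * (q * (q + 1))) > 0" using e by simp
    from key[OF this] show "\<forall>\<^sub>F k in sequentially. dist (modular (\<lambda>x. Gs k x - G x)) 0 < e"
    proof eventually_elim
      case (elim k)
      have "r * (e / (2 * r)) = e / 2" if "r > 0" for r :: real using that by simp
      note this[OF p]
      then show ?case using elim e modular_nonneg[of "\<lambda>x. Gs k x - G x"] unfolding dist_real_def by linarith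
    qed
  qed
qed

end

text \<open>The upper bound on \<open>t \<phi>'(t) / \<phi>(t)\<close> makes \<open>\<phi>(t) / t\<^sup>p\<close> nonincreasing, which is the doubling property.\<close>

lemma phi_doubling:
  fixes \<phi> :: "real \<Rightarrow> real"
  assumes diff: "\<And>t. t > 0 \<Longrightarrow> \<phi> differentiable (at t)"
    and growth: "\<And>t. t > 0 \<Longrightarrow> t * deriv \<phi> t / \<phi> t \<le> p"
    and pos: "\<And>t. t > 0 \<Longrightarrow> \<phi> t > 0" and t: "t > 0"
  shows "\<phi> (2 * t) \<le> 2 powr p * \<phi> t"
proof -
  have d: "(\<phi> has_real_derivative deriv \<phi> s) (at s)" if "s > 0" for s
    using diff[OF that] by (simp add: DERIV_deriv_iff_real_differentiable)
  have D: "((\<lambda>s. \<phi> s * s powr (- p)) has_real_derivative (s * deriv \<phi> s - p * \<phi> s) * s powr (- p - 1)) (at s)" if "s > 0" for s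
  proof -
    have "((\<lambda>s. \<phi> s * s powr (- p)) has_real_derivative deriv \<phi> s * s powr (- p) + (- p * s powr (- p - 1)) * \<phi> s) (at s)"
      by (rule DERIV_mult[OF d[OF that] has_real_derivative_powr[OF that]])
    moreover have "s powr (- p) = s * s powr (- p - 1)"
      using that powr_add[of s 1 "- p - 1"] by simp
    ultimately show ?thesis by (simp add: algebra_simps)
  qed
  have "\<phi> (2 * t) * (2 * t) powr (- p) \<le> \<phi> t * t powr (- p)"
  proof (rule DERIV_nonpos_imp_nonincreasing[where f="\<lambda>s. \<phi> s * s powr (- p)" and a=t and b="2 * t"])
    show "t \<le> 2 * t" using t by simp
    fix s assume s: "t \<le> s" "s \<le> 2 * t"
    then have "s > 0" using t by simp
    moreover have "s * deriv \<phi> s - p * \<phi> s \<le> 0"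
      using growth[OF \<open>s > 0\<close>] pos[OF \<open>s > 0\<close>] by (simp add: divide_le_eq)
    ultimately show "\<exists>y. ((\<lambda>s. \<phi> s * s powr (- p)) has_real_derivative y) (at s) \<and> y \<le> 0"
      using D by (intro exI conjI) (auto simp: mult_nonpos_nonneg)
  qed
  also have "(2 * t) powr (- p) = t powr (- p) / 2 powr p"
    using t by (simp add: powr_mult powr_minus field_simps)
  finally have "(\<phi> (2 * t) / 2 powr p) * t powr (- p) \<le> \<phi> t * t powr (- p)" by simp
  then have "\<phi> (2 * t) / 2 powr p \<le> \<phi> t" by (rule mult_right_le_imp_le) (use t in simp)
  then show ?thesis by (simp add: divide_le_eq mult.commute)
qed

lemma (in young) complementary_0: "\<Psi> 0 = 0"
proof (rule antisym)
  show "\<Psi> 0 \<le> 0" unfolding complementary_def by (rule cSUP_least) (auto simp: Phi_nonneg)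
qed (rule complementary_nonneg)

theorem mainTheorem2:
  fixes D \<Omega> :: "'a::euclidean_space set"
    and \<Omega>s :: "nat \<Rightarrow> 'a set"
    and \<Phi> \<phi> :: "real \<Rightarrow> real"
    and p_minus p_plus :: real
    and f u :: "'a \<Rightarrow> real"
    and us :: "nat \<Rightarrow> 'a \<Rightarrow> real"
  assumes "open D" and "bounded D"
    and "young_function \<Phi> \<phi>"
    and "\<forall>t>0. \<phi> differentiable (at t)"
    and "1 < p_minus"
    and "\<forall>t>0. p_minus \<le> t * deriv \<phi> t / \<phi> t \<and> t * deriv \<phi> t / \<phi> t \<le> p_plus"
    and "convex_on {0..} \<phi>"
    and "f \<in> orlicz_space (complementary \<Phi>) D"
    and "\<forall>k. open (\<Omega>s k) \<and> \<Omega>s k \<subseteq> D"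
    and "open \<Omega>" and "\<Omega> \<subseteq> D"
    and "(\<lambda>k. hausdorff_compl_distance (\<Omega>s k) \<Omega>) \<longlonglongrightarrow> 0"
    and "(\<lambda>k. capacity \<Phi> (\<Omega>s k - \<Omega>) D) \<longlonglongrightarrow> 0"
    and "\<forall>k. is_weak_solution \<Phi> \<phi> (\<Omega>s k) f (us k)"
    and "is_weak_solution \<Phi> \<phi> \<Omega> f u"
  shows "\<exists>r :: nat \<Rightarrow> nat. strict_mono r \<and>
           tendsto_sobolev_0 \<Phi> D (\<lambda>k. zero_extension (\<Omega>s (r k)) (us (r k))) (zero_extension \<Omega> u)"
proof -
  have Y: "\<And>t. t \<ge> 0 \<Longrightarrow> continuous (at_right t) \<phi>" "mono_on {0..} \<phi>" "\<phi> 0 = 0" "\<And>t. t > 0 \<Longrightarrow> \<phi> t > 0"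
    "\<And>t. t \<ge> 0 \<Longrightarrow> (\<phi> has_integral \<Phi> t) {0..t}"
    using assms(3) by (auto simp: young_function_def)
  interpret young \<Phi> \<phi> "2 powr p_plus"
  proof
    show "continuous_on {0..} \<phi>"
      unfolding continuous_on_eq_continuous_within
    proof
      fix t :: real assume "t \<in> {0..}"
      then consider "t = 0" | "t > 0" by force
      then show "continuous (at t within {0..}) \<phi>"
      proof cases
        case 1
        then show ?thesis using Y(1)[of 0] by (simp add: at_within_Ici_at_right)
      next
        case 2
        then have "isCont \<phi> t" using assms(4) by (simp add: differentiable_imp_continuous_within)
        then show ?thesis by (rule continuous_at_imp_continuous_at_within)
      qed
    qed
    show "\<phi> (2 * t) \<le> 2 powr p_plus * \<phi> t" if "0 \<le> t" for t
    proof (cases "t = 0")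
      case False
      then show ?thesis using that assms(4,6) Y(4) by (intro phi_doubling) auto
    qed (simp add: Y(3))
  qed (use Y assms(7) in auto)
  define F where "F x = indicator D x * f x" for x
  have Ds: "D \<in> sets lebesgue" using assms(1) by auto
  have f: "f \<in> borel_measurable (lebesgue_on D)" "(\<integral>\<^sup>+x. ennreal (\<Psi> \<bar>f x\<bar>) \<partial>lebesgue_on D) < \<infinity>"
    using assms(8) by (auto simp: orlicz_space_def)
  have Fm: "F \<in> borel_measurable lebesgue"
    using f(1) Ds by (simp add: borel_measurable_restrict_space_iff F_def[abs_def])
  interpret dirichlet_data \<Phi> \<phi> "2 powr p_plus" D F
  proof
    have "(\<integral>\<^sup>+x. ennreal (\<Psi> \<bar>f x\<bar>) \<partial>lebesgue_on D) = (\<integral>\<^sup>+x. ennreal (\<Psi> \<bar>f x\<bar>) * indicator D x \<partial>lebesgue)"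
      using Ds by (intro nn_integral_restrict_space) simp
    also have "\<dots> = (\<integral>\<^sup>+x. ennreal (norm (\<Psi> \<bar>F x\<bar>)) \<partial>lebesgue)"
      by (intro nn_integral_cong) (auto simp: F_def indicator_def complementary_0 complementary_nonneg)
    finally have "(\<integral>\<^sup>+x. ennreal (norm (\<Psi> \<bar>F x\<bar>)) \<partial>lebesgue) < \<infinity>" using f(2) by simp
    moreover have "(\<lambda>x. \<Psi> \<bar>F x\<bar>) \<in> borel_measurable lebesgue"
      using measurable_compose[OF borel_measurable_abs[OF Fm] complementary_measurable] .
    ultimately show "integrable lebesgue (\<lambda>x. \<Psi> \<bar>F x\<bar>)" by (simp add: integrable_iff_bounded)
  qed (use assms(1,2) Fm in auto)
  define vs where "vs k = zero_extension (\<Omega>s k) (us k)" for k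
  define Gs where "Gs k x = indicator (\<Omega>s k) x *\<^sub>R weak_gradient (\<Omega>s k) (us k) x" for k x
  define v where "v = zero_extension \<Omega> u"
  define G where "G x = indicator \<Omega> x *\<^sub>R weak_gradient \<Omega> u x" for x
  have sol: "weak_solution_on \<Omega>' (zero_extension \<Omega>' w) (\<lambda>x. indicator \<Omega>' x *\<^sub>R weak_gradient \<Omega>' w x)"
    if o: "open \<Omega>'" "\<Omega>' \<subseteq> D" and w: "is_weak_solution \<Phi> \<phi> \<Omega>' f w" for \<Omega>' w
  proof -
    have lm: "\<Omega>' \<in> lmeasurable" by (rule lmeasurable_open[OF bounded_subset[OF D_bounded o(2)] o(1)])
    from weak_solution_pair[OF o(1) lm o(2) w Fm[unfolded F_def]]
    show ?thesis by (simp add: weak_solution_on_def F_def)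
  qed
  have Ws: "weak_solution_on (\<Omega>s k) (vs k) (Gs k)" for k
    using sol[of "\<Omega>s k" "us k"] assms(9,14) by (simp add: vs_def Gs_def[abs_def])
  have W: "weak_solution_on \<Omega> v G"
    using sol[OF assms(10,11,15)] by (simp add: v_def G_def[abs_def])
  have sub: "\<Omega>s k \<subseteq> D" for k using assms(9) by blast
  note conv = solutions_converge[OF assms(10,11) sub assms(12,13) Ws W]
  have P: "W0_pair (\<Omega>s k) (vs k) (Gs k)" "W0_pair \<Omega> v G" for k
    using Ws[of k] W by (simp_all add: weak_solution_on_def)
  have "tendsto_sobolev_0 \<Phi> D vs v"
    by (rule tendsto_sobolev_0I[OF D_open D_lmeasurable sub assms(11) P conv])
  then have "tendsto_sobolev_0 \<Phi> D (\<lambda>k. zero_extension (\<Omega>s (id k)) (us (id k))) (zero_extension \<Omega> u)"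
    by (simp add: vs_def[abs_def] v_def)
  \<comment> \<open>The whole sequence converges.\<close>
  moreover have "strict_mono (id :: nat \<Rightarrow> nat)" by (simp add: strict_mono_def)
  ultimately show ?thesis by blast
qed

end
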